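(* Let $1<k<\frac{2}{\sqrt 3}$ and let $F_4:\mathbb{R}^2\to\mathbb{R}^2$ be given by $$F_4(x,y)=\left(-\frac{ky^3}{1+x^2+y^2},\ \frac{kx^3}{1+x^2+y^2}\right).$$ Then a $\mathbb{Z}_4$ universal unfolding, under $\mathbb{Z}_4$-contact equivalence, of the germ at the origin of $F_4$ is given by $$G_4(x,y,\alpha,\beta,\delta)=F_4(x,y)+\alpha(x,y)+\left[\beta+\delta(x^2+y^2)\right](-y,x),$$ where the parameters $\alpha,\beta,\delta$ are real.
   Context: $\mathbb{Z}_4$ acts on $\mathbb{R}^2$ as the group generated by the rotation $R_4(x,y)=(-y,x)$. A map germ $g:(\mathbb{R}^2,0)\to\mathbb{R}^2$ (smooth) is $\mathbb{Z}_4$-equivariant if $g(\gamma x)=\gamma g(x)$ for all $\gamma\in\mathbb{Z}_4$; every such germ satisfies $g(0)=0$. Two such germs $g,h$ are $\mathbb{Z}_4$-contact-equivalent if there exist an invertible smooth $\mathbb{Z}_4$-equivariant change of coordinates germ $x\mapsto X(x)$ fixing the origin and a smooth germ $S(x)$ of $2\times 2$-matrix-valued maps satisfying $S(\gamma x)\gamma=\gamma S(x)$ for all $\gamma\in\mathbb{Z}_4$, with $S(0)$ and $dX(0)$ in the same connected component as the identity in the space of (invertible, $\mathbb{Z}_4$-equivariant) linear maps of the plane, such that $g(x)=S(x)h(X(x))$. Unfoldings are taken in the standard sense: an $\ell$-parameter $\mathbb{Z}_4$-unfolding of a $\mathbb{Z}_4$-equivariant germ $f$ is a smooth germ $G(x,\lambda)$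 at $(0,0)\in\mathbb{R}^2\times\mathbb{R}^\ell$, with $\mathbb{Z}_4$ acting trivially on $\lambda$, such that $G(\gamma x,\lambda)=\gamma G(x,\lambda)$ for all $\gamma\in\mathbb{Z}_4$ and $G(x,0)=f(x)$. An unfolding $H(x,\mu)$ of $f$ factors through $G$ if there are smooth germs $S(x,\mu)$, $X(x,\mu)$, $\Lambda(\mu)$ with $S(\gamma x,\mu)\gamma=\gamma S(x,\mu)$ and $X(\gamma x,\mu)=\gamma X(x,\mu)$ for all $\gamma\in\mathbb{Z}_4$, $S(x,0)=I$, $X(x,0)=x$, $\Lambda(0)=0$, and $H(x,\mu)=S(x,\mu)\,G(X(x,\mu),\Lambda(\mu))$. The unfolding $G$ is versal if every $\mathbb{Z}_4$-unfolding of $f$ factors through $G$, and universal if it is versal with the minimum possible number of parameters. *)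

theory Defs
  imports "HOL-Analysis.Analysis"
begin

text \<open>
  The plane is \<^typ>\<open>real^2\<close>. Unfoldings with different numbers of parameters have to be compared
  with each other, so parameter spaces are the spaces \<^term>\<open>Euclidean_space l\<close> of the library,
  whose points are the \<mu> :: \<^typ>\<open>nat \<Rightarrow> real\<close> with \<mu> i = 0 for all i \<ge> l.

  Germs are represented by total functions. Only the values at points of the respective spaces
  close to the origin matter, and every identity between germs is required only there.
\<close>

primrec Ck_on :: "nat \<Rightarrow> nat \<Rightarrow> (nat \<Rightarrow> real) set \<Rightarrow> ((nat \<Rightarrow> real) \<Rightarrow> 'b::real_normed_vector) \<Rightarrow> bool"
where
  "Ck_on n 0 U f \<longleftrightarrow> continuous_map (subtopology (Euclidean_space n) U) euclidean f"
| "Ck_on n (Suc k) U f \<longleftrightarrow>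
     continuous_map (subtopology (Euclidean_space n) U) euclidean f \<and>
     (\<exists>D. \<forall>i<n.
        (\<forall>p\<in>U. ((\<lambda>t. f (p(i := t))) has_vector_derivative D i p) (at (p i))) \<and>
        Ck_on n k U (D i))"

definition smooth_germ :: "nat \<Rightarrow> ((nat \<Rightarrow> real) \<Rightarrow> 'b::real_normed_vector) \<Rightarrow> bool" where
  "smooth_germ n f \<longleftrightarrow>
     (\<exists>U. openin (Euclidean_space n) U \<and> (\<lambda>_. 0) \<in> U \<and> (\<forall>k. Ck_on n k U f))"

text \<open>
  Germs at (0,0) of maps of (x,\<mu>) \<in> R^2 \<times> R^l. For joint smoothness, a point of the product is
  listed as (x 1, x 2, \<mu> 0, \<dots>, \<mu> (l - 1)).
\<close>

definition smooth_family_germ ::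
  "nat \<Rightarrow> (real^2 \<Rightarrow> (nat \<Rightarrow> real) \<Rightarrow> 'b::real_normed_vector) \<Rightarrow> bool" where
  "smooth_family_germ l G \<longleftrightarrow>
     smooth_germ (l + 2) (\<lambda>p. G (vector [p 0, p 1]) (\<lambda>i. p (i + 2)))"

definition param_nhds :: "nat \<Rightarrow> (nat \<Rightarrow> real) filter" where
  "param_nhds l = nhdsin (Euclidean_space l) (\<lambda>_. 0)"

definition family_nhds :: "nat \<Rightarrow> ((real^2) \<times> (nat \<Rightarrow> real)) filter" where
  "family_nhds l = nhdsin (prod_topology euclidean (Euclidean_space l)) (0, \<lambda>_. 0)"

definition smooth_param_map_germ :: "nat \<Rightarrow> nat \<Rightarrow> ((nat \<Rightarrow> real) \<Rightarrow> (nat \<Rightarrow> real)) \<Rightarrow> bool" where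
  "smooth_param_map_germ m l \<Lambda> \<longleftrightarrow>
     (\<forall>\<^sub>F \<mu> in param_nhds m. \<Lambda> \<mu> \<in> topspace (Euclidean_space l)) \<and>
     (\<forall>i<l. smooth_germ m (\<lambda>\<mu>. \<Lambda> \<mu> i))"

definition R4 :: "real^2^2" where
  "R4 = vector [vector [0, -1], vector [1, 0]]"

text \<open>Since \<^term>\<open>R4\<close> has finite order, its powers with natural exponents form the group it generates.\<close>

definition Z4 :: "(real^2^2) set" where
  "Z4 = range (\<lambda>n. (((**) R4) ^^ n) (mat 1))"

definition equivariant_family :: "nat \<Rightarrow> (real^2 \<Rightarrow> (nat \<Rightarrow> real) \<Rightarrow> real^2) \<Rightarrow> bool" where
  "equivariant_family l G \<longleftrightarrow>
     (\<forall>\<gamma>\<in>Z4. \<forall>\<^sub>F (x, \<mu>) in family_nhds l. G (\<gamma> *v x) \<mu> = \<gamma> *v G x \<mu>)"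

definition equivariant_matrix_family :: "nat \<Rightarrow> (real^2 \<Rightarrow> (nat \<Rightarrow> real) \<Rightarrow> real^2^2) \<Rightarrow> bool" where
  "equivariant_matrix_family l S \<longleftrightarrow>
     (\<forall>\<gamma>\<in>Z4. \<forall>\<^sub>F (x, \<mu>) in family_nhds l. S (\<gamma> *v x) \<mu> ** \<gamma> = \<gamma> ** S x \<mu>)"

definition Z4_unfolding ::
  "nat \<Rightarrow> (real^2 \<Rightarrow> real^2) \<Rightarrow> (real^2 \<Rightarrow> (nat \<Rightarrow> real) \<Rightarrow> real^2) \<Rightarrow> bool" where
  "Z4_unfolding l f G \<longleftrightarrow>
     smooth_family_germ l G \<and> equivariant_family l G \<and>
     (\<forall>\<^sub>F x in nhds 0. G x (\<lambda>_. 0) = f x)"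

text \<open>
  factors_through m H l G: the m-parameter unfolding H factors, under Z4-contact equivalence,
  through the l-parameter unfolding G.
\<close>

definition factors_through ::
  "nat \<Rightarrow> (real^2 \<Rightarrow> (nat \<Rightarrow> real) \<Rightarrow> real^2) \<Rightarrow>
   nat \<Rightarrow> (real^2 \<Rightarrow> (nat \<Rightarrow> real) \<Rightarrow> real^2) \<Rightarrow> bool" where
  "factors_through m H l G \<longleftrightarrow>
     (\<exists>S X \<Lambda>.
        smooth_family_germ m S \<and> equivariant_matrix_family m S \<and>
        (\<forall>\<^sub>F x in nhds 0. S x (\<lambda>_. 0) = mat 1) \<and>
        smooth_family_germ m X \<and> equivariant_family m X \<and>
        (\<forall>\<^sub>F x in nhds 0. X x (\<lambda>_. 0) = x) \<and>
        smooth_param_map_germ m l \<Lambda> \<and> \<Lambda> (\<lambda>_. 0) = (\<lambda>_. 0) \<and>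
        (\<forall>\<^sub>F (x, \<mu>) in family_nhds m. H x \<mu> = S x \<mu> *v G (X x \<mu>) (\<Lambda> \<mu>)))"

definition Z4_versal_unfolding ::
  "nat \<Rightarrow> (real^2 \<Rightarrow> real^2) \<Rightarrow> (real^2 \<Rightarrow> (nat \<Rightarrow> real) \<Rightarrow> real^2) \<Rightarrow> bool" where
  "Z4_versal_unfolding l f G \<longleftrightarrow>
     Z4_unfolding l f G \<and>
     (\<forall>m H. Z4_unfolding m f H \<longrightarrow> factors_through m H l G)"

definition Z4_universal_unfolding ::
  "nat \<Rightarrow> (real^2 \<Rightarrow> real^2) \<Rightarrow> (real^2 \<Rightarrow> (nat \<Rightarrow> real) \<Rightarrow> real^2) \<Rightarrow> bool" where
  "Z4_universal_unfolding l f G \<longleftrightarrow>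
     Z4_versal_unfolding l f G \<and>
     (\<forall>l' G'. Z4_versal_unfolding l' f G' \<longrightarrow> l \<le> l')"

definition F4 :: "real \<Rightarrow> real^2 \<Rightarrow> real^2" where
  "F4 k v = (let x = v $ 1; y = v $ 2 in
     vector [- (k * y ^ 3 / (1 + x\<^sup>2 + y\<^sup>2)), k * x ^ 3 / (1 + x\<^sup>2 + y\<^sup>2)])"

definition G4 :: "real \<Rightarrow> real^2 \<Rightarrow> real \<Rightarrow> real \<Rightarrow> real \<Rightarrow> real^2" where
  "G4 k v \<alpha> \<beta> \<delta> = (let x = v $ 1; y = v $ 2 in
     F4 k v + \<alpha> *\<^sub>R vector [x, y] + (\<beta> + \<delta> * (x\<^sup>2 + y\<^sup>2)) *\<^sub>R vector [- y, x])"

end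

theory Submission
  imports Defs
begin

text \<open>
  In the complex coordinate \<open>z = x + iy\<close>, with \<open>N = z cnj z\<close>, the map \<open>F\<^sub>4\<close> is
  \<open>c(N) (cnj z ^ 3 + 3 N z)\<close> with \<open>c(N) = ik / (4 (1 + N))\<close>, and an equivariant matrix acts as
  \<open>w \<mapsto> \<sigma> w + \<tau> cnj w\<close>, where \<open>\<sigma>\<close> is invariant under the quarter turn and \<open>\<tau>\<close> changes sign.

  Versality. The family to compare with is \<open>model l0 l1 z = cnj z ^ 3 + (l0 + l1 N) z\<close>, with complex
  coefficients \<open>l0\<close> near 0 and \<open>l1\<close> near 3. Write \<open>G\<close> for a member of it, \<open>P = l0 + l1 N\<close>, and work
  modulo combinations of \<open>G\<close> and \<open>cnj G\<close>. Then \<open>cnj z ^ 3\<close> is \<open>- P z\<close>; multiplying \<open>G\<close> and \<open>cnj G\<close>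
  by suitable quadratic monomials gives \<open>z ^ 5 = - cnj P N z\<close> and \<open>N\<^sup>2 z = P cnj P z\<close>
  (\<open>syzygy_linear\<close>, \<open>syzygy_quadratic\<close>). As every smooth equivariant germ is \<open>A z + B cnj z ^ 3\<close>
  with \<open>A\<close>, \<open>B\<close> smooth functions of \<open>N\<close> and \<open>(x\<^sup>2 - y\<^sup>2)\<^sup>2\<close> (\<open>equivariant_normal_form\<close>), it is first
  reduced to a function of \<open>N\<close> times \<open>z\<close>, and then, since \<open>|l1| \<noteq> 1\<close> makes \<open>N\<^sup>2 = P cnj P\<close> a
  quadratic equation for \<open>N\<close> with real coefficients, to \<open>(r0 + r1 N) z\<close> with \<open>r0\<close>, \<open>r1\<close>
  independent of \<open>z\<close> (\<open>division\<close>). Both \<open>equivariant_normal_form\<close> and the division by the quadratic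
  rest on Whitney's theorem on even functions, with parameters (\<open>whitney_even\<close>): a smooth even
  function of \<open>t\<close> is a smooth function of \<open>t\<^sup>2\<close>, which is extended to negative arguments by a
  series of reflections.

  Dividing an unfolding of \<open>F\<^sub>4\<close> by the model with undetermined coefficients and choosing these so
  that the remainder disappears (\<open>reduction\<close>, by the implicit function theorem \<open>ift\<close>) shows that
  every unfolding is a multiple of a model whose coefficients depend smoothly on the parameters.
  These are four real coefficients, one more than \<open>\<alpha>\<close>, \<open>\<beta>\<close>, \<open>\<delta>\<close>; the fourth is absorbed by a
  rotation of the plane. Indeed the members of \<open>G\<^sub>4\<close>, rotated by an angle \<open>\<theta>\<close>, are multiples of
  models, and \<open>\<alpha>\<close>, \<open>\<beta>\<close>, \<open>\<delta>\<close> and \<open>exp (4i\<theta>)\<close> are explicit functions of \<open>l0\<close> and \<open>l1\<close>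
  (\<open>G4_as_model\<close>). The two multipliers combine to the required factorisation (\<open>G4_versal\<close>).

  Minimality. If \<open>G\<^sub>4\<close> factors through an unfolding with fewer than three parameters, then the map
  of the parameters is stationary in some direction of the \<open>(\<alpha>, \<beta>, \<delta>)\<close> space. Differentiating the
  factorisation in that direction exhibits \<open>\<alpha> z + (\<beta> + \<delta> N) i z\<close> in the form
  \<open>A F\<^sub>4 + dF\<^sub>4 X\<close> with \<open>X(0) = 0\<close>. The terms of order one give \<open>\<alpha> = \<beta> = 0\<close>; the coefficient
  of \<open>x y\<^sup>2\<close> in the second component, which is \<open>\<delta>\<close> on one side and 0 on the other, gives \<open>\<delta> = 0\<close>
  (\<open>versal_needs_three_parameters\<close>).
\<close>

section \<open>Germs at the origin and cubes\<close>

text \<open>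
  Cubes form a neighbourhood base of 0 in R^n and are stable under changing, scaling or deleting a
  single coordinate, which makes them convenient common domains for partial derivatives.
\<close>

definition cube :: "nat \<Rightarrow> real \<Rightarrow> (nat \<Rightarrow> real) set" where
  "cube n e = {p. (\<forall>i<n. \<bar>p i\<bar> < e) \<and> (\<forall>i\<ge>n. p i = 0)}"

text \<open>
  A point of R^n is a function on all of nat that vanishes from n on; this makes the point with
  prescribed first coordinates.
\<close>

definition tup :: "nat \<Rightarrow> (nat \<Rightarrow> real) \<Rightarrow> nat \<Rightarrow> real" where
  "tup n h = (\<lambda>i. if i < n then h i else 0)"

abbreviation has_partial ::
  "((nat \<Rightarrow> real) \<Rightarrow> 'b::real_normed_vector) \<Rightarrow> nat \<Rightarrow> 'b \<Rightarrow> (nat \<Rightarrow> real) \<Rightarrow> bool" where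
  "has_partial f i d p \<equiv> ((\<lambda>t. f (p(i := t))) has_vector_derivative d) (at (p i))"

lemma tup_id: "p \<in> cube n e \<Longrightarrow> tup n p = p"
  by (auto simp: tup_def cube_def fun_eq_iff not_less)

lemma cube_upd: "p \<in> cube n e \<Longrightarrow> i < n \<Longrightarrow> p(i := t) \<in> cube n e \<longleftrightarrow> \<bar>t\<bar> < e"
  by (auto simp: cube_def)

lemma cube_mono: "d \<le> e \<Longrightarrow> cube n d \<subseteq> cube n e"
  by (force simp: cube_def)

lemma zero_in_cube: "0 < e \<Longrightarrow> (\<lambda>_. 0) \<in> cube n e"
  by (auto simp: cube_def)

lemma tup_in_cube: "tup n h \<in> cube n e \<longleftrightarrow> (\<forall>i<n. \<bar>h i\<bar> < e)"
  by (auto simp: tup_def cube_def)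

lemma topspace_E: "topspace (Euclidean_space n) = {x. \<forall>i\<ge>n. x i = 0}"
  by (simp add: topspace_Euclidean_space)

lemma Euclidean_space_alt: "Euclidean_space n = subtopology euclidean {x. \<forall>i\<ge>n. x i = 0}"
  by (simp add: Euclidean_space_def euclidean_product_topology)

lemma continuous_map_sub_E:
  "continuous_map (subtopology (Euclidean_space n) U) euclidean f
     \<longleftrightarrow> continuous_on (U \<inter> {x. \<forall>i\<ge>n. x i = 0}) f"
  by (simp add: Euclidean_space_alt subtopology_subtopology Int_commute)

lemma cube_subset_E: "cube n e \<inter> {x. \<forall>i\<ge>n. x i = 0} = cube n e"
  by (auto simp: cube_def)

text \<open>
  A basic open set of the product topology constrains finitely many coordinates only. Those
  beyond n are kept equal because the boxes are to lie in a translate of R^n.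
\<close>

lemma open_contains_box:
  fixes T :: "(nat \<Rightarrow> real) set"
  assumes "open T" "p \<in> T"
  shows "\<exists>d>0. \<forall>q. (\<forall>i<n. \<bar>q i - p i\<bar> < d) \<and> (\<forall>i\<ge>n. q i = p i) \<longrightarrow> q \<in> T"
proof -
  have "openin (product_topology (\<lambda>i. euclidean) UNIV) T"
    using assms by (simp add: euclidean_product_topology)
  from product_topology_open_contains_basis[OF this assms(2)]
  have "\<exists>X. p \<in> (\<Pi>\<^sub>E i\<in>UNIV. X i) \<and> (\<forall>i. open (X i)) \<and> finite {i. X i \<noteq> UNIV} \<and> (\<Pi>\<^sub>E i\<in>UNIV. X i) \<subseteq> T"
    by simp
  then obtain X where X: "p \<in> (\<Pi>\<^sub>E i\<in>UNIV. X i)" "\<And>i. open (X i)"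
    "finite {i. X i \<noteq> UNIV}" "(\<Pi>\<^sub>E i\<in>UNIV. X i) \<subseteq> T" by auto
  have "\<exists>d>0. \<forall>y. \<bar>y - p i\<bar> < d \<longrightarrow> y \<in> X i" for i
  proof -
    have "p i \<in> X i" using X(1) by auto
    then obtain d where "d > 0" "ball (p i) d \<subseteq> X i" using X(2) openE by blast
    then show ?thesis by (intro exI[of _ d]) (auto simp: subset_iff dist_real_def abs_minus_commute)
  qed
  then obtain d where d: "\<And>i. d i > 0" "\<And>i y. \<bar>y - p i\<bar> < d i \<Longrightarrow> y \<in> X i" by metis
  define m where "m = Min (insert 1 (d ` {..<n}))"
  have "m > 0" unfolding m_def using d(1) by (subst Min_gr_iff) auto
  moreover have "q \<in> T" if "\<forall>i<n. \<bar>q i - p i\<bar> < m" "\<forall>i\<ge>n. q i = p i" for q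
  proof -
    have "q i \<in> X i" for i
    proof (cases "i < n")
      case True
      then have "m \<le> d i" unfolding m_def by (intro Min_le) auto
      then show ?thesis using that(1) True d(2) by force
    next
      case False
      then show ?thesis using that(2) d by force
    qed
    then show ?thesis using X(4) by (auto simp: PiE_iff)
  qed
  ultimately show ?thesis by blast
qed

lemma continuous_on_tup_coords:
  "continuous_on S f \<longleftrightarrow> (\<forall>i. continuous_on S (\<lambda>x. f x i :: real))" for f :: "'a::topological_space \<Rightarrow> nat \<Rightarrow> real"
  by (metis continuous_on_coordinatewise_then_product continuous_on_product_then_coordinatewise)

lemma openin_cube: "openin (Euclidean_space n) (cube n e)"
proof -
  have "open (\<Inter>i\<in>{..<n}. (\<lambda>p::nat\<Rightarrow>real. p i) -` {-e<..<e})"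
    by (intro open_INT open_vimage ballI continuous_intros continuous_on_product_coordinates) auto
  moreover have "cube n e = (\<Inter>i\<in>{..<n}. (\<lambda>p::nat\<Rightarrow>real. p i) -` {-e<..<e}) \<inter> {x. \<forall>i\<ge>n. x i = 0}"
    by (auto simp: cube_def abs_less_iff) 
  ultimately show ?thesis unfolding Euclidean_space_alt openin_subtopology by auto
qed

lemma open_E_contains_cube:
  assumes "openin (Euclidean_space n) U" "(\<lambda>_. 0) \<in> U"
  shows "\<exists>e>0. cube n e \<subseteq> U"
proof -
  obtain T where T: "open T" "U = T \<inter> {x. \<forall>i\<ge>n. x i = 0}"
    using assms(1) unfolding Euclidean_space_alt openin_subtopology by auto
  then obtain d where "d > 0" "\<forall>q. (\<forall>i<n. \<bar>q i - 0\<bar> < d) \<and> (\<forall>i\<ge>n. q i = 0) \<longrightarrow> q \<in> T"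
    using open_contains_box[of T "\<lambda>_. 0" n] assms(2) by blast
  then show ?thesis using T by (intro exI[of _ d]) (auto simp: cube_def)
qed

lemma eventually_param_nhds:
  "eventually P (param_nhds n) \<longleftrightarrow> (\<exists>e>0. \<forall>p\<in>cube n e. P p)"
proof
  assume "eventually P (param_nhds n)"
  then obtain S where "openin (Euclidean_space n) S" "(\<lambda>_. 0) \<in> S" "\<forall>x\<in>S. P x"
    unfolding param_nhds_def eventually_nhdsin by (auto simp: topspace_E)
  moreover obtain e where "e > 0" "cube n e \<subseteq> S" using open_E_contains_cube calculation by blast
  ultimately show "\<exists>e>0. \<forall>p\<in>cube n e. P p" by (intro exI[of _ e]) auto
next
  assume "\<exists>e>0. \<forall>p\<in>cube n e. P p"
  then show "eventually P (param_nhds n)"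
    unfolding param_nhds_def eventually_nhdsin using openin_cube[of n] zero_in_cube[of _ n] by metis
qed

lemma continuous_on_cube_eps_delta:
  fixes f :: "(nat \<Rightarrow> real) \<Rightarrow> 'b::real_normed_vector"
  assumes "continuous_on (cube n e) f" "p \<in> cube n e" "\<epsilon> > 0"
  shows "\<exists>d>0. \<forall>q\<in>cube n e. (\<forall>i<n. \<bar>q i - p i\<bar> < d) \<longrightarrow> norm (f q - f p) < \<epsilon>"
proof -
  obtain A where A: "open A" "A \<inter> cube n e = f -` ball (f p) \<epsilon> \<inter> cube n e"
    using assms(1) by (metis continuous_on_open_invariant open_ball)
  then have "p \<in> A" using assms by auto
  from open_contains_box[OF A(1) this, of n] obtain d where
    d: "d > 0" "\<forall>q. (\<forall>i<n. \<bar>q i - p i\<bar> < d) \<and> (\<forall>i\<ge>n. q i = p i) \<longrightarrow> q \<in> A" by blast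
  show ?thesis
  proof (intro exI[of _ d] conjI ballI impI d)
    fix q assume q: "q \<in> cube n e" "\<forall>i<n. \<bar>q i - p i\<bar> < d"
    then have "q \<in> A" using d(2) assms(2) by (auto simp: cube_def)
    then have "f q \<in> ball (f p) \<epsilon>" using A q by auto
    then show "norm (f q - f p) < \<epsilon>" by (simp add: dist_norm norm_minus_commute)
  qed
qed

definition smooth_cube :: "nat \<Rightarrow> real \<Rightarrow> ((nat \<Rightarrow> real) \<Rightarrow> 'b::real_normed_vector) \<Rightarrow> bool" where
  "smooth_cube n e f \<longleftrightarrow> (\<forall>k. Ck_on n k (cube n e) f)"

lemma Ck_subset: "Ck_on n k U f \<Longrightarrow> V \<subseteq> U \<Longrightarrow> Ck_on n k V f"
proof (induction k arbitrary: f)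
  case 0
  then show ?case by (auto simp: continuous_map_sub_E elim: continuous_on_subset)
next
  case (Suc k)
  then have "continuous_map (subtopology (Euclidean_space n) V) euclidean f"
    by (auto simp: continuous_map_sub_E elim!: continuous_on_subset)
  moreover obtain D where "\<forall>i<n. (\<forall>p\<in>U. has_partial f i (D i p) p) \<and> Ck_on n k U (D i)"
    using Suc.prems by auto
  ultimately show ?case using Suc.IH Suc.prems(2) by (simp, intro exI[of _ D]) (auto simp: subset_iff)
qed

lemma smooth_germ_iff: "smooth_germ n f \<longleftrightarrow> (\<exists>e>0. smooth_cube n e f)"
  unfolding smooth_germ_def smooth_cube_def
  using open_E_contains_cube openin_cube zero_in_cube Ck_subset by metis

lemma smooth_cube_mono: "smooth_cube n e f \<Longrightarrow> d \<le> e \<Longrightarrow> smooth_cube n d f"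
  unfolding smooth_cube_def using Ck_subset cube_mono by metis

lemma Ck_0: "Ck_on n 0 (cube n e) f \<longleftrightarrow> continuous_on (cube n e) f"
  by (simp add: continuous_map_sub_E cube_subset_E)

lemma Ck_Suc: "Ck_on n (Suc k) (cube n e) f \<longleftrightarrow> continuous_on (cube n e) f \<and>
     (\<exists>D. \<forall>i<n. (\<forall>p\<in>cube n e. has_partial f i (D i p) p) \<and>
        Ck_on n k (cube n e) (D i))"
  by (simp add: continuous_map_sub_E cube_subset_E)

lemma Ck_cont: "Ck_on n k (cube n e) f \<Longrightarrow> continuous_on (cube n e) f"
  by (cases k) (simp_all only: Ck_0 Ck_Suc)

lemma Ck_mono: "Ck_on n (Suc k) (cube n e) f \<Longrightarrow> Ck_on n k (cube n e) f"
proof (induction k arbitrary: f)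
  case 0
  then show ?case by (simp only: Ck_0 Ck_Suc)
next
  case (Suc k)
  then show ?case unfolding Ck_Suc[of n "Suc k"] Ck_Suc[of n k] by metis
qed

lemma partial_cong:
  assumes "\<And>q. q \<in> cube n e \<Longrightarrow> f q = g q" "p \<in> cube n e" "i < n"
    "has_partial f i D p"
  shows "has_partial g i D p"
proof -
  have "\<bar>p i\<bar> < e" using assms(2,3) by (auto simp: cube_def)
  then show ?thesis
    by (intro has_vector_derivative_transform_within_open[OF assms(4), of "{-e<..<e}"] assms(1))
       (use assms(2,3) in \<open>auto simp: cube_upd abs_less_iff\<close>)
qed

lemma Ck_cong:
  assumes "\<And>q. q \<in> cube n e \<Longrightarrow> f q = g q" "Ck_on n k (cube n e) f"
  shows "Ck_on n k (cube n e) g"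
proof (cases k)
  case 0
  then show ?thesis using assms by (simp only: Ck_0) (metis continuous_on_cong)
next
  case (Suc k)
  have "continuous_on (cube n e) g" using Ck_cont[OF assms(2)] assms(1) by (metis continuous_on_cong)
  then show ?thesis using assms(2) partial_cong[of n e f g, OF assms(1)] unfolding Suc Ck_Suc by metis
qed

lemma smooth_cube_cong:
  assumes "smooth_cube n e f" "\<And>q. q \<in> cube n e \<Longrightarrow> f q = g q"
  shows "smooth_cube n e g"
  using assms Ck_cong unfolding smooth_cube_def by metis

lemma smooth_cube_cont: "smooth_cube n e f \<Longrightarrow> continuous_on (cube n e) f"
  using Ck_cont smooth_cube_def by blast

text \<open>
  Differentiability of each order comes with its own choice of derivatives; on the cube they
  agree, by uniqueness, so that one choice serves all orders.
\<close>

lemma smooth_cube_partials: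
  assumes "smooth_cube n e f"
  obtains D where "\<And>i p. i < n \<Longrightarrow> p \<in> cube n e \<Longrightarrow>
      has_partial f i (D i p) p"
    "\<And>i. i < n \<Longrightarrow> smooth_cube n e (D i)"
proof -
  have "\<forall>k. \<exists>D. \<forall>i<n. (\<forall>p\<in>cube n e. has_partial f i (D i p) p) \<and>
        Ck_on n k (cube n e) (D i)"
    using assms unfolding smooth_cube_def by (metis Ck_Suc)
  then obtain D where D: "\<And>k i p. i < n \<Longrightarrow> p \<in> cube n e \<Longrightarrow> has_partial f i (D k i p) p"
    "\<And>k i. i < n \<Longrightarrow> Ck_on n k (cube n e) (D k i)" by metis
  have "D k i p = D 0 i p" if "i < n" "p \<in> cube n e" for k i p
    using D(1)[OF that] vector_derivative_unique_at by metis
  then have "Ck_on n k (cube n e) (D 0 i)" if "i < n" for i k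
    using Ck_cong[OF _ D(2)[OF that]] that by metis
  then show ?thesis using D(1) that unfolding smooth_cube_def by metis
qed

text \<open>
  Smoothness of functions given by integrals or series is shown through this principle: there a
  partial derivative is again a function of the same kind, and a single differentiation suffices.
\<close>

lemma smooth_cube_closure:
  assumes "R f"
    and "\<And>f. R f \<Longrightarrow> continuous_on (cube n e) f"
    and "\<And>f i. R f \<Longrightarrow> i < n \<Longrightarrow> \<exists>g. R g \<and>
       (\<forall>p\<in>cube n e. has_partial f i (g p) p)"
  shows "smooth_cube n e f"
proof -
  have "Ck_on n k (cube n e) f" for k
    using assms(1)
  proof (induction k arbitrary: f)
    case 0
    then show ?case using assms(2) by (simp only: Ck_0)
  next
    case (Suc k)
    obtain D where "\<And>i. i < n \<Longrightarrow> R (D i) \<and>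
       (\<forall>p\<in>cube n e. has_partial f i (D i p) p)"
      using assms(3)[OF Suc.prems] by metis
    then show ?case unfolding Ck_Suc using Suc assms(2) by blast
  qed
  then show ?thesis by (simp add: smooth_cube_def)
qed

section \<open>Sums, products, quotients and compositions of smooth functions\<close>

lemma Ck_const: "Ck_on n k (cube n e) (\<lambda>_. c)"
proof (induction k arbitrary: c)
  case 0 then show ?case by (simp only: Ck_0) simp
next
  case (Suc k)
  show ?case unfolding Ck_Suc by (auto intro!: exI[of _ "\<lambda>_ _. 0"] Suc)
qed

lemma Ck_proj: "Ck_on n k (cube n e) (\<lambda>p. p i)"
proof (cases k)
  case 0 then show ?thesis by (simp only: Ck_0) (metis continuous_on_product_coordinates continuous_on_subset subset_UNIV)
next
  case (Suc k)
  have "((\<lambda>t. (p(j := t)) i) has_vector_derivative (if i = j then 1 else 0)) (at (p j))" for p :: "nat \<Rightarrow> real" and j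
    by (auto)
  moreover have "continuous_on (cube n e) (\<lambda>p. p i)" by (metis continuous_on_product_coordinates continuous_on_subset subset_UNIV)
  ultimately show ?thesis unfolding Suc Ck_Suc
    by (intro conjI exI[of _ "\<lambda>j _. if i = j then 1 else 0"] allI impI ballI Ck_const) auto
qed

lemma Ck_linear:
  assumes "bounded_linear h" "Ck_on n k (cube n e) f"
  shows "Ck_on n k (cube n e) (\<lambda>p. h (f p))"
  using assms(2)
proof (induction k arbitrary: f)
  case 0 then show ?case by (simp only: Ck_0) (metis bounded_linear.continuous_on[OF assms(1)])
next
  case (Suc k)
  then obtain D where c: "continuous_on (cube n e) f" and D: "\<And>i p. i < n \<Longrightarrow> p \<in> cube n e \<Longrightarrow> has_partial f i (D i p) p"
    "\<And>i. i < n \<Longrightarrow> Ck_on n k (cube n e) (D i)" unfolding Ck_Suc by metis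
  show ?case unfolding Ck_Suc
    by (intro conjI exI[of _ "\<lambda>i p. h (D i p)"] allI impI ballI Suc.IH D bounded_linear.continuous_on[OF assms(1)] c
        bounded_linear.has_vector_derivative[OF assms(1)])
qed

lemma Ck_add:
  assumes "Ck_on n k (cube n e) f" "Ck_on n k (cube n e) g"
  shows "Ck_on n k (cube n e) (\<lambda>p. f p + g p)"
  using assms
proof (induction k arbitrary: f g)
  case 0 then show ?case by (simp only: Ck_0) (intro continuous_intros)
next
  case (Suc k)
  then obtain D where c: "continuous_on (cube n e) f" and D: "\<And>i p. i < n \<Longrightarrow> p \<in> cube n e \<Longrightarrow> has_partial f i (D i p) p"
    "\<And>i. i < n \<Longrightarrow> Ck_on n k (cube n e) (D i)" unfolding Ck_Suc by metis
  from Suc obtain D' where c': "continuous_on (cube n e) g" and D': "\<And>i p. i < n \<Longrightarrow> p \<in> cube n e \<Longrightarrow> has_partial g i (D' i p) p"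
    "\<And>i. i < n \<Longrightarrow> Ck_on n k (cube n e) (D' i)" unfolding Ck_Suc by metis
  show ?case unfolding Ck_Suc
    by (intro conjI exI[of _ "\<lambda>i p. D i p + D' i p"] allI impI ballI Suc.IH D D' continuous_intros c c' has_vector_derivative_add)
qed

lemma Ck_bilinear:
  assumes "bounded_bilinear h" "Ck_on n k (cube n e) f" "Ck_on n k (cube n e) g"
  shows "Ck_on n k (cube n e) (\<lambda>p. h (f p) (g p))"
  using assms(2,3)
proof (induction k arbitrary: f g)
  case 0 then show ?case by (simp only: Ck_0) (metis bounded_bilinear.continuous_on[OF assms(1)])
next
  case (Suc k)
  then obtain D where c: "continuous_on (cube n e) f" and D: "\<And>i p. i < n \<Longrightarrow> p \<in> cube n e \<Longrightarrow> has_partial f i (D i p) p"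
    "\<And>i. i < n \<Longrightarrow> Ck_on n k (cube n e) (D i)" unfolding Ck_Suc by metis
  from Suc obtain D' where c': "continuous_on (cube n e) g" and D': "\<And>i p. i < n \<Longrightarrow> p \<in> cube n e \<Longrightarrow> has_partial g i (D' i p) p"
    "\<And>i. i < n \<Longrightarrow> Ck_on n k (cube n e) (D' i)" unfolding Ck_Suc by metis
  have "((\<lambda>t. h (f (p(i := t))) (g (p(i := t)))) has_vector_derivative h (f p) (D' i p) + h (D i p) (g p)) (at (p i))"
    if "i < n" "p \<in> cube n e" for i p
    using bounded_bilinear.has_vector_derivative[OF assms(1) D(1)[OF that] D'(1)[OF that]] by simp
  then show ?case unfolding Ck_Suc
    by (intro conjI exI[of _ "\<lambda>i p. h (f p) (D' i p) + h (D i p) (g p)"] allI impI ballI Suc.IH D D' Ck_add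
       Ck_mono[OF Suc.prems(1)] Ck_mono[OF Suc.prems(2)] bounded_bilinear.continuous_on[OF assms(1)] c c') auto
qed

lemma Ck_sum:
  assumes "\<And>i. i \<in> I \<Longrightarrow> Ck_on n k (cube n e) (f i)"
  shows "Ck_on n k (cube n e) (\<lambda>p. \<Sum>i\<in>I. f i p)"
  using assms by (induction I rule: infinite_finite_induct) (auto intro: Ck_const Ck_add)

lemma vector_bound_linearization:
  fixes f :: "real \<Rightarrow> 'b::real_normed_vector"
  assumes "\<And>s. s \<in> closed_segment a b \<Longrightarrow> (f has_vector_derivative f' s) (at s)"
    and "\<And>s. s \<in> closed_segment a b \<Longrightarrow> norm (f' s - v) \<le> B"
  shows "norm (f b - f a - (b - a) *\<^sub>R v) \<le> \<bar>b - a\<bar> * B"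
proof -
  have "norm ((f b - b *\<^sub>R v) - (f a - a *\<^sub>R v)) \<le> B * norm (b - a)"
  proof (rule differentiable_bound[of "closed_segment a b" "\<lambda>s. f s - s *\<^sub>R v" "\<lambda>s h. h *\<^sub>R (f' s - v)"])
    fix s assume s: "s \<in> closed_segment a b"
    have "((\<lambda>s. f s - s *\<^sub>R v) has_vector_derivative (f' s - 1 *\<^sub>R v)) (at s)"
      using assms(1)[OF s] by (auto intro!: derivative_eq_intros)
    then show "((\<lambda>s. f s - s *\<^sub>R v) has_derivative (\<lambda>h. h *\<^sub>R (f' s - v))) (at s within closed_segment a b)"
      by (simp add: has_vector_derivative_def has_derivative_at_withinI)
    show "onorm (\<lambda>h. h *\<^sub>R (f' s - v)) \<le> B"
      using assms(2)[OF s] by (intro onorm_le) (simp add: mult.commute[of B] mult_left_mono)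
  qed auto
  then show ?thesis by (simp add: algebra_simps)
qed

text \<open>
  Continuity of the partial derivatives is enough for the chain rule: the increment is the sum of
  the increments that arise from moving one coordinate at a time, and each of these is compared
  with its linearisation by the mean value inequality.
\<close>

lemma chain_curve:
  fixes F :: "(nat \<Rightarrow> real) \<Rightarrow> 'b::real_normed_vector"
  assumes part: "\<And>i p. i < n \<Longrightarrow> p \<in> cube n e \<Longrightarrow> has_partial F i (D i p) p"
    and cont: "\<And>i. i < n \<Longrightarrow> continuous_on (cube n e) (D i)"
    and gam: "\<And>i. i < n \<Longrightarrow> (g i has_vector_derivative g' i) (at t0)"
    and in_cube: "tup n (\<lambda>i. g i t0) \<in> cube n e"
  shows "((\<lambda>t. F (tup n (\<lambda>i. g i t))) has_vector_derivative (\<Sum>i<n. g' i *\<^sub>R D i (tup n (\<lambda>i. g i t0)))) (at t0)"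
proof -
  define P where "P k t = tup n (\<lambda>i. if i < k then g i t else g i t0)" for k t
  define p where "p = tup n (\<lambda>i. g i t0)"
  have bracket: "((\<lambda>t. F (P (Suc k) t) - F (P k t)) has_vector_derivative g' k *\<^sub>R D k p) (at t0)" if k: "k < n" for k
  proof -
    have Pk: "P (Suc k) t = (P k t)(k := g k t)" "P k t k = g k t0" for t
      using k unfolding P_def tup_def fun_eq_iff by auto
    have small: "\<forall>\<^sub>F t in at t0. norm (F (P (Suc k) t) - F (P k t) - (g k t - g k t0) *\<^sub>R D k p) \<le> \<epsilon> * \<bar>g k t - g k t0\<bar>"
      if eps: "\<epsilon> > 0" for \<epsilon>
    proof -
      obtain d where d: "d > 0" "\<forall>q\<in>cube n e. (\<forall>i<n. \<bar>q i - p i\<bar> < d) \<longrightarrow> norm (D k q - D k p) < \<epsilon>"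
        using continuous_on_cube_eps_delta[OF cont[OF k] in_cube eps] unfolding p_def[symmetric] by (elim exE conjE)
      define d' where "d' = Min (insert d ((\<lambda>i. e - \<bar>p i\<bar>) ` {..<n}))"
      have "\<And>i. i < n \<Longrightarrow> \<bar>p i\<bar> < e" using in_cube by (auto simp: p_def tup_def cube_def)
      then have d': "d' > 0" "d' \<le> d" "\<And>i. i < n \<Longrightarrow> d' \<le> e - \<bar>p i\<bar>"
        using d(1) by (auto simp: d'_def)
      have "\<forall>\<^sub>F t in at t0. \<forall>i\<in>{..<n}. \<bar>g i t - g i t0\<bar> < d'"
      proof (intro eventually_ball_finite ballI)
        fix i assume "i \<in> {..<n}"
        then have "(g i \<longlongrightarrow> g i t0) (at t0)"
          using gam has_vector_derivative_continuous isCont_def by blast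
        then show "\<forall>\<^sub>F t in at t0. \<bar>g i t - g i t0\<bar> < d'"
          using d'(1) by (auto simp: tendsto_iff dist_real_def)
      qed auto
      then show ?thesis
      proof eventually_elim
        case (elim t)
        have inq: "(P k t)(k := s) \<in> cube n e \<and> (\<forall>i<n. \<bar>((P k t)(k := s)) i - p i\<bar> < d)"
          if s: "s \<in> closed_segment (g k t0) (g k t)" for s
        proof -
          have "\<bar>s - g k t0\<bar> \<le> \<bar>g k t - g k t0\<bar>" using s by (auto simp: closed_segment_eq_real_ivl split: if_splits)
          moreover have "\<bar>g k t - g k t0\<bar> < d'" using elim k by auto
          ultimately have s': "\<bar>s - g k t0\<bar> < d'" by linarith
          have "\<bar>((P k t)(k := s)) i - p i\<bar> < d'" if "i < n" for i
            using that elim s' d'(1) by (auto simp: P_def tup_def p_def)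
          moreover have "((P k t)(k := s)) i = 0" if "i \<ge> n" for i using that k by (auto simp: P_def tup_def)
          ultimately show ?thesis using d'(2,3) unfolding cube_def
            by (smt (verit) mem_Collect_eq)
        qed
        have "norm (F ((P k t)(k := g k t)) - F ((P k t)(k := g k t0)) - (g k t - g k t0) *\<^sub>R D k p) \<le> \<bar>g k t - g k t0\<bar> * \<epsilon>"
        proof (rule vector_bound_linearization)
          fix s assume s: "s \<in> closed_segment (g k t0) (g k t)"
          have "((\<lambda>u. F ((P k t)(k := s, k := u))) has_vector_derivative D k ((P k t)(k := s))) (at (((P k t)(k := s)) k))"
            using inq[OF s] by (intro part k) auto
          then show "((\<lambda>u. F ((P k t)(k := u))) has_vector_derivative D k ((P k t)(k := s))) (at s)"
            by simp
          show "norm (D k ((P k t)(k := s)) - D k p) \<le> \<epsilon>" using inq[OF s] d(2) less_imp_le by blast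
        qed
        then show ?case using Pk(1)[of t] Pk(2)[of t] by (metis fun_upd_triv mult.commute)
      qed
    qed
    have gk: "(g k has_vector_derivative g' k) (at t0)" using gam k .
    define K where "K = \<bar>g' k\<bar> + 1"
    have lip: "\<forall>\<^sub>F t in at t0. \<bar>g k t - g k t0\<bar> \<le> K * \<bar>t - t0\<bar>"
    proof -
      have "((\<lambda>t. (g k t - g k t0) / (t - t0)) \<longlongrightarrow> g' k) (at t0)"
        using gk unfolding has_real_derivative_iff_has_vector_derivative[symmetric] has_field_derivative_iff .
      then have "\<forall>\<^sub>F t in at t0. \<bar>(g k t - g k t0) / (t - t0) - g' k\<bar> < 1"
        by (auto simp: tendsto_iff dist_real_def)
      moreover have "\<forall>\<^sub>F t in at t0. t \<noteq> t0" by (simp add: eventually_neq_at_within)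
      ultimately show ?thesis
      proof eventually_elim
        case (elim t)
        then have "\<bar>(g k t - g k t0) / (t - t0)\<bar> \<le> K" by (simp add: K_def abs_if split: if_splits)
        then show ?case using elim(2) by (simp add: abs_divide divide_le_eq)
      qed
    qed
    have "K > 0" by (simp add: K_def)
    have tt: "((\<lambda>t. (F (P (Suc k) t) - F (P k t) - (g k t - g k t0) *\<^sub>R D k p) /\<^sub>R (t - t0)) \<longlongrightarrow> 0) (at t0)"
    proof (rule tendstoI)
      fix \<epsilon> :: real assume "\<epsilon> > 0"
      then have "\<epsilon> / (2 * K) > 0" using \<open>K > 0\<close> by simp
      from small[OF this] lip eventually_neq_at_within[of t0 t0 UNIV]
      show "\<forall>\<^sub>F t in at t0. dist ((F (P (Suc k) t) - F (P k t) - (g k t - g k t0) *\<^sub>R D k p) /\<^sub>R (t - t0)) 0 < \<epsilon>"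
      proof eventually_elim
        case (elim t)
        have "norm (F (P (Suc k) t) - F (P k t) - (g k t - g k t0) *\<^sub>R D k p) \<le> \<epsilon> / (2 * K) * (K * \<bar>t - t0\<bar>)"
          using elim \<open>\<epsilon> / (2 * K) > 0\<close> by (smt (verit) mult_left_mono)
        also have "\<dots> = \<epsilon> / 2 * \<bar>t - t0\<bar>" using \<open>K > 0\<close> by simp
        finally have "norm (F (P (Suc k) t) - F (P k t) - (g k t - g k t0) *\<^sub>R D k p) / \<bar>t - t0\<bar> \<le> \<epsilon> / 2"
          using elim by (simp add: divide_le_eq)
        then have "norm ((F (P (Suc k) t) - F (P k t) - (g k t - g k t0) *\<^sub>R D k p) /\<^sub>R (t - t0)) \<le> \<epsilon> / 2"
          unfolding norm_scaleR abs_inverse real_norm_def divide_inverse by (simp only: mult.commute)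
        then show ?case using \<open>\<epsilon> > 0\<close> by (simp only: dist_norm diff_0_right)
      qed
    qed
    have P0: "P (Suc k) t0 = P k t0" by (auto simp: P_def tup_def)
    have "((\<lambda>t. F (P (Suc k) t) - F (P k t) - (g k t - g k t0) *\<^sub>R D k p) has_vector_derivative 0) (at t0)"
      unfolding has_vector_derivative_def has_derivative_at_within
    proof (intro conjI)
      show "bounded_linear (\<lambda>x::real. x *\<^sub>R (0::'b))" by simp
      show "((\<lambda>y. (F (P (Suc k) y) - F (P k y) - (g k y - g k t0) *\<^sub>R D k p -
              (F (P (Suc k) t0) - F (P k t0) - (g k t0 - g k t0) *\<^sub>R D k p) -
              (y - t0) *\<^sub>R 0) /\<^sub>R norm (y - t0)) \<longlongrightarrow> 0) (at t0)"
        by (rule tendsto_norm_zero_cancel, insert tendsto_norm_zero[OF tt]) (simp add: P0)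
    qed
    from has_vector_derivative_add[OF this bounded_linear.has_vector_derivative[OF bounded_linear_scaleR_left has_vector_derivative_diff[OF gk has_vector_derivative_const[of "g k t0"]], of "D k p"]]
    show ?thesis by simp
  qed
  have tele: "F (tup n (\<lambda>i. g i t)) = F p + (\<Sum>k<n. F (P (Suc k) t) - F (P k t))" for t
  proof -
    have "P n t = tup n (\<lambda>i. g i t)" "P 0 t = p" by (auto simp: P_def tup_def p_def)
    then show ?thesis using sum_lessThan_telescope[of "\<lambda>k. F (P k t)" n] by simp
  qed
  have "((\<lambda>t. F p + (\<Sum>k<n. F (P (Suc k) t) - F (P k t))) has_vector_derivative (0 + (\<Sum>k<n. g' k *\<^sub>R D k p))) (at t0)"
    by (intro has_vector_derivative_add has_vector_derivative_const has_vector_derivative_sum bracket) auto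
  then show ?thesis unfolding p_def[symmetric] tele by simp
qed

lemma continuous_on_tup:
  assumes "\<And>i. i < n \<Longrightarrow> continuous_on S (g i)"
  shows "continuous_on S (\<lambda>q. tup n (\<lambda>i. g i q))"
  unfolding continuous_on_tup_coords
proof
  fix i show "continuous_on S (\<lambda>x. tup n (\<lambda>i. g i x) i)"
    using assms by (cases "i < n") (simp_all add: tup_def)
qed

lemma Ck_comp:
  assumes "Ck_on n k (cube n e) F" "\<And>i. i < n \<Longrightarrow> Ck_on m k (cube m d) (g i)"
    and dom: "\<And>i q. i < n \<Longrightarrow> q \<in> cube m d \<Longrightarrow> \<bar>g i q\<bar> < e"
  shows "Ck_on m k (cube m d) (\<lambda>q. F (tup n (\<lambda>i. g i q)))"
  using assms(1,2)
proof (induction k arbitrary: F)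
  case 0
  have im: "tup n (\<lambda>i. g i q) \<in> cube n e" if "q \<in> cube m d" for q using dom that by (auto simp: tup_in_cube)
  show ?case unfolding Ck_0
  proof (rule continuous_on_compose2[OF Ck_cont[OF 0(1)]])
    show "continuous_on (cube m d) (\<lambda>q. tup n (\<lambda>i. g i q))"
      by (rule continuous_on_tup) (rule Ck_cont[OF 0(2)])
  qed (use im in auto)
next
  case (Suc k)
  have im: "tup n (\<lambda>i. g i q) \<in> cube n e" if "q \<in> cube m d" for q using dom that by (auto simp: tup_in_cube)
  have c: "continuous_on (cube m d) (\<lambda>q. F (tup n (\<lambda>i. g i q)))"
  proof (rule continuous_on_compose2[OF Ck_cont[OF Suc.prems(1)]])
    show "continuous_on (cube m d) (\<lambda>q. tup n (\<lambda>i. g i q))"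
      by (rule continuous_on_tup) (rule Ck_cont[OF Suc.prems(2)])
  qed (use im in auto)
  obtain D where D: "\<And>i p. i < n \<Longrightarrow> p \<in> cube n e \<Longrightarrow> has_partial F i (D i p) p"
    "\<And>i. i < n \<Longrightarrow> Ck_on n k (cube n e) (D i)" using Suc.prems(1) unfolding Ck_Suc by metis
  obtain E where E: "\<And>i j p. i < n \<Longrightarrow> j < m \<Longrightarrow> p \<in> cube m d \<Longrightarrow> has_partial (g i) j (E i j p) p"
    "\<And>i j. i < n \<Longrightarrow> j < m \<Longrightarrow> Ck_on m k (cube m d) (E i j)" using Suc.prems(2) unfolding Ck_Suc by metis
  show ?case unfolding Ck_Suc
  proof (intro conjI c exI[of _ "\<lambda>j q. \<Sum>i<n. E i j q *\<^sub>R D i (tup n (\<lambda>i. g i q))"] allI impI ballI)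
    fix j q assume j: "j < m" "q \<in> cube m d"
    have qj: "q(j := q j) = q" by simp
    show "((\<lambda>t. F (tup n (\<lambda>i. g i (q(j := t))))) has_vector_derivative
        (\<Sum>i<n. E i j q *\<^sub>R D i (tup n (\<lambda>i. g i q)))) (at (q j))"
      using chain_curve[of n e F D "\<lambda>i t. g i (q(j := t))" "\<lambda>i. E i j q" "q j", unfolded qj, OF D(1) Ck_cont[OF D(2)] E(1)[OF _ j] im[OF j(2)]]
      by simp
  next
    fix j assume j: "j < m"
    show "Ck_on m k (cube m d) (\<lambda>q. \<Sum>i<n. E i j q *\<^sub>R D i (tup n (\<lambda>i. g i q)))"
    proof (rule Ck_sum, rule Ck_bilinear[OF bounded_bilinear_scaleR])
      fix i assume "i \<in> {..<n}"
      then have i: "i < n" by simp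
      show "Ck_on m k (cube m d) (E i j)" by (rule E(2)[OF i j])
      show "Ck_on m k (cube m d) (\<lambda>q. D i (tup n (\<lambda>i. g i q)))"
        by (rule Suc.IH[OF D(2)[OF i]]) (rule Ck_mono[OF Suc.prems(2)])
    qed
  qed
qed

lemma smooth_cube_comp:
  assumes "smooth_cube n e F" "\<And>i. i < n \<Longrightarrow> smooth_cube m d (g i)"
    and "\<And>i q. i < n \<Longrightarrow> q \<in> cube m d \<Longrightarrow> \<bar>g i q\<bar> < e"
  shows "smooth_cube m d (\<lambda>q. F (tup n (\<lambda>i. g i q)))"
  using assms Ck_comp unfolding smooth_cube_def by blast

lemma Ck_inverse:
  fixes f :: "(nat \<Rightarrow> real) \<Rightarrow> real"
  assumes "Ck_on n k (cube n e) f" "\<And>p. p \<in> cube n e \<Longrightarrow> f p \<noteq> 0"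
  shows "Ck_on n k (cube n e) (\<lambda>p. inverse (f p))"
  using assms(1)
proof (induction k)
  case 0 then show ?case using assms(2) by (simp only: Ck_0) (intro continuous_intros, auto)
next
  case (Suc k)
  then obtain D where c: "continuous_on (cube n e) f" and D: "\<And>i p. i < n \<Longrightarrow> p \<in> cube n e \<Longrightarrow> has_partial f i (D i p) p"
    "\<And>i. i < n \<Longrightarrow> Ck_on n k (cube n e) (D i)" unfolding Ck_Suc by metis
  have "((\<lambda>t. inverse (f (p(i := t)))) has_vector_derivative - 1 * ((inverse (f p) * inverse (f p)) * D i p)) (at (p i))"
    if "i < n" "p \<in> cube n e" for i p
    using DERIV_inverse'[of "\<lambda>t. f (p(i := t))" "D i p" "p i" UNIV] D(1)[OF that] assms(2)[OF that(2)]
    by (simp add: has_real_derivative_iff_has_vector_derivative mult.commute mult.left_commute)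
  moreover have "continuous_on (cube n e) (\<lambda>p. inverse (f p))"
    using assms(2) c by (intro continuous_intros) auto
  ultimately show ?case unfolding Ck_Suc
    by (intro conjI exI[of _ "\<lambda>i p. - 1 * ((inverse (f p) * inverse (f p)) * D i p)"] allI impI ballI
       Ck_bilinear[OF bounded_bilinear_mult] Ck_const Suc.IH Ck_mono[OF Suc.prems] D) auto
qed

lemma Ck_sqrt:
  assumes "Ck_on n k (cube n e) f" "\<And>p. p \<in> cube n e \<Longrightarrow> f p > 0"
  shows "Ck_on n k (cube n e) (\<lambda>p. sqrt (f p))"
  using assms(1)
proof (induction k)
  case 0 then show ?case using assms(2) by (simp only: Ck_0) (intro continuous_intros, auto)
next
  case (Suc k)
  then obtain D where c: "continuous_on (cube n e) f" and D: "\<And>i p. i < n \<Longrightarrow> p \<in> cube n e \<Longrightarrow> has_partial f i (D i p) p"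
    "\<And>i. i < n \<Longrightarrow> Ck_on n k (cube n e) (D i)" unfolding Ck_Suc by metis
  have "((\<lambda>t. sqrt (f (p(i := t)))) has_vector_derivative (1/2) * (inverse (sqrt (f p)) * D i p)) (at (p i))"
    if "i < n" "p \<in> cube n e" for i p
  proof -
    have "((\<lambda>t. f (p(i := t))) has_real_derivative D i p) (at (p i))"
      using D(1)[OF that] by (simp add: has_real_derivative_iff_has_vector_derivative)
    moreover have "f (p(i := p i)) > 0" using assms(2) that by simp
    ultimately show ?thesis unfolding has_real_derivative_iff_has_vector_derivative[symmetric]
      by (auto intro!: derivative_eq_intros simp: field_simps)
  qed
  moreover have "continuous_on (cube n e) (\<lambda>p. sqrt (f p))"
    using assms(2) c by (intro continuous_intros) auto
  moreover have "Ck_on n k (cube n e) (\<lambda>p. inverse (sqrt (f p)))"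
    by (intro Ck_inverse Suc.IH Ck_mono[OF Suc.prems]) (use assms(2) in force)
  ultimately show ?case unfolding Ck_Suc
    by (intro conjI exI[of _ "\<lambda>i p. (1/2) * (inverse (sqrt (f p)) * D i p)"] allI impI ballI
       Ck_bilinear[OF bounded_bilinear_mult] Ck_const D) auto
qed

section \<open>Calculus of smooth germs\<close>

lemma sg_cube: "smooth_germ n f \<Longrightarrow> \<exists>e>0. smooth_cube n e f"
  by (simp add: smooth_germ_iff)

lemma sgI: "0 < e \<Longrightarrow> smooth_cube n e f \<Longrightarrow> smooth_germ n f"
  by (auto simp: smooth_germ_iff)

lemma sg_cong:
  assumes "smooth_germ n f" "\<forall>\<^sub>F p in param_nhds n. f p = g p"
  shows "smooth_germ n g"
proof -
  obtain e where e: "e > 0" "smooth_cube n e f" using assms(1) sg_cube by blast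
  obtain d where d: "d > 0" "\<forall>p\<in>cube n d. f p = g p" using assms(2) by (auto simp: eventually_param_nhds)
  show ?thesis
  proof (rule sgI)
    show "0 < min e d" using e d by simp
    show "smooth_cube n (min e d) g"
      by (rule smooth_cube_cong[OF smooth_cube_mono[OF e(2)]]) (use d cube_mono[of "min e d" d n] in auto)
  qed
qed

lemma sg_const: "smooth_germ n (\<lambda>_. c)"
  by (rule sgI[of 1]) (auto simp: smooth_cube_def Ck_const)

lemma sg_proj: "smooth_germ n (\<lambda>p. p i)"
  by (rule sgI[of 1]) (auto simp: smooth_cube_def Ck_proj)

lemma sg_linear: "bounded_linear h \<Longrightarrow> smooth_germ n f \<Longrightarrow> smooth_germ n (\<lambda>p. h (f p))"
  unfolding smooth_germ_iff smooth_cube_def using Ck_linear by blast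

lemma smooth_germ_common:
  assumes "smooth_germ n f" "smooth_germ n g"
  obtains e where "e > 0" "smooth_cube n e f" "smooth_cube n e g"
proof -
  obtain d e where "d > 0" "e > 0" "smooth_cube n d f" "smooth_cube n e g" using assms sg_cube by metis
  then show ?thesis using that[of "min d e"] smooth_cube_mono by (metis min.cobounded1 min.cobounded2 min_less_iff_conj)
qed

lemma sg_add:
  assumes "smooth_germ n f" "smooth_germ n g" shows "smooth_germ n (\<lambda>p. f p + g p)"
  using smooth_germ_common[OF assms] unfolding smooth_germ_iff smooth_cube_def by (metis Ck_add)

lemma sg_bilinear:
  assumes "bounded_bilinear h" "smooth_germ n f" "smooth_germ n g" shows "smooth_germ n (\<lambda>p. h (f p) (g p))"
  using smooth_germ_common[OF assms(2,3)] Ck_bilinear[OF assms(1)] unfolding smooth_germ_iff smooth_cube_def by metis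

lemma sg_mult:
  fixes f g :: "_ \<Rightarrow> 'a::real_normed_algebra"
  shows "smooth_germ n f \<Longrightarrow> smooth_germ n g \<Longrightarrow> smooth_germ n (\<lambda>p. f p * g p)"
  by (rule sg_bilinear[OF bounded_bilinear_mult])

lemma sg_scaleR: "smooth_germ n f \<Longrightarrow> smooth_germ n g \<Longrightarrow> smooth_germ n (\<lambda>p. f p *\<^sub>R g p)"
  by (rule sg_bilinear[OF bounded_bilinear_scaleR])

lemma sg_minus: "smooth_germ n f \<Longrightarrow> smooth_germ n (\<lambda>p. - f p)"
  by (rule sg_linear[OF bounded_linear_minus[OF bounded_linear_ident]])

lemma sg_diff: "smooth_germ n f \<Longrightarrow> smooth_germ n g \<Longrightarrow> smooth_germ n (\<lambda>p. f p - g p)"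
  using sg_add[of n f "\<lambda>p. - g p"] sg_minus[of n g] by simp

lemma sg_power:
  fixes f :: "_ \<Rightarrow> 'a::real_normed_algebra_1"
  shows "smooth_germ n f \<Longrightarrow> smooth_germ n (\<lambda>p. f p ^ k)"
  by (induction k) (auto intro: sg_const sg_mult)

lemma sg_Re: "smooth_germ n f \<Longrightarrow> smooth_germ n (\<lambda>p. Re (f p))"
  by (rule sg_linear[OF bounded_linear_Re])

lemma sg_Im: "smooth_germ n f \<Longrightarrow> smooth_germ n (\<lambda>p. Im (f p))"
  by (rule sg_linear[OF bounded_linear_Im])

lemma sg_cnj: "smooth_germ n f \<Longrightarrow> smooth_germ n (\<lambda>p. cnj (f p))"
  by (rule sg_linear[OF bounded_linear_cnj])

lemma sg_of_real:
  "smooth_germ n f \<Longrightarrow> smooth_germ n (\<lambda>p. of_real (f p) :: 'a::real_normed_algebra_1)"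
  by (rule sg_linear[OF bounded_linear_of_real])

lemma sg_Complex: "smooth_germ n f \<Longrightarrow> smooth_germ n g \<Longrightarrow> smooth_germ n (\<lambda>p. Complex (f p) (g p))"
  unfolding Complex_eq by (intro sg_add sg_mult sg_const sg_of_real)

lemma sg_near:
  assumes "smooth_germ n f" "\<epsilon> > 0"
  shows "\<forall>\<^sub>F p in param_nhds n. norm (f p - f (\<lambda>_. 0)) < \<epsilon>"
proof -
  obtain e where e: "e > 0" "smooth_cube n e f" using assms(1) sg_cube by blast
  obtain d where d: "d > 0" "\<forall>q\<in>cube n e. (\<forall>i<n. \<bar>q i - 0\<bar> < d) \<longrightarrow> norm (f q - f (\<lambda>_. 0)) < \<epsilon>"
    using continuous_on_cube_eps_delta[OF smooth_cube_cont[OF e(2)] zero_in_cube[OF e(1)] assms(2)] by blast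
  show ?thesis unfolding eventually_param_nhds
    using d e cube_mono[of "min d e" e n] by (intro exI[of _ "min d e"]) (auto simp: cube_def)
qed

lemma sg_tendsto: "smooth_germ n f \<Longrightarrow> (f \<longlongrightarrow> f (\<lambda>_. 0)) (param_nhds n)"
  using sg_near by (auto simp: tendsto_iff dist_norm)

lemma param_nhds_at_0: "eventually P (param_nhds n) \<Longrightarrow> P (\<lambda>_. 0)"
  by (auto simp: eventually_param_nhds intro: zero_in_cube)

lemma eventually_in_cube: "e > 0 \<Longrightarrow> \<forall>\<^sub>F p in param_nhds n. p \<in> cube n e"
  by (auto simp: eventually_param_nhds)

lemma eventually_coord_0: "\<forall>\<^sub>F p in param_nhds n. \<forall>i\<ge>n. p i = 0"
  by (auto simp: eventually_param_nhds cube_def intro: exI[of _ 1])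

lemma sg_inverse:
  fixes f :: "_ \<Rightarrow> real"
  assumes "smooth_germ n f" "f (\<lambda>_. 0) \<noteq> 0"
  shows "smooth_germ n (\<lambda>p. inverse (f p))"
proof -
  obtain e where e: "e > 0" "smooth_cube n e f" using assms(1) sg_cube by blast
  obtain d where d: "d > 0" "\<forall>p\<in>cube n d. f p \<noteq> 0"
    using sg_near[OF assms(1), of "\<bar>f (\<lambda>_. 0)\<bar>"] assms(2) unfolding eventually_param_nhds by force
  have "smooth_cube n (min e d) f" using smooth_cube_mono[OF e(2)] by simp
  then have "smooth_cube n (min e d) (\<lambda>p. inverse (f p))"
    using d(2) cube_mono[of "min e d" d n] unfolding smooth_cube_def by (intro allI Ck_inverse) auto
  then show ?thesis by (rule sgI[rotated]) (use d e in simp)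
qed

lemma sg_divide:
  fixes f g :: "_ \<Rightarrow> real"
  shows "smooth_germ n f \<Longrightarrow> smooth_germ n g \<Longrightarrow> g (\<lambda>_. 0) \<noteq> 0 \<Longrightarrow> smooth_germ n (\<lambda>p. f p / g p)"
  unfolding divide_inverse by (intro sg_mult sg_inverse)

lemma sg_sqrt:
  assumes "smooth_germ n f" "f (\<lambda>_. 0) > 0"
  shows "smooth_germ n (\<lambda>p. sqrt (f p))"
proof -
  obtain e where e: "e > 0" "smooth_cube n e f" using assms(1) sg_cube by blast
  obtain d where d: "d > 0" "\<forall>p\<in>cube n d. f p > 0"
    using sg_near[OF assms] unfolding eventually_param_nhds by force
  have "smooth_cube n (min e d) f" using smooth_cube_mono[OF e(2)] by simp
  then have "smooth_cube n (min e d) (\<lambda>p. sqrt (f p))"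
    using d(2) cube_mono[of "min e d" d n] unfolding smooth_cube_def by (intro allI Ck_sqrt) auto
  then show ?thesis by (rule sgI[rotated]) (use d e in simp)
qed

lemma finite_common_radius:
  assumes "\<And>i. i < (n::nat) \<Longrightarrow> \<exists>d>0. Q i d" "\<And>i d d'. i < n \<Longrightarrow> Q i d \<Longrightarrow> 0 < d' \<Longrightarrow> d' \<le> d \<Longrightarrow> Q i d'"
  shows "\<exists>d>0::real. \<forall>i<n. Q i d"
proof -
  obtain d where d: "\<And>i. i < n \<Longrightarrow> d i > 0" "\<And>i. i < n \<Longrightarrow> Q i (d i)" using assms(1) by metis
  define m where "m = Min (insert 1 (d ` {..<n}))"
  have "m > 0" "\<And>i. i < n \<Longrightarrow> m \<le> d i" using d(1) by (auto simp: m_def)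
  then show ?thesis using assms(2)[OF _ d(2)] by blast
qed

lemma filterlim_tup:
  assumes "\<And>i. i < n \<Longrightarrow> (g i \<longlongrightarrow> 0) F"
  shows "filterlim (\<lambda>q. tup n (\<lambda>i. g i q)) (param_nhds n) F"
proof (unfold filterlim_iff, intro allI impI)
  fix P assume "eventually P (param_nhds n)"
  then obtain e where e: "e > 0" "\<forall>p\<in>cube n e. P p" by (auto simp: eventually_param_nhds)
  have "\<forall>\<^sub>F q in F. \<forall>i\<in>{..<n}. \<bar>g i q\<bar> < e"
    using assms e(1) by (intro eventually_ball_finite) (auto simp: tendsto_iff)
  then show "\<forall>\<^sub>F q in F. P (tup n (\<lambda>i. g i q))"
    by eventually_elim (use e(2) in \<open>auto simp: tup_in_cube\<close>)
qed

lemma filterlim_tup_germs: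
  assumes "\<And>i. i < n \<Longrightarrow> smooth_germ m (g i)" "\<And>i. i < n \<Longrightarrow> g i (\<lambda>_. 0) = 0"
  shows "filterlim (\<lambda>q. tup n (\<lambda>i. g i q)) (param_nhds n) (param_nhds m)"
proof (rule filterlim_tup)
  fix i assume "i < n"
  from sg_tendsto[OF assms(1)[OF this]] show "(g i \<longlongrightarrow> 0) (param_nhds m)"
    unfolding assms(2)[OF \<open>i < n\<close>] .
qed

lemma eventually_tup:
  assumes "eventually P (param_nhds n)" "\<And>i. i < n \<Longrightarrow> smooth_germ m (g i)" "\<And>i. i < n \<Longrightarrow> g i (\<lambda>_. 0) = 0"
  shows "\<forall>\<^sub>F q in param_nhds m. P (tup n (\<lambda>i. g i q))"
  by (rule eventually_compose_filterlim[OF assms(1) filterlim_tup_germs[OF assms(2,3)]])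

lemma sg_comp:
  assumes F: "smooth_germ n F" and g: "\<And>i. i < n \<Longrightarrow> smooth_germ m (g i)" "\<And>i. i < n \<Longrightarrow> g i (\<lambda>_. 0) = 0"
  shows "smooth_germ m (\<lambda>q. F (tup n (\<lambda>i. g i q)))"
proof -
  obtain e where e: "e > 0" "smooth_cube n e F" using F sg_cube by blast
  have "\<exists>d>0. \<forall>i<n. smooth_cube m d (g i)"
    by (rule finite_common_radius) (use g(1) sg_cube smooth_cube_mono in blast)+
  then obtain d where d: "d > 0" "\<And>i. i < n \<Longrightarrow> smooth_cube m d (g i)" by blast
  have "\<forall>\<^sub>F q in param_nhds m. tup n (\<lambda>i. g i q) \<in> cube n e"
    by (rule eventually_tup[OF eventually_in_cube[OF e(1)] g])
  then obtain d' where d': "d' > 0" "\<forall>q\<in>cube m d'. tup n (\<lambda>i. g i q) \<in> cube n e"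
    by (auto simp: eventually_param_nhds)
  have "smooth_cube m (min d d') (\<lambda>q. F (tup n (\<lambda>i. g i q)))"
  proof (rule smooth_cube_comp[OF e(2)])
    show "smooth_cube m (min d d') (g i)" if "i < n" for i using smooth_cube_mono[OF d(2)[OF that]] by simp
    show "\<bar>g i q\<bar> < e" if "i < n" "q \<in> cube m (min d d')" for i q
      using d'(2) that cube_mono[of "min d d'" d' m] by (auto simp: tup_in_cube)
  qed
  then show ?thesis by (rule sgI[rotated]) (use d d' in simp)
qed

lemma upd_tup:
  assumes "p \<in> cube n e" "i < n"
  shows "p(i := s) = tup n (\<lambda>j. if j = i then s else p j)"
  using assms by (auto simp: tup_def cube_def fun_eq_iff not_less)

lemma sg_upd:
  assumes "smooth_germ n F" "i < n" "smooth_germ n g" "g (\<lambda>_. 0) = 0"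
  shows "smooth_germ n (\<lambda>p. F (p(i := g p)))"
proof (rule sg_cong)
  show "smooth_germ n (\<lambda>p. F (tup n (\<lambda>j. (if j = i then g else (\<lambda>p. p j)) p)))"
    by (rule sg_comp[OF assms(1)]) (use assms(3,4) in \<open>auto intro: sg_proj\<close>)
  show "\<forall>\<^sub>F p in param_nhds n. F (tup n (\<lambda>j. (if j = i then g else (\<lambda>p. p j)) p)) = F (p(i := g p))"
    using eventually_in_cube[OF zero_less_one, of n] 
    by eventually_elim (simp add: upd_tup[OF _ assms(2)] if_distrib[of "\<lambda>f. f _"] cong: if_cong)
qed

lemma eventually_upd:
  assumes "eventually P (param_nhds n)" "i < n" "smooth_germ n g" "g (\<lambda>_. 0) = 0"
  shows "\<forall>\<^sub>F p in param_nhds n. P (p(i := g p))"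
proof -
  have "\<forall>\<^sub>F p in param_nhds n. P (tup n (\<lambda>j. (if j = i then g else (\<lambda>p. p j)) p))"
    by (rule eventually_tup[OF assms(1)]) (use assms(3,4) in \<open>auto intro: sg_proj\<close>)
  with eventually_in_cube[OF zero_less_one, of n] show ?thesis
    by eventually_elim (simp_all add: upd_tup[OF _ assms(2)] if_distrib[of "\<lambda>f. f _"] cong: if_cong)
qed

section \<open>Hadamard's lemma\<close>

text \<open>
  The mean of F over the segment from \<open>p(i := 0)\<close> to p. The weight \<open>u ^ a\<close> is included because
  differentiation in the direction i under the integral sign produces a factor u.
\<close>

definition avg_int :: "nat \<Rightarrow> nat \<Rightarrow> ((nat \<Rightarrow> real) \<Rightarrow> 'b::banach) \<Rightarrow> (nat \<Rightarrow> real) \<Rightarrow> 'b" where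
  "avg_int i a F p = integral (cbox 0 1) (\<lambda>u. u ^ a *\<^sub>R F (p(i := u * p i)))"

lemma abs_scaled_less: "\<bar>x\<bar> < e \<Longrightarrow> 0 \<le> u \<Longrightarrow> u \<le> 1 \<Longrightarrow> \<bar>u * x\<bar> < (e::real)"
  by (metis abs_ge_zero abs_mult abs_of_nonneg mult_left_le_one_le order.strict_trans1)

lemma scaled_in_cube:
  "p \<in> cube n e \<Longrightarrow> 0 \<le> u \<Longrightarrow> u \<le> 1 \<Longrightarrow> p(i := u * p i) \<in> cube n e"
  by (auto simp: cube_def intro: abs_scaled_less)

lemma continuous_on_avg_integrand:
  fixes F :: "(nat \<Rightarrow> real) \<Rightarrow> 'b::real_normed_vector"
  assumes "continuous_on (cube n e) F"
  shows "continuous_on (cube n e \<times> cbox (0::real) 1) (\<lambda>(p, u). u ^ a *\<^sub>R F (p(i := u * p i)))"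
proof -
  have "continuous_on (cube n e \<times> cbox (0::real) 1) (\<lambda>q. (fst q)(i := snd q * fst q i))"
    unfolding continuous_on_tup_coords
  proof
    fix j
    have c: "continuous_on (cube n e \<times> cbox (0::real) 1) (\<lambda>q. fst q j)" for j
      by (rule continuous_on_product_then_coordinatewise, rule continuous_on_fst, rule continuous_on_id)
    show "continuous_on (cube n e \<times> cbox (0::real) 1) (\<lambda>q. ((fst q)(i := snd q * fst q i)) j)"
      using c[of j] continuous_on_mult[OF continuous_on_snd[OF continuous_on_id] c[of i]] by (cases "j = i") simp_all
  qed
  then have "continuous_on (cube n e \<times> cbox (0::real) 1) (\<lambda>q. F ((fst q)(i := snd q * fst q i)))"
    by (rule continuous_on_compose2[OF assms]) (auto intro: scaled_in_cube)
  then show ?thesis unfolding split_beta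
    by (rule continuous_on_scaleR[OF continuous_on_power[OF continuous_on_snd[OF continuous_on_id]]])
qed

lemma smooth_cube_avg_int:
  assumes "smooth_cube n e F" "i < n"
  shows "smooth_cube n e (avg_int i a F)"
proof (rule smooth_cube_closure[where R = "\<lambda>G. \<exists>a F. smooth_cube n e F \<and> G = avg_int i a F"])
  show "\<exists>a' F'. smooth_cube n e F' \<and> avg_int i a F = avg_int i a' F'" using assms by blast
next
  fix G :: "(nat \<Rightarrow> real) \<Rightarrow> 'a" assume "\<exists>a F. smooth_cube n e F \<and> G = avg_int i a F"
  then obtain a F where F: "smooth_cube n e F" "G = avg_int i a F" by blast
  have "continuous_on (cube n e) (\<lambda>p. integral (cbox 0 1) (\<lambda>u. u ^ a *\<^sub>R F (p(i := u * p i))))"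
    by (rule integral_continuous_on_param[OF continuous_on_avg_integrand[OF smooth_cube_cont[OF F(1)]]])
  then show "continuous_on (cube n e) G" unfolding F(2) avg_int_def .
next
  fix G :: "(nat \<Rightarrow> real) \<Rightarrow> 'a" and j assume "\<exists>a F. smooth_cube n e F \<and> G = avg_int i a F" and j: "j < n"
  then obtain a F where F: "smooth_cube n e F" "G = avg_int i a F" by blast
  obtain D where D: "\<And>i p. i < n \<Longrightarrow> p \<in> cube n e \<Longrightarrow> has_partial F i (D i p) p"
    "\<And>i. i < n \<Longrightarrow> smooth_cube n e (D i)" using smooth_cube_partials[OF F(1)] by metis
  define b where "b = (if j = i then Suc a else a)"
  have "has_partial G j (avg_int i b (D j) p) p" if p: "p \<in> cube n e" for p
  proof -
    have pin: "p(j := x) \<in> cube n e" if "x \<in> {-e<..<e}" for x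
      using that by (simp add: cube_upd[OF p j] abs_less_iff)
    have "((\<lambda>x. integral (cbox 0 1) (\<lambda>u. u ^ a *\<^sub>R F ((p(j := x))(i := u * (p(j := x)) i))))
        has_vector_derivative integral (cbox 0 1) (\<lambda>u. u ^ b *\<^sub>R D j ((p(j := p j))(i := u * (p(j := p j)) i))))
        (at (p j) within {-e<..<e})"
    proof (rule leibniz_rule_vector_derivative[where fx = "\<lambda>x u. u ^ b *\<^sub>R D j ((p(j := x))(i := u * (p(j := x)) i))"])
      fix x u :: real assume x: "x \<in> {-e<..<e}" and u: "u \<in> cbox 0 1"
      define q where "q = (p(j := x))(i := u * (p(j := x)) i)"
      have q: "q \<in> cube n e" unfolding q_def by (rule scaled_in_cube[OF pin[OF x]]) (use u in auto)
      have "((\<lambda>x. F ((p(j := x))(i := u * (p(j := x)) i))) has_vector_derivative (if j = i then u else 1) *\<^sub>R D j q) (at x)"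
      proof (cases "j = i")
        case True
        have eq: "(\<lambda>x. F ((p(j := x))(i := u * (p(j := x)) i))) = (\<lambda>t. F (q(j := t))) \<circ> (\<lambda>x. u * x)"
          using True by (auto simp: q_def fun_eq_iff)
        have "((\<lambda>x. u * x) has_vector_derivative u) (at x)" by (auto intro!: derivative_eq_intros)
        moreover have "((\<lambda>t. F (q(j := t))) has_vector_derivative D j q) (at (u * x))"
          using D(1)[OF j q] True by (simp add: q_def)
        ultimately show ?thesis unfolding eq using True vector_diff_chain_at by fastforce
      next
        case False
        then have "(\<lambda>x. F ((p(j := x))(i := u * (p(j := x)) i))) = (\<lambda>t. F (q(j := t)))" "q j = x"
          by (auto simp: q_def fun_upd_twist)
        then show ?thesis using D(1)[OF j q] False by simp
      qed
      moreover have "u ^ a *\<^sub>R ((if j = i then u else 1) *\<^sub>R D j q) = u ^ b *\<^sub>R D j q"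
        by (simp add: b_def mult.commute)
      ultimately show "((\<lambda>x. u ^ a *\<^sub>R F ((p(j := x))(i := u * (p(j := x)) i))) has_vector_derivative
          u ^ b *\<^sub>R D j ((p(j := x))(i := u * (p(j := x)) i))) (at x within {-e<..<e})"
        unfolding q_def[symmetric]
        by (metis bounded_linear.has_vector_derivative[OF bounded_linear_scaleR_right] has_vector_derivative_at_within)
    next
      fix x assume x: "x \<in> {-e<..<e}"
      have "continuous_on (cbox (0::real) 1) (Pair (p(j := x)))"
        by (rule continuous_on_Pair[OF continuous_on_const continuous_on_id])
      moreover have "Pair (p(j := x)) ` cbox (0::real) 1 \<subseteq> cube n e \<times> cbox 0 1"
        using pin[OF x] by (simp add: image_subset_iff)
      ultimately have "continuous_on (cbox 0 1) (\<lambda>u. (\<lambda>(p, u). u ^ a *\<^sub>R F (p(i := u * p i))) (p(j := x), u))"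
        by (rule continuous_on_compose2[OF continuous_on_avg_integrand[OF smooth_cube_cont[OF F(1)], of a i]])
      then have "continuous_on (cbox 0 1) (\<lambda>u. u ^ a *\<^sub>R F ((p(j := x))(i := u * (p(j := x)) i)))"
        unfolding prod.case .
      then show "(\<lambda>u. u ^ a *\<^sub>R F ((p(j := x))(i := u * (p(j := x)) i))) integrable_on cbox 0 1"
        by (rule integrable_continuous)
    next
      have "continuous_on ({-e<..<e} \<times> cbox (0::real) 1) (\<lambda>q. (p(j := fst q), snd q))"
      proof (rule continuous_on_Pair)
        have c: "continuous_on S (\<lambda>q::real \<times> real. (p(j := fst q)) l)" for S l
          by (cases "l = j") (simp_all add: continuous_on_fst[OF continuous_on_id])
        show "continuous_on ({-e<..<e} \<times> cbox (0::real) 1) (\<lambda>q. p(j := fst q))"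
          unfolding continuous_on_tup_coords using c by blast
      qed (rule continuous_on_snd[OF continuous_on_id])
      moreover have "(\<lambda>q. (p(j := fst q), snd q)) ` ({-e<..<e} \<times> cbox (0::real) 1) \<subseteq> cube n e \<times> cbox 0 1"
        using pin by (simp add: image_subset_iff)
      ultimately have "continuous_on ({-e<..<e} \<times> cbox (0::real) 1)
          (\<lambda>q. (\<lambda>(p, u). u ^ b *\<^sub>R D j (p(i := u * p i))) (p(j := fst q), snd q))"
        by (rule continuous_on_compose2[OF continuous_on_avg_integrand[OF smooth_cube_cont[OF D(2)[OF j]], of b i]])
      then show "continuous_on ({-e<..<e} \<times> cbox (0::real) 1) (\<lambda>(x, u). u ^ b *\<^sub>R D j ((p(j := x))(i := u * (p(j := x)) i)))"
        unfolding split_beta fst_conv snd_conv .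
    next
      show "p j \<in> {-e<..<e}" using p j by (auto simp: cube_def abs_less_iff)
      then show "convex {-e<..<e}" by simp
    qed
    moreover have "p j \<in> {-e<..<e}" using p j by (auto simp: cube_def abs_less_iff)
    then have "at (p j) within {-e<..<e} = at (p j)" by (intro at_within_open) auto
    ultimately show ?thesis unfolding F(2) avg_int_def by simp
  qed
  then show "\<exists>g. (\<exists>a F. smooth_cube n e F \<and> g = avg_int i a F) \<and>
      (\<forall>p\<in>cube n e. has_partial G j (g p) p)"
    using D(2)[OF j] by blast
qed

text \<open>
  The fundamental theorem of calculus along that segment.
\<close>

lemma hadamard_cube:
  assumes "smooth_cube n e F" "i < n"
    and D: "\<And>p. p \<in> cube n e \<Longrightarrow> has_partial F i (D p) p"
    and p: "p \<in> cube n e"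
  shows "F p - F (p(i := 0)) = p i *\<^sub>R avg_int i 0 D p"
proof -
  have "((\<lambda>u. p i *\<^sub>R D (p(i := u * p i))) has_integral F (p(i := 1 * p i)) - F (p(i := 0 * p i))) {0..1}"
  proof (rule fundamental_theorem_of_calculus)
    fix u :: real assume u: "u \<in> {0..1}"
    have q: "p(i := u * p i) \<in> cube n e" using scaled_in_cube[OF p] u by auto
    have "((\<lambda>t. F (p(i := t))) has_vector_derivative D (p(i := u * p i))) (at (u * p i))"
      using D[OF q] by simp
    moreover have "((\<lambda>u. u * p i) has_vector_derivative p i) (at u)" by (auto intro!: derivative_eq_intros)
    ultimately have "((\<lambda>t. F (p(i := t))) \<circ> (\<lambda>u. u * p i) has_vector_derivative p i *\<^sub>R D (p(i := u * p i))) (at u)"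
      by (intro vector_diff_chain_at)
    from this[unfolded o_def]
    show "((\<lambda>u. F (p(i := u * p i))) has_vector_derivative p i *\<^sub>R D (p(i := u * p i))) (at u within {0..1})"
      by (rule has_vector_derivative_at_within)
  qed simp
  from integral_unique[OF this] show ?thesis unfolding avg_int_def by simp
qed

lemma hadamard:
  fixes F :: "(nat \<Rightarrow> real) \<Rightarrow> 'b::banach"
  assumes "smooth_germ n F" "i < n"
  obtains Q where "smooth_germ n Q" "\<forall>\<^sub>F p in param_nhds n. F p - F (p(i := 0)) = p i *\<^sub>R Q p"
proof -
  obtain e where e: "e > 0" "smooth_cube n e F" using assms(1) sg_cube by blast
  obtain D where D: "\<And>i p. i < n \<Longrightarrow> p \<in> cube n e \<Longrightarrow> has_partial F i (D i p) p"
    "\<And>i. i < n \<Longrightarrow> smooth_cube n e (D i)" using smooth_cube_partials[OF e(2)] by metis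
  have "smooth_germ n (avg_int i 0 (D i))"
    by (rule sgI[OF e(1) smooth_cube_avg_int[OF D(2) assms(2)]]) (rule assms(2))
  moreover have "\<forall>\<^sub>F p in param_nhds n. F p - F (p(i := 0)) = p i *\<^sub>R avg_int i 0 (D i) p"
    using eventually_in_cube[OF e(1), of n]
    by eventually_elim (rule hadamard_cube[OF e(2) assms(2) D(1)[OF assms(2)]])
  ultimately show ?thesis using that by blast
qed

section \<open>Weights for the extension across zero\<close>

text \<open>
  The coefficients of \<open>e(x) = (1 - x) (1 - x/10) (1 - x/100) \<dots>\<close>, read off from
  \<open>e(x) = (1 - x) e(x/10)\<close>. This function vanishes at \<open>x = 10 ^ n\<close>, which says that masses w_k at the
  points \<open>10 ^ k\<close> have vanishing moments of all orders. The factor 10 makes the series converge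
  so fast that crude estimates decide the sign of \<open>seeley_T 0\<close>.
\<close>

primrec seeley_w :: "nat \<Rightarrow> real" where
  "seeley_w 0 = 1"
| "seeley_w (Suc k) = - seeley_w k * (1/10) ^ k / (1 - (1/10) ^ Suc k)"

declare seeley_w.simps(2) [simp del]

lemma seeley_den: "1 - (1/10::real) ^ Suc k \<ge> 9/10"
  using power_le_one[of "1/10::real" k] by simp

lemma seeley_w_step: "\<bar>seeley_w (Suc k)\<bar> \<le> 10/9 * (1/10) ^ k * \<bar>seeley_w k\<bar>"
proof -
  have pos: "1 - (1/10::real) ^ Suc k > 0" using seeley_den[of k] by linarith
  have "\<bar>seeley_w (Suc k)\<bar> = (\<bar>seeley_w k\<bar> * (1/10) ^ k) / (1 - (1/10) ^ Suc k)"
    using pos by (simp only: seeley_w.simps abs_divide abs_mult abs_minus_cancel abs_of_pos) simp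
  also have "\<dots> \<le> (\<bar>seeley_w k\<bar> * (1/10) ^ k) / (9/10)"
    by (rule divide_left_mono[OF seeley_den]) (use pos in auto)
  finally show ?thesis by (simp add: mult_ac)
qed

lemma seeley_w_bound: "\<bar>seeley_w (Suc k)\<bar> \<le> 10/9"
proof (induction k)
  case 0
  then show ?case using seeley_w_step[of 0] by simp
next
  case (Suc k)
  have "10/9 * (1/10::real) ^ Suc k \<le> 1" using power_le_one[of "1/10::real" k] by simp
  then have "10/9 * (1/10) ^ Suc k * \<bar>seeley_w (Suc k)\<bar> \<le> 1 * \<bar>seeley_w (Suc k)\<bar>"
    by (intro mult_right_mono) auto
  then show ?case using seeley_w_step[of "Suc k"] Suc by linarith
qed

lemma summable_seeley_w:
  assumes "x \<ge> 0" shows "summable (\<lambda>k. \<bar>seeley_w k\<bar> * x ^ k)"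
proof -
  have "(\<lambda>k. 10/9 * x * (1/10) ^ k) \<longlonglongrightarrow> 10/9 * x * 0"
    by (intro tendsto_intros LIMSEQ_power_zero) auto
  then have "\<forall>\<^sub>F k in sequentially. 10/9 * x * (1/10) ^ k < 1/2"
    by (rule order_tendstoD) simp
  then obtain N where N: "\<And>k. k \<ge> N \<Longrightarrow> 10/9 * x * (1/10) ^ k < 1/2"
    by (auto simp: eventually_sequentially)
  show ?thesis
  proof (rule summable_ratio_test[of "1/2" N])
    fix k assume "k \<ge> N"
    have "\<bar>seeley_w (Suc k)\<bar> * x ^ Suc k \<le> (10/9 * (1/10) ^ k * \<bar>seeley_w k\<bar>) * x ^ Suc k"
      by (rule mult_right_mono[OF seeley_w_step]) (use assms in simp)
    also have "\<dots> = (10/9 * x * (1/10) ^ k) * (\<bar>seeley_w k\<bar> * x ^ k)" by simp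
    also have "\<dots> \<le> 1/2 * (\<bar>seeley_w k\<bar> * x ^ k)"
      by (rule mult_right_mono) (use N[OF \<open>k \<ge> N\<close>] assms in auto)
    finally show "norm (\<bar>seeley_w (Suc k)\<bar> * x ^ Suc k) \<le> 1/2 * norm (\<bar>seeley_w k\<bar> * x ^ k)"
      using assms by (simp add: abs_mult)
  qed simp
qed

lemma summable_seeley_w': "x \<ge> 0 \<Longrightarrow> summable (\<lambda>k. seeley_w k * x ^ k)"
  by (rule summable_norm_cancel) (use summable_seeley_w in \<open>simp add: abs_mult\<close>)

lemma seeley_functional_eq:
  assumes "x \<ge> 0"
  shows "(\<Sum>k. seeley_w k * x ^ k) = (1 - x) * (\<Sum>k. seeley_w k * (x / 10) ^ k)"
proof -
  have s: "summable (\<lambda>k. seeley_w k * x ^ k)" "summable (\<lambda>k. seeley_w k * (x / 10) ^ k)"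
    using assms by (auto intro: summable_seeley_w')
  have step: "seeley_w (Suc k) * x ^ Suc k - seeley_w (Suc k) * (x / 10) ^ Suc k = - x * (seeley_w k * (x / 10) ^ k)" for k
  proof -
    have "seeley_w (Suc k) * x ^ Suc k - seeley_w (Suc k) * (x / 10) ^ Suc k
        = (seeley_w (Suc k) * (1 - (1/10) ^ Suc k)) * x ^ Suc k"
      by (simp add: power_divide algebra_simps)
    also have "seeley_w (Suc k) * (1 - (1/10) ^ Suc k) = - seeley_w k * (1/10) ^ k"
      using seeley_den[of k] by (simp only: seeley_w.simps) (subst nonzero_eq_divide_eq[symmetric], auto)
    finally show ?thesis by (simp add: power_divide)
  qed
  have "(\<Sum>k. seeley_w k * x ^ k) - (\<Sum>k. seeley_w k * (x / 10) ^ k)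
      = (\<Sum>k. seeley_w k * x ^ k - seeley_w k * (x / 10) ^ k)" by (rule suminf_diff[OF s])
  also have "\<dots> = (\<Sum>k. seeley_w (Suc k) * x ^ Suc k - seeley_w (Suc k) * (x / 10) ^ Suc k)"
    using suminf_split_head[OF summable_diff[OF s]] by simp
  also have "\<dots> = - x * (\<Sum>k. seeley_w k * (x / 10) ^ k)"
    unfolding step by (rule suminf_mult[OF s(2)])
  finally show ?thesis by (simp add: algebra_simps)
qed

lemma seeley_moment_zero: "(\<Sum>k. seeley_w k * (10 ^ n) ^ k) = 0"
proof (induction n)
  case 0
  then show ?case using seeley_functional_eq[of 1] by simp
next
  case (Suc n)
  then show ?case using seeley_functional_eq[of "10 ^ Suc n"] by simp
qed

text \<open>
  The moments of the masses \<open>w_k / (1 + 10 ^ k)\<close>. Two consecutive ones add up to a moment of the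
  w_k, which is zero; so they alternate in sign, as the moments of a mass at -1 do.
\<close>

definition seeley_T :: "nat \<Rightarrow> real" where
  "seeley_T n = (\<Sum>k. seeley_w k * (10 ^ n) ^ k / (1 + 10 ^ k))"

lemma summable_seeley_T_abs: "summable (\<lambda>k. \<bar>seeley_w k\<bar> * (10 ^ n) ^ k / (1 + 10 ^ k))"
proof (rule summable_comparison_test'[of "\<lambda>k. \<bar>seeley_w k\<bar> * (10 ^ n) ^ k" 0])
  show "summable (\<lambda>k. \<bar>seeley_w k\<bar> * (10 ^ n) ^ k)" by (rule summable_seeley_w) simp
  fix k :: nat
  have "\<bar>seeley_w k\<bar> * (10 ^ n) ^ k / (1 + 10 ^ k) \<le> \<bar>seeley_w k\<bar> * (10 ^ n) ^ k / 1"
    by (rule divide_left_mono) (auto simp: add_pos_nonneg)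
  then show "norm (\<bar>seeley_w k\<bar> * (10 ^ n) ^ k / (1 + 10 ^ k)) \<le> \<bar>seeley_w k\<bar> * (10 ^ n) ^ k"
    by (simp add: abs_mult add_pos_nonneg)
qed

lemma summable_seeley_T: "summable (\<lambda>k. seeley_w k * (10 ^ n) ^ k / (1 + 10 ^ k))"
  by (rule summable_norm_cancel)
     (use summable_seeley_T_abs[of n] in \<open>simp add: abs_mult add_pos_nonneg\<close>)

lemma seeley_T_alternates: "seeley_T (Suc n) = - seeley_T n"
proof -
  have "seeley_w k * (10 ^ n) ^ k / (1 + 10 ^ k) + seeley_w k * (10 ^ Suc n) ^ k / (1 + 10 ^ k)
      = seeley_w k * (10 ^ n) ^ k" for k :: nat
  proof -
    have nz: "(1 + 10 ^ k :: real) \<noteq> 0" by (metis add_pos_nonneg less_numeral_extra(3) zero_le_numeral zero_le_power zero_less_one)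
    have num: "seeley_w k * (10 ^ n) ^ k + seeley_w k * (10 ^ Suc n) ^ k = seeley_w k * (10 ^ n) ^ k * (1 + 10 ^ k)"
      by (simp add: power_mult_distrib distrib_left)
    have "seeley_w k * (10 ^ n) ^ k / (1 + 10 ^ k) + seeley_w k * (10 ^ Suc n) ^ k / (1 + 10 ^ k)
      = seeley_w k * (10 ^ n) ^ k * (1 + 10 ^ k) / (1 + 10 ^ k)"
      by (simp only: add_divide_distrib[symmetric] num)
    then show ?thesis unfolding nonzero_mult_div_cancel_right[OF nz] .
  qed
  then have "seeley_T n + seeley_T (Suc n) = (\<Sum>k. seeley_w k * (10 ^ n) ^ k)"
    unfolding seeley_T_def by (subst suminf_add[OF summable_seeley_T summable_seeley_T]) simp
  then show ?thesis using seeley_moment_zero[of n] by simp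
qed

lemma seeley_T_pow: "seeley_T n = (-1) ^ n * seeley_T 0"
  by (induction n) (simp_all add: seeley_T_alternates)

text \<open>
  The summand for k = 0 is 1/2 and the others contribute at most 10/81.
\<close>

lemma seeley_T_0_pos: "seeley_T 0 > 0"
proof -
  let ?f = "\<lambda>k. seeley_w k * (10 ^ 0) ^ k / (1 + 10 ^ k)"
  have "seeley_T 0 = ?f 0 + (\<Sum>k. ?f (Suc k))"
    unfolding seeley_T_def using suminf_split_head[OF summable_seeley_T[of 0]] by simp
  moreover have "norm (\<Sum>k. ?f (Suc k)) \<le> (\<Sum>k. 1/9 * (1/10) ^ k)"
  proof (rule norm_suminf_le)
    show "summable (\<lambda>k. 1/9 * (1/10::real) ^ k)" by (intro summable_mult summable_geometric) simp
    fix k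
    have "\<bar>seeley_w (Suc k)\<bar> / (1 + 10 ^ Suc k) \<le> (10/9) / (10 ^ Suc k)"
      by (rule frac_le) (use seeley_w_bound in auto)
    then show "norm (?f (Suc k)) \<le> 1/9 * (1/10) ^ k"
      by (simp add: abs_mult add_pos_nonneg power_divide)
  qed
  moreover have "(\<Sum>k. 1/9 * (1/10::real) ^ k) = 10/81"
    by (subst suminf_mult) (simp_all add: suminf_geometric)
  ultimately show ?thesis by (simp add: abs_le_iff)
qed

text \<open>
  Normalised so that the masses c_k at \<open>10 ^ k\<close> have the moments of a unit mass at -1. Hence
  \<open>\<Sum>k. c_k f (- 10 ^ k * s)\<close>, for s < 0, joins \<open>f s\<close>, for s > 0, smoothly at 0.
\<close>

definition seeley_c :: "nat \<Rightarrow> real" where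
  "seeley_c k = seeley_w k / ((1 + 10 ^ k) * seeley_T 0)"

lemma summable_seeley_c: "summable (\<lambda>k. \<bar>seeley_c k * (- (10 ^ k)) ^ j\<bar>)"
proof -
  have e: "(\<lambda>k. \<bar>seeley_c k * (- (10 ^ k)) ^ j\<bar>) = (\<lambda>k. \<bar>seeley_w k\<bar> * (10 ^ j) ^ k / (1 + 10 ^ k) * (1 / seeley_T 0))"
    using seeley_T_0_pos
    by (auto simp: fun_eq_iff seeley_c_def abs_mult power_abs add_pos_nonneg mult.commute simp flip: power_mult)
  show ?thesis unfolding e by (rule summable_mult2[OF summable_seeley_T_abs])
qed

lemma seeley_c_sums: "(\<lambda>k. seeley_c k * (- (10 ^ k)) ^ j) sums 1"
proof -
  have A: "(\<lambda>k. seeley_w k * (10 ^ j) ^ k / (1 + 10 ^ k) * ((-1) ^ j / seeley_T 0)) sums (seeley_T j * ((-1) ^ j / seeley_T 0))"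
    unfolding seeley_T_def[of j] by (intro sums_mult2 summable_sums summable_seeley_T)
  have B: "seeley_T j * ((-1) ^ j / seeley_T 0) = 1"
    using seeley_T_0_pos by (simp add: seeley_T_pow[of j] flip: power_mult_distrib)
  have C: "seeley_w k * (10 ^ j) ^ k / (1 + 10 ^ k) * ((-1) ^ j / seeley_T 0) = seeley_c k * (- (10 ^ k)) ^ j" for k
    unfolding seeley_c_def power_minus[of "10 ^ k"] by (simp add: mult.commute flip: power_mult)
  from A[unfolded B C] show ?thesis .
qed

section \<open>Differentiating series and gluing at zero\<close>

lemma series_has_vector_derivative:
  fixes f :: "nat \<Rightarrow> real \<Rightarrow> 'b::banach"
  assumes S: "open S" "convex S" "x \<in> S"
    and d: "\<And>k s. s \<in> S \<Longrightarrow> (f k has_vector_derivative f' k s) (at s)"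
    and b: "\<And>k s. s \<in> S \<Longrightarrow> norm (f' k s) \<le> a k" "summable a"
    and s: "summable (\<lambda>k. f k x)"
  shows "((\<lambda>s. \<Sum>k. f k s) has_vector_derivative (\<Sum>k. f' k x)) (at x)"
proof -
  have u: "uniform_limit S (\<lambda>n s. \<Sum>k<n. f' k s) (\<lambda>s. \<Sum>k. f' k s) sequentially"
    by (rule Weierstrass_m_test[OF b]) auto
  have "\<exists>g. \<forall>s\<in>S. (\<lambda>k. f k s) sums g s \<and> (g has_derivative (\<lambda>h. h *\<^sub>R (\<Sum>k. f' k s))) (at s within S)"
  proof (rule has_derivative_series[OF S(2)])
    show "(f k has_derivative (\<lambda>h. h *\<^sub>R f' k s)) (at s within S)" if "s \<in> S" for k s
      using d[OF that] by (simp add: has_vector_derivative_def has_derivative_at_withinI)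
    show "\<forall>\<^sub>F n in sequentially. \<forall>s\<in>S. \<forall>h. norm ((\<Sum>i<n. h *\<^sub>R f' i s) - h *\<^sub>R (\<Sum>k. f' k s)) \<le> e * norm h"
      if "e > 0" for e
      using uniform_limitD[OF u that]
    proof eventually_elim
      case (elim n)
      show ?case
      proof (intro ballI allI)
        fix s h assume "s \<in> S"
        then have "norm ((\<Sum>i<n. f' i s) - (\<Sum>k. f' k s)) \<le> e" using elim by (force simp: dist_norm)
        then have "\<bar>h\<bar> * norm ((\<Sum>i<n. f' i s) - (\<Sum>k. f' k s)) \<le> \<bar>h\<bar> * e" by (rule mult_left_mono) simp
        then show "norm ((\<Sum>i<n. h *\<^sub>R f' i s) - h *\<^sub>R (\<Sum>k. f' k s)) \<le> e * norm h"
          by (simp add: scaleR_sum_right[symmetric] scaleR_diff_right[symmetric] mult.commute)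
      qed
    qed
    show "(\<lambda>k. f k x) sums (\<Sum>k. f k x)" using s by (rule summable_sums)
  qed (rule S(3))
  then obtain g where g: "\<And>s. s \<in> S \<Longrightarrow> (\<lambda>k. f k s) sums g s"
    "\<And>s. s \<in> S \<Longrightarrow> (g has_derivative (\<lambda>h. h *\<^sub>R (\<Sum>k. f' k s))) (at s within S)" by blast
  have "(g has_vector_derivative (\<Sum>k. f' k x)) (at x)"
    using g(2)[OF S(3)] at_within_open[OF S(3,1)] by (simp add: has_vector_derivative_def)
  then show ?thesis
    by (rule has_vector_derivative_transform_within_open[OF _ S(1,3)]) (use g(1) sums_unique in blast)
qed

text \<open>
  The derivative at 0 exists because the mean value inequality applies on either side of 0.
\<close>

lemma has_vector_derivative_glue:
  fixes f :: "real \<Rightarrow> 'b::real_normed_vector"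
  assumes "e > 0" and c: "continuous_on {-e<..<e} f"
    and d: "\<And>t. t \<in> {-e<..<e} \<Longrightarrow> t \<noteq> 0 \<Longrightarrow> (f has_vector_derivative g t) (at t)"
    and g: "isCont g 0"
  shows "(f has_vector_derivative g 0) (at 0)"
proof -
  have key: "norm (f y - f x - (y - x) *\<^sub>R g 0) \<le> \<epsilon> * (y - x)"
    if xy: "x < y" "-e < x" "y < e" "0 \<notin> {x<..<y}" and b: "\<And>t. t \<in> {x<..<y} \<Longrightarrow> norm (g t - g 0) \<le> \<epsilon>" for x y \<epsilon>
  proof -
    have "norm ((f y - y *\<^sub>R g 0) - (f x - x *\<^sub>R g 0)) \<le> \<epsilon> * y - \<epsilon> * x"
    proof (rule differentiable_bound_general[of x y "\<lambda>t. f t - t *\<^sub>R g 0" "\<lambda>t. \<epsilon> * t" "\<lambda>t. g t - 1 *\<^sub>R g 0" "\<lambda>_. \<epsilon>"])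
      show "continuous_on {x..y} (\<lambda>t. f t - t *\<^sub>R g 0)"
        by (intro continuous_intros continuous_on_subset[OF c]) (use xy in auto)
      show "((\<lambda>t. f t - t *\<^sub>R g 0) has_vector_derivative g t - 1 *\<^sub>R g 0) (at t)" if "x < t" "t < y" for t
        using that xy by (auto intro!: derivative_eq_intros d)
      show "((\<lambda>t. \<epsilon> * t) has_vector_derivative \<epsilon>) (at t)" for t
        by (auto intro!: derivative_eq_intros)
    qed (use xy b in \<open>auto intro!: continuous_intros\<close>)
    then show ?thesis by (simp add: algebra_simps)
  qed
  have "((\<lambda>t. (f t - f 0 - t *\<^sub>R g 0) /\<^sub>R \<bar>t\<bar>) \<longlongrightarrow> 0) (at 0)"
  proof (rule tendstoI)
    fix \<epsilon> :: real assume "\<epsilon> > 0"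
    then obtain d0 where d0: "d0 > 0" "\<And>t. \<bar>t\<bar> < d0 \<Longrightarrow> norm (g t - g 0) < \<epsilon> / 2"
      using g[unfolded continuous_at_eps_delta, rule_format, of "\<epsilon> / 2"] by (auto simp: dist_norm)
    have "norm (f t - f 0 - t *\<^sub>R g 0) \<le> \<epsilon> / 2 * \<bar>t\<bar>" if t: "t \<noteq> 0" "\<bar>t\<bar> < min d0 e" for t
    proof (cases "t > 0")
      case True
      then show ?thesis using key[of 0 t "\<epsilon> / 2"] t d0(2) \<open>e > 0\<close> by (simp add: less_imp_le)
    next
      case False
      then have "norm (f 0 - f t - (0 - t) *\<^sub>R g 0) \<le> \<epsilon> / 2 * (0 - t)"
        using t d0(2) \<open>e > 0\<close> by (intro key) (auto simp: less_imp_le)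
      moreover have "f t - f 0 - t *\<^sub>R g 0 = - (f 0 - f t - (0 - t) *\<^sub>R g 0)" by simp
      ultimately show ?thesis using False by (metis abs_of_neg diff_0 linorder_neqE_linordered_idom norm_minus_cancel t(1))
    qed
    moreover have "\<forall>\<^sub>F t in at (0::real). t \<noteq> 0 \<and> \<bar>t\<bar> < min d0 e"
      using d0(1) \<open>e > 0\<close> unfolding eventually_at by (intro exI[of _ "min d0 e"]) auto
    ultimately show "\<forall>\<^sub>F t in at 0. dist ((f t - f 0 - t *\<^sub>R g 0) /\<^sub>R \<bar>t\<bar>) 0 < \<epsilon>"
    proof (elim eventually_mono)
      fix t assume t: "t \<noteq> 0 \<and> \<bar>t\<bar> < min d0 e"
        and *: "\<And>t. t \<noteq> 0 \<Longrightarrow> \<bar>t\<bar> < min d0 e \<Longrightarrow> norm (f t - f 0 - t *\<^sub>R g 0) \<le> \<epsilon> / 2 * \<bar>t\<bar>"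
      have "norm (f t - f 0 - t *\<^sub>R g 0) / \<bar>t\<bar> \<le> \<epsilon> / 2"
        using *[of t] t by (simp add: divide_le_eq)
      then have "norm (f t - f 0 - t *\<^sub>R g 0) / \<bar>t\<bar> < \<epsilon>" using \<open>\<epsilon> > 0\<close> by linarith
      then show "dist ((f t - f 0 - t *\<^sub>R g 0) /\<^sub>R \<bar>t\<bar>) 0 < \<epsilon>"
        unfolding dist_norm diff_0_right norm_scaleR abs_inverse abs_idempotent real_norm_def divide_inverse
        by (simp only: mult.commute)
    qed
  qed
  then show ?thesis
    unfolding has_vector_derivative_def has_derivative_at_within by (simp add: bounded_linear_scaleR_left)
qed

section \<open>Whitney's theorem on even functions\<close>

text \<open>
  The square root of \<open>r\<^sup>2 x / (1 + x)\<close>, a parametrisation of [0, r) by the half-line. In the variable x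
  the dilations by \<open>10 ^ k\<close> do not leave the domain of the function to be extended, and all
  derivatives of that function stay bounded. The absolute value lets the same expression be used for
  the reflected arguments.
\<close>

definition half_chart :: "real \<Rightarrow> real \<Rightarrow> real" where
  "half_chart r x = r * sqrt (\<bar>x\<bar> / (1 + \<bar>x\<bar>))"

lemma half_chart_bounds: assumes "r > 0" shows "0 \<le> half_chart r x" "half_chart r x < r"
proof -
  have "sqrt (\<bar>x\<bar> / (1 + \<bar>x\<bar>)) < 1" by simp
  then show "half_chart r x < r" using assms unfolding half_chart_def by (metis mult.right_neutral mult_strict_left_mono)
  show "0 \<le> half_chart r x" using assms by (simp add: half_chart_def)
qed

lemma half_chart_in_cube: "r > 0 \<Longrightarrow> p \<in> cube n r \<Longrightarrow> i < n \<Longrightarrow> p(i := half_chart r x) \<in> cube n r"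
  using half_chart_bounds[of r x] by (simp add: cube_upd)

lemma half_chart_0 [simp]: "half_chart r 0 = 0" by (simp add: half_chart_def)

lemma half_chart_pos: "r > 0 \<Longrightarrow> x > 0 \<Longrightarrow> half_chart r x > 0"
  by (simp add: half_chart_def add_pos_pos)

lemma continuous_on_half_chart: "continuous_on S (half_chart r)"
proof -
  have "\<And>x::real. 1 + \<bar>x\<bar> \<noteq> 0" by linarith
  then show ?thesis unfolding half_chart_def by (intro continuous_intros) auto
qed

lemma half_chart_deriv:
  assumes "r > 0" "x > 0"
  shows "(half_chart r has_vector_derivative (r\<^sup>2 * (1 - (half_chart r x)\<^sup>2 / r\<^sup>2)\<^sup>2 / 2) / half_chart r x) (at x)"
proof -
  have d: "((\<lambda>x. r * sqrt (x / (1 + x))) has_real_derivative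
      r * (1 / (1 + x)\<^sup>2 * (inverse (sqrt (x / (1 + x))) / 2))) (at x)"
    using assms by (auto intro!: derivative_eq_intros simp: field_simps power2_eq_square)
  have w: "half_chart r x = r * sqrt (x / (1 + x))" using assms by (simp add: half_chart_def)
  have "(half_chart r x)\<^sup>2 = r\<^sup>2 * (x / (1 + x))" using assms by (simp add: w power_mult_distrib)
  then have "1 - (half_chart r x)\<^sup>2 / r\<^sup>2 = 1 / (1 + x)" using assms by (simp add: field_simps)
  then have e: "(r\<^sup>2 * (1 - (half_chart r x)\<^sup>2 / r\<^sup>2)\<^sup>2 / 2) / half_chart r x = r * (1 / (1 + x)\<^sup>2 * (inverse (sqrt (x / (1 + x))) / 2))"
    unfolding w using assms by (simp add: power_divide power2_eq_square divide_simps)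
  show ?thesis unfolding e
    by (rule has_vector_derivative_transform_within_open[of "\<lambda>x. r * sqrt (x / (1 + x))" _ _ "{0<..}"])
       (use d assms in \<open>auto simp: half_chart_def has_real_derivative_iff_has_vector_derivative\<close>)
qed

lemma compact_closed_cube:
  fixes n :: nat
  shows "compact {p. (\<forall>l<n. \<bar>p l\<bar> \<le> r) \<and> (\<forall>l\<ge>n. p l = (0::real))}"
proof -
  have "compactin (product_topology (\<lambda>_. euclidean) UNIV) (\<Pi>\<^sub>E l\<in>UNIV. if l < n then {-r..r} else {0::real})"
    unfolding compactin_PiE by simp
  moreover have "(\<Pi>\<^sub>E l\<in>(UNIV::nat set). if l < n then {-r..r} else {0::real}) = {p. (\<forall>l<n. \<bar>p l\<bar> \<le> r) \<and> (\<forall>l\<ge>n. p l = (0::real))}"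
  proof (rule set_eqI)
    fix p :: "nat \<Rightarrow> real"
    have "p \<in> (\<Pi>\<^sub>E l\<in>UNIV. if l < n then {-r..r} else {0}) \<longleftrightarrow> (\<forall>l. (l < n \<longrightarrow> \<bar>p l\<bar> \<le> r) \<and> (\<not> l < n \<longrightarrow> p l = 0))"
      by (simp add: PiE_iff abs_le_iff minus_le_iff[of _ r] conj_commute)
    then show "p \<in> (\<Pi>\<^sub>E l\<in>UNIV. if l < n then {-r..r} else {0}) \<longleftrightarrow> p \<in> {p. (\<forall>l<n. \<bar>p l\<bar> \<le> r) \<and> (\<forall>l\<ge>n. p l = 0)}"
      by (auto simp: not_less)
  qed
  ultimately show ?thesis by (simp add: euclidean_product_topology)
qed

lemma smooth_cube_bounded:
  assumes "smooth_cube n e f" "0 < r" "r < e"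
  obtains M where "M > 0" "\<And>p. p \<in> cube n r \<Longrightarrow> norm (f p) \<le> M"
proof -
  let ?K = "{p. (\<forall>l<n. \<bar>p l\<bar> \<le> r) \<and> (\<forall>l\<ge>n. p l = (0::real))}"
  have "?K \<subseteq> cube n e" using assms by (auto simp: cube_def)
  then have "compact (f ` ?K)"
    by (intro compact_continuous_image compact_closed_cube continuous_on_subset[OF smooth_cube_cont[OF assms(1)]])
  then have "bounded (f ` ?K)" by (rule compact_imp_bounded)
  then obtain M where "M > 0" "\<forall>x\<in>f ` ?K. norm x \<le> M" using bounded_pos by blast
  moreover have "cube n r \<subseteq> ?K" by (auto simp: cube_def)
  ultimately show ?thesis using that by blast
qed

definition even_cube :: "nat \<Rightarrow> real \<Rightarrow> nat \<Rightarrow> ((nat \<Rightarrow> real) \<Rightarrow> 'b) \<Rightarrow> bool" where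
  "even_cube n e i f \<longleftrightarrow> (\<forall>p\<in>cube n e. f (p(i := - p i)) = f p)"

lemma even_partial_other:
  assumes "even_cube n e i f" "i < n" "j < n" "j \<noteq> i"
    and D: "\<And>p. p \<in> cube n e \<Longrightarrow> has_partial f j (D p) p"
  shows "even_cube n e i D"
  unfolding even_cube_def
proof
  fix p assume p: "p \<in> cube n e"
  have q: "p(i := - p i) \<in> cube n e" using p assms(2) by (auto simp: cube_def)
  have "((\<lambda>t. f ((p(i := - p i))(j := t))) has_vector_derivative D (p(i := - p i))) (at (p j))"
    using D[OF q] assms(4) by simp
  moreover have "((\<lambda>t. f ((p(i := - p i))(j := t))) has_vector_derivative D p) (at (p j))"
  proof (rule has_vector_derivative_transform_within_open[OF D[OF p], of "{-e<..<e}"])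
    show "p j \<in> {-e<..<e}" using p assms(3) by (auto simp: cube_def abs_less_iff)
    fix t assume "t \<in> {-e<..<e}"
    then have "p(j := t) \<in> cube n e" using p assms(3) by (simp add: cube_upd abs_less_iff)
    from assms(1)[unfolded even_cube_def, rule_format, OF this]
    show "f (p(j := t)) = f ((p(i := - p i))(j := t))" using assms(4) by (simp add: fun_upd_twist)
  qed auto
  ultimately show "D (p(i := - p i)) = D p" using vector_derivative_unique_at by metis
qed

lemma odd_partial:
  assumes "even_cube n e i f" "i < n"
    and D: "\<And>p. p \<in> cube n e \<Longrightarrow> has_partial f i (D p) p"
    and p: "p \<in> cube n e"
  shows "D (p(i := - p i)) = - D p"
proof -
  have q: "p(i := - p i) \<in> cube n e" using p assms(2) by (auto simp: cube_def)
  have "((\<lambda>t. f (p(i := t))) has_vector_derivative D (p(i := - p i))) (at (- p i))"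
    using D[OF q] by simp
  moreover have "((\<lambda>t. - t) has_vector_derivative -1) (at (p i))" by (auto intro!: derivative_eq_intros)
  ultimately have 1: "((\<lambda>t. f (p(i := t))) \<circ> (\<lambda>t. - t) has_vector_derivative (-1) *\<^sub>R D (p(i := - p i))) (at (p i))"
    by (intro vector_diff_chain_at)
  have "has_partial f i ((-1) *\<^sub>R D (p(i := - p i))) p"
  proof (rule has_vector_derivative_transform_within_open[OF 1, of "{-e<..<e}"])
    show "p i \<in> {-e<..<e}" using p assms(2) by (auto simp: cube_def abs_less_iff)
    fix t assume "t \<in> {-e<..<e}"
    then have "p(i := t) \<in> cube n e" using p assms(2) by (simp add: cube_upd abs_less_iff)
    from assms(1)[unfolded even_cube_def, rule_format, OF this]
    show "((\<lambda>t. f (p(i := t))) \<circ> (\<lambda>t. - t)) t = f (p(i := t))" by simp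
  qed auto
  then have "(-1) *\<^sub>R D (p(i := - p i)) = D p" using vector_derivative_unique_at[OF _ D[OF p]] by blast
  then show ?thesis by (metis minus_minus scaleR_minus1_left)
qed

lemma smooth_cube_scaleR:
  "smooth_cube n e f \<Longrightarrow> smooth_cube n e g \<Longrightarrow> smooth_cube n e (\<lambda>p. f p *\<^sub>R g p)"
  unfolding smooth_cube_def using Ck_bilinear[OF bounded_bilinear_scaleR] by blast

text \<open>
  The class of even functions, seen through \<open>half_chart\<close>, is closed under differentiation: the
  derivative of f in the direction i is odd, hence divisible by the coordinate with an even quotient,
  and the derivative of the chart is an even polynomial in the chart divided by the chart itself.
\<close>

lemma even_extension_step:
  fixes f :: "(nat \<Rightarrow> real) \<Rightarrow> 'b::banach"
  assumes f: "smooth_cube n e f" "even_cube n e i f" and i: "i < n" and r: "0 < r" "r < e"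
  obtains g where "smooth_cube n e g" "even_cube n e i g"
    "\<And>p x. p \<in> cube n r \<Longrightarrow> x > 0 \<Longrightarrow>
      ((\<lambda>s. f (p(i := half_chart r s))) has_vector_derivative g (p(i := half_chart r x))) (at x)"
proof -
  obtain D where D: "\<And>i p. i < n \<Longrightarrow> p \<in> cube n e \<Longrightarrow> has_partial f i (D i p) p"
    "\<And>i. i < n \<Longrightarrow> smooth_cube n e (D i)" using smooth_cube_partials[OF f(1)] by metis
  obtain E where E: "\<And>j p. j < n \<Longrightarrow> p \<in> cube n e \<Longrightarrow> has_partial (D i) j (E j p) p"
    "\<And>j. j < n \<Longrightarrow> smooth_cube n e (E j)" using smooth_cube_partials[OF D(2)[OF i]] by metis
  define Q where "Q = avg_int i 0 (E i)"
  have Q: "smooth_cube n e Q" unfolding Q_def by (rule smooth_cube_avg_int[OF E(2)[OF i] i])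
  have odd: "D i (p(i := - p i)) = - D i p" if "p \<in> cube n e" for p
    by (rule odd_partial[OF f(2) i D(1)[OF i] that])
  have DQ: "D i p = p i *\<^sub>R Q p" if p: "p \<in> cube n e" for p
  proof -
    have "p(i := 0) \<in> cube n e" using p i by (auto simp: cube_def)
    from odd[OF this] have "D i (p(i := 0)) = - D i (p(i := 0))" by simp
    then have "2 *\<^sub>R D i (p(i := 0)) = 0" by (metis add.right_inverse scaleR_2)
    then have "D i (p(i := 0)) = 0" by simp
    moreover have "D i p - D i (p(i := 0)) = p i *\<^sub>R Q p"
      unfolding Q_def by (rule hadamard_cube[OF D(2)[OF i] i E(1)[OF i] p])
    ultimately show ?thesis by simp
  qed
  have Qeven: "Q (p(i := - p i)) = Q p" if p: "p \<in> cube n e" for p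
  proof (cases "p i = 0")
    case True
    then show ?thesis by (metis fun_upd_triv minus_zero)
  next
    case False
    have "p(i := - p i) \<in> cube n e" using p i by (auto simp: cube_def)
    from DQ[OF this] have "D i (p(i := - p i)) = - (p i *\<^sub>R Q (p(i := - p i)))" by simp
    moreover have "D i (p(i := - p i)) = - (p i *\<^sub>R Q p)" using odd[OF p] DQ[OF p] by simp
    ultimately have "p i *\<^sub>R Q (p(i := - p i)) = p i *\<^sub>R Q p" by (metis neg_equal_iff_equal)
    then show ?thesis using False by (metis scaleR_cancel_left)
  qed
  define w where "w p = (1/2) *\<^sub>R ((r + (-1/r) *\<^sub>R (p i *\<^sub>R p i)) *\<^sub>R (r + (-1/r) *\<^sub>R (p i *\<^sub>R p i)))" for p :: "nat \<Rightarrow> real"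
  have w: "smooth_cube n e w"
    unfolding w_def smooth_cube_def
    by (intro allI Ck_bilinear[OF bounded_bilinear_scaleR] Ck_add Ck_const Ck_proj)
  show ?thesis
  proof (rule that[of "\<lambda>p. w p *\<^sub>R Q p"])
    show "smooth_cube n e (\<lambda>p. w p *\<^sub>R Q p)" by (rule smooth_cube_scaleR[OF w Q])
    show "even_cube n e i (\<lambda>p. w p *\<^sub>R Q p)"
      unfolding even_cube_def using Qeven by (simp add: w_def)
    fix p x assume p: "p \<in> cube n r" and x: "(x::real) > 0"
    define q where "q = p(i := half_chart r x)"
    have q: "q \<in> cube n e" using half_chart_in_cube[OF r(1) p i] cube_mono[of r e n] r by (auto simp: q_def)
    have "((\<lambda>t. f (p(i := t))) has_vector_derivative D i q) (at (half_chart r x))"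
      using D(1)[OF i q] by (simp add: q_def)
    from vector_diff_chain_at[OF half_chart_deriv[OF r(1) x] this]
    have "((\<lambda>s. f (p(i := half_chart r s))) has_vector_derivative ((r\<^sup>2 * (1 - (half_chart r x)\<^sup>2 / r\<^sup>2)\<^sup>2 / 2) / half_chart r x) *\<^sub>R D i q) (at x)"
      by (simp add: o_def)
    moreover have "((r\<^sup>2 * (1 - (half_chart r x)\<^sup>2 / r\<^sup>2)\<^sup>2 / 2) / half_chart r x) * half_chart r x = w q"
    proof -
      have "r\<^sup>2 * (1 - (half_chart r x)\<^sup>2 / r\<^sup>2)\<^sup>2 = (r * (1 - (half_chart r x)\<^sup>2 / r\<^sup>2))\<^sup>2" by (simp add: power_mult_distrib)
      also have "r * (1 - (half_chart r x)\<^sup>2 / r\<^sup>2) = r + (-1/r) * (half_chart r x * half_chart r x)"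
        using r(1) by (simp add: field_simps power2_eq_square)
      finally show ?thesis using half_chart_pos[OF r(1) x] by (simp add: w_def q_def power2_eq_square)
    qed
    ultimately show "((\<lambda>s. f (p(i := half_chart r s))) has_vector_derivative w (p(i := half_chart r x)) *\<^sub>R Q (p(i := half_chart r x))) (at x)"
      unfolding q_def[symmetric] DQ[OF q] by (simp add: q_def)
  qed
qed

text \<open>
  The index j counts derivatives with respect to the reflected variable; each of them contributes a
  factor \<open>- (10 ^ k)\<close>.
\<close>

definition seeley_sum :: "nat \<Rightarrow> real \<Rightarrow> nat \<Rightarrow> ((nat \<Rightarrow> real) \<Rightarrow> 'b::banach) \<Rightarrow> (nat \<Rightarrow> real) \<Rightarrow> 'b" where
  "seeley_sum i r j f p = (\<Sum>k. (seeley_c k * (- (10 ^ k)) ^ j) *\<^sub>R f (p(i := half_chart r (10 ^ k * p i))))"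

text \<open>
  For positive \<open>p i\<close> the function f itself in the chart, for negative \<open>p i\<close> the sum of its reflections.
\<close>

definition even_ext :: "nat \<Rightarrow> real \<Rightarrow> nat \<Rightarrow> ((nat \<Rightarrow> real) \<Rightarrow> 'b::banach) \<Rightarrow> (nat \<Rightarrow> real) \<Rightarrow> 'b" where
  "even_ext i r j f p = (if p i \<le> 0 then seeley_sum i r j f p else f (p(i := half_chart r (p i))))"

lemma half_chart_minus: "half_chart r (- x) = half_chart r x" by (simp add: half_chart_def)

lemma seeley_term_bound:
  fixes v :: "'b::real_normed_vector"
  shows "norm v \<le> M \<Longrightarrow> norm ((seeley_c k * (- (10 ^ k)) ^ j) *\<^sub>R v) \<le> \<bar>seeley_c k * (- (10 ^ k)) ^ j\<bar> * M"
  by (simp only: norm_scaleR) (intro mult_left_mono, auto)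

lemma summable_seeley_term:
  fixes v :: "nat \<Rightarrow> 'b::banach"
  assumes "\<And>k. norm (v k) \<le> M"
  shows "summable (\<lambda>k. (seeley_c k * (- (10 ^ k)) ^ j) *\<^sub>R v k)"
  by (rule summable_comparison_test'[OF summable_mult2[OF summable_seeley_c[of j], of M], of 0])
     (rule seeley_term_bound[OF assms])

lemma continuous_on_half_chart_upd:
  assumes "0 < r" "r \<le> e" "i < n" "continuous_on (cube n e) f"
  shows "continuous_on (cube n r) (\<lambda>p. f (p(i := half_chart r (c * p i))))"
proof (rule continuous_on_compose2[OF assms(4)])
  have c: "continuous_on (cube n r) (\<lambda>p. p l)" for l
    by (rule continuous_on_product_then_coordinatewise[OF continuous_on_id])
  have "continuous_on (cube n r) (\<lambda>p. half_chart r (c * p i))"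
    by (rule continuous_on_compose2[OF continuous_on_half_chart[of UNIV r] continuous_on_mult[OF continuous_on_const c]]) simp
  then have "continuous_on (cube n r) (\<lambda>p. (p(i := half_chart r (c * p i))) l)" for l
    using c[of l] by (cases "l = i") simp_all
  then show "continuous_on (cube n r) (\<lambda>p. p(i := half_chart r (c * p i)))"
    unfolding continuous_on_tup_coords by blast
  show "(\<lambda>p. p(i := half_chart r (c * p i))) ` cube n r \<subseteq> cube n e"
    using half_chart_in_cube[OF assms(1) _ assms(3)] cube_mono[OF assms(2), of n] by blast
qed

text \<open>
  The two expressions agree where \<open>p i = 0\<close> because the weights of the series add up to 1 for every j.
\<close>

lemma continuous_on_even_ext:
  fixes f :: "(nat \<Rightarrow> real) \<Rightarrow> 'b::banach"
  assumes f: "smooth_cube n e f" and i: "i < n" and r: "0 < r" "r < e"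
  shows "continuous_on (cube n r) (even_ext i r j f)"
proof -
  obtain M where M: "M > 0" "\<And>p. p \<in> cube n r \<Longrightarrow> norm (f p) \<le> M" using smooth_cube_bounded[OF f r] by blast
  have b: "norm (f (p(i := half_chart r x))) \<le> M" if "p \<in> cube n r" for p x
    by (rule M(2)[OF half_chart_in_cube[OF r(1) that i]])
  have cS: "continuous_on (cube n r) (seeley_sum i r j f)"
    unfolding seeley_sum_def
  proof (rule uniform_limit_theorem)
    show "uniform_limit (cube n r) (\<lambda>N p. \<Sum>k<N. (seeley_c k * (- (10 ^ k)) ^ j) *\<^sub>R f (p(i := half_chart r (10 ^ k * p i))))
      (\<lambda>p. \<Sum>k. (seeley_c k * (- (10 ^ k)) ^ j) *\<^sub>R f (p(i := half_chart r (10 ^ k * p i)))) sequentially"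
      by (rule Weierstrass_m_test[OF seeley_term_bound[OF b] summable_mult2[OF summable_seeley_c]])
    show "\<forall>\<^sub>F N in sequentially. continuous_on (cube n r) (\<lambda>p. \<Sum>k<N. (seeley_c k * (- (10 ^ k)) ^ j) *\<^sub>R f (p(i := half_chart r (10 ^ k * p i))))"
      by (intro always_eventually allI continuous_on_sum continuous_on_scaleR continuous_on_const
          continuous_on_half_chart_upd[OF r(1) _ i smooth_cube_cont[OF f]] less_imp_le r)
  qed simp
  have cA: "continuous_on (cube n r) (\<lambda>p. f (p(i := half_chart r (p i))))"
    using continuous_on_half_chart_upd[OF r(1) less_imp_le[OF r(2)] i smooth_cube_cont[OF f], of 1] by simp
  show ?thesis
    unfolding even_ext_def
  proof (rule continuous_on_cases_le)
    show "continuous_on {p \<in> cube n r. p i \<le> 0} (seeley_sum i r j f)" by (rule continuous_on_subset[OF cS]) auto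
    show "continuous_on {p \<in> cube n r. 0 \<le> p i} (\<lambda>p. f (p(i := half_chart r (p i))))" by (rule continuous_on_subset[OF cA]) auto
    show "continuous_on (cube n r) (\<lambda>p. p i)"
      by (rule continuous_on_product_then_coordinatewise[OF continuous_on_id])
    fix p :: "nat \<Rightarrow> real" assume "p i = 0"
    then show "seeley_sum i r j f p = f (p(i := half_chart r (p i)))"
      using sums_unique[OF sums_scaleR_left[OF seeley_c_sums[of j]], of "f (p(i := 0))"] by (simp add: seeley_sum_def)
  qed
qed

lemma even_ext_partial_other:
  fixes f :: "(nat \<Rightarrow> real) \<Rightarrow> 'b::banach"
  assumes f: "smooth_cube n e f" and i: "i < n" and r: "0 < r" "r < e" and l: "l < n" "l \<noteq> i"
    and D: "smooth_cube n e D" "\<And>p. p \<in> cube n e \<Longrightarrow> has_partial f l (D p) p"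
    and p: "p \<in> cube n r"
  shows "has_partial (even_ext i r j f) l (even_ext i r j D p) p"
proof -
  have sub: "cube n r \<subseteq> cube n e" using cube_mono r by simp
  obtain M where M: "\<And>p. p \<in> cube n r \<Longrightarrow> norm (f p) \<le> M" using smooth_cube_bounded[OF f r] by blast
  obtain M' where M': "\<And>p. p \<in> cube n r \<Longrightarrow> norm (D p) \<le> M'" using smooth_cube_bounded[OF D(1) r] by blast
  define q where "q x = p(i := half_chart r x)" for x
  have q: "q x \<in> cube n r" for x unfolding q_def by (rule half_chart_in_cube[OF r(1) p i])
  have ql: "(q x)(l := s) = (p(l := s))(i := half_chart r x)" "q x l = p l" for x s
    using l by (simp_all add: q_def fun_upd_twist)
  have pl: "p l \<in> {-r<..<r}" using p l by (auto simp: cube_def abs_less_iff)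
  have qin: "(q x)(l := s) \<in> cube n r" if "s \<in> {-r<..<r}" for x s
    using cube_upd[OF q l(1)] that by (simp add: abs_less_iff)
  have d: "((\<lambda>t. f ((q x)(l := t))) has_vector_derivative D ((q x)(l := s))) (at s)" if "s \<in> {-r<..<r}" for x s
    using D(2)[of "(q x)(l := s)"] qin[OF that] sub by auto
  show ?thesis
  proof (cases "p i \<le> 0")
    case True
    have "((\<lambda>t. \<Sum>k. (seeley_c k * (- (10 ^ k)) ^ j) *\<^sub>R f ((q (10 ^ k * p i))(l := t))) has_vector_derivative
       (\<Sum>k. (seeley_c k * (- (10 ^ k)) ^ j) *\<^sub>R D ((q (10 ^ k * p i))(l := p l)))) (at (p l))"
    proof (rule series_has_vector_derivative[of "{-r<..<r}"])
      show "((\<lambda>t. (seeley_c k * (- (10 ^ k)) ^ j) *\<^sub>R f ((q (10 ^ k * p i))(l := t))) has_vector_derivative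
         (seeley_c k * (- (10 ^ k)) ^ j) *\<^sub>R D ((q (10 ^ k * p i))(l := s))) (at s)" if "s \<in> {-r<..<r}" for k s
        by (rule bounded_linear.has_vector_derivative[OF bounded_linear_scaleR_right d[OF that]])
      show "norm ((seeley_c k * (- (10 ^ k)) ^ j) *\<^sub>R D ((q (10 ^ k * p i))(l := s))) \<le> \<bar>seeley_c k * (- (10 ^ k)) ^ j\<bar> * M'"
        if "s \<in> {-r<..<r}" for k s by (rule seeley_term_bound[OF M'[OF qin[OF that]]])
      show "summable (\<lambda>k. \<bar>seeley_c k * (- (10 ^ k)) ^ j\<bar> * M')" by (rule summable_mult2[OF summable_seeley_c])
      show "summable (\<lambda>k. (seeley_c k * (- (10 ^ k)) ^ j) *\<^sub>R f ((q (10 ^ k * p i))(l := p l)))"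
        by (rule summable_seeley_term[OF M[OF qin[OF pl]]])
    qed (use pl in auto)
    then show ?thesis using True l by (simp add: even_ext_def seeley_sum_def ql)
  next
    case False
    then show ?thesis using d[OF pl, of "p i"] l by (simp add: even_ext_def ql)
  qed
qed

text \<open>
  Away from \<open>p i = 0\<close> this is termwise differentiation. At 0 the one-sided derivatives agree
  because the candidate for the derivative, being again an extension, is continuous there.
\<close>

lemma even_ext_partial_same:
  fixes f :: "(nat \<Rightarrow> real) \<Rightarrow> 'b::banach"
  assumes f: "smooth_cube n e f" and g: "smooth_cube n e g" and i: "i < n" and r: "0 < r" "r < e"
    and d: "\<And>p x. p \<in> cube n r \<Longrightarrow> x > 0 \<Longrightarrow>
      ((\<lambda>s. f (p(i := half_chart r s))) has_vector_derivative g (p(i := half_chart r x))) (at x)"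
    and p: "p \<in> cube n r"
  shows "has_partial (even_ext i r j f) i (even_ext i r (Suc j) g p) p"
proof -
  obtain M where M: "\<And>p. p \<in> cube n r \<Longrightarrow> norm (f p) \<le> M" using smooth_cube_bounded[OF f r] by blast
  obtain M' where M': "\<And>p. p \<in> cube n r \<Longrightarrow> norm (g p) \<le> M'" using smooth_cube_bounded[OF g r] by blast
  have neg: "((\<lambda>s. f (p(i := half_chart r (10 ^ k * s)))) has_vector_derivative (- (10 ^ k)) *\<^sub>R g (p(i := half_chart r (10 ^ k * x)))) (at x)"
    if x: "x < 0" for k x
  proof -
    have "((\<lambda>s. - (10 ^ k) * s) has_vector_derivative - (10 ^ k)) (at x)" by (auto intro!: derivative_eq_intros)
    moreover have "- (10 ^ k) * x > 0" using x by (simp add: mult_pos_neg)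
    ultimately have "((\<lambda>s. f (p(i := half_chart r s))) \<circ> (\<lambda>s. - (10 ^ k) * s) has_vector_derivative
       (- (10 ^ k)) *\<^sub>R g (p(i := half_chart r (- (10 ^ k) * x)))) (at x)"
      by (intro vector_diff_chain_at d[OF p])
    then show ?thesis by (simp add: o_def half_chart_minus)
  qed
  have ne: "((\<lambda>t. even_ext i r j f (p(i := t))) has_vector_derivative even_ext i r (Suc j) g (p(i := x))) (at x)" if "x \<noteq> 0" for x
  proof (cases "x > 0")
    case True
    have "((\<lambda>t. even_ext i r j f (p(i := t))) has_vector_derivative g (p(i := half_chart r x))) (at x)"
      by (rule has_vector_derivative_transform_within_open[OF d[OF p True], of "{0<..}"]) (use True in \<open>auto simp: even_ext_def\<close>)
    then show ?thesis using True by (simp add: even_ext_def)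
  next
    case False
    then have x: "x < 0" using that by simp
    have "((\<lambda>t. \<Sum>k. (seeley_c k * (- (10 ^ k)) ^ j) *\<^sub>R f (p(i := half_chart r (10 ^ k * t)))) has_vector_derivative
       (\<Sum>k. (seeley_c k * (- (10 ^ k)) ^ Suc j) *\<^sub>R g (p(i := half_chart r (10 ^ k * x))))) (at x)"
    proof (rule series_has_vector_derivative[of "{..<0}"])
      show "((\<lambda>t. (seeley_c k * (- (10 ^ k)) ^ j) *\<^sub>R f (p(i := half_chart r (10 ^ k * t)))) has_vector_derivative
         (seeley_c k * (- (10 ^ k)) ^ Suc j) *\<^sub>R g (p(i := half_chart r (10 ^ k * s)))) (at s)" if "s \<in> {..<0}" for k s
      proof -
        have "s < 0" using that by simp
        from bounded_linear.has_vector_derivative[OF bounded_linear_scaleR_right neg[OF this], of "seeley_c k * (- (10 ^ k)) ^ j" k]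
        show ?thesis by (simp add: mult_ac)
      qed
      show "norm ((seeley_c k * (- (10 ^ k)) ^ Suc j) *\<^sub>R g (p(i := half_chart r (10 ^ k * s)))) \<le> \<bar>seeley_c k * (- (10 ^ k)) ^ Suc j\<bar> * M'"
        for k s by (rule seeley_term_bound[OF M'[OF half_chart_in_cube[OF r(1) p i]]])
      show "summable (\<lambda>k. \<bar>seeley_c k * (- (10 ^ k)) ^ Suc j\<bar> * M')" by (rule summable_mult2[OF summable_seeley_c])
      show "summable (\<lambda>k. (seeley_c k * (- (10 ^ k)) ^ j) *\<^sub>R f (p(i := half_chart r (10 ^ k * x))))"
        by (rule summable_seeley_term[OF M[OF half_chart_in_cube[OF r(1) p i]]])
    qed (use x in auto)
    then have "((\<lambda>t. \<Sum>k. (seeley_c k * (- (10 ^ k)) ^ j) *\<^sub>R f (p(i := half_chart r (10 ^ k * t)))) has_vector_derivative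
       even_ext i r (Suc j) g (p(i := x))) (at x)" using x by (simp add: even_ext_def seeley_sum_def)
    then show ?thesis
      by (rule has_vector_derivative_transform_within_open[of _ _ _ "{..<0}"]) (use x in \<open>auto simp: even_ext_def seeley_sum_def\<close>)
  qed
  show ?thesis
  proof (cases "p i = 0")
    case False
    then show ?thesis using ne[of "p i"] by simp
  next
    case True
    have upd: "continuous_on {-r<..<r} (\<lambda>t. p(i := t))"
    proof -
      have "continuous_on {-r<..<r} (\<lambda>t. (p(i := t)) l)" for l by (cases "l = i") simp_all
      then show ?thesis unfolding continuous_on_tup_coords by blast
    qed
    have im: "(\<lambda>t. p(i := t)) ` {-r<..<r} \<subseteq> cube n r" by (simp add: image_subset_iff cube_upd[OF p i] abs_less_iff)
    have c1: "continuous_on {-r<..<r} (\<lambda>t. even_ext i r j f (p(i := t)))"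
      by (rule continuous_on_compose2[OF continuous_on_even_ext[OF f i r] upd im])
    have c2: "continuous_on {-r<..<r} (\<lambda>t. even_ext i r (Suc j) g (p(i := t)))"
      by (rule continuous_on_compose2[OF continuous_on_even_ext[OF g i r] upd im])
    have "((\<lambda>t. even_ext i r j f (p(i := t))) has_vector_derivative even_ext i r (Suc j) g (p(i := 0))) (at 0)"
    proof (rule has_vector_derivative_glue[OF r(1) c1])
      show "isCont (\<lambda>t. even_ext i r (Suc j) g (p(i := t))) 0"
        using c2 r(1) by (simp add: continuous_on_eq_continuous_at)
    qed (rule ne)
    then show ?thesis using True by (metis fun_upd_triv)
  qed
qed

lemma smooth_cube_even_ext:
  fixes f :: "(nat \<Rightarrow> real) \<Rightarrow> 'b::banach"
  assumes f: "smooth_cube n e f" "even_cube n e i f" and i: "i < n" and r: "0 < r" "r < e"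
  shows "smooth_cube n r (even_ext i r j f)"
proof (rule smooth_cube_closure[where R = "\<lambda>G. \<exists>j f. smooth_cube n e f \<and> even_cube n e i f \<and> G = even_ext i r j f"])
  show "\<exists>j' f'. smooth_cube n e f' \<and> even_cube n e i f' \<and> even_ext i r j f = even_ext i r j' f'" using f by blast
next
  fix G :: "(nat \<Rightarrow> real) \<Rightarrow> 'b" assume "\<exists>j f. smooth_cube n e f \<and> even_cube n e i f \<and> G = even_ext i r j f"
  then obtain j f where f: "smooth_cube n e f" and G: "G = even_ext i r j f" by blast
  show "continuous_on (cube n r) G" unfolding G by (rule continuous_on_even_ext[OF f i r])
next
  fix G :: "(nat \<Rightarrow> real) \<Rightarrow> 'b" and l assume "\<exists>j f. smooth_cube n e f \<and> even_cube n e i f \<and> G = even_ext i r j f" and l: "l < n"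
  then obtain j f where f: "smooth_cube n e f" "even_cube n e i f" "G = even_ext i r j f" by blast
  have "\<exists>j' g. smooth_cube n e g \<and> even_cube n e i g \<and>
      (\<forall>p\<in>cube n r. has_partial G l (even_ext i r j' g p) p)"
  proof (cases "l = i")
    case True
    obtain g where g: "smooth_cube n e g" "even_cube n e i g"
      "\<And>p x. p \<in> cube n r \<Longrightarrow> x > 0 \<Longrightarrow> ((\<lambda>s. f (p(i := half_chart r s))) has_vector_derivative g (p(i := half_chart r x))) (at x)"
      using even_extension_step[OF f(1,2) i r] by blast
    show ?thesis unfolding f(3) True
      using even_ext_partial_same[OF f(1) g(1) i r g(3)] g(1,2) by blast
  next
    case False
    obtain D where D: "\<And>i p. i < n \<Longrightarrow> p \<in> cube n e \<Longrightarrow> has_partial f i (D i p) p"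
      "\<And>i. i < n \<Longrightarrow> smooth_cube n e (D i)" using smooth_cube_partials[OF f(1)] by metis
    show ?thesis unfolding f(3)
      using even_ext_partial_other[OF f(1) i r l False D(2)[OF l] D(1)[OF l]] D(2)[OF l]
        even_partial_other[OF f(2) i l False D(1)[OF l]] by blast
  qed
  then show "\<exists>g. (\<exists>j f. smooth_cube n e f \<and> even_cube n e i f \<and> g = even_ext i r j f) \<and>
      (\<forall>p\<in>cube n r. has_partial G l (g p) p)" by blast
qed

text \<open>
  With \<open>s = (p i)\<^sup>2 = r\<^sup>2 x / (1 + x)\<close>, the substitution \<open>x = s / (r\<^sup>2 - s)\<close> turns the extension in the
  variable x into one in the variable s near 0.
\<close>

lemma whitney_even:
  fixes f :: "(nat \<Rightarrow> real) \<Rightarrow> 'b::banach"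
  assumes f: "smooth_germ n f" and i: "i < n" and ev: "\<forall>\<^sub>F p in param_nhds n. f (p(i := - p i)) = f p"
  obtains g where "smooth_germ n g" "\<forall>\<^sub>F p in param_nhds n. f p = g (p(i := (p i)\<^sup>2))"
proof -
  obtain e1 where e1: "e1 > 0" "smooth_cube n e1 f" using f sg_cube by blast
  obtain e2 where e2: "e2 > 0" "\<forall>p\<in>cube n e2. f (p(i := - p i)) = f p" using ev by (auto simp: eventually_param_nhds)
  define e where "e = min e1 e2"
  have e: "e > 0" "smooth_cube n e f" "even_cube n e i f"
    using e1 e2 smooth_cube_mono[OF e1(2), of e] cube_mono[of e e2 n] by (auto simp: e_def even_cube_def)
  define r where "r = e / 2"
  have r: "0 < r" "r < e" using e(1) by (auto simp: r_def)
  define W where "W = even_ext i r 0 f"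
  have W: "smooth_germ n W" unfolding W_def by (rule sgI[OF r(1) smooth_cube_even_ext[OF e(2,3) i r]])
  define h where "h p = p i / (r\<^sup>2 - p i)" for p :: "nat \<Rightarrow> real"
  have h: "smooth_germ n h" "h (\<lambda>_. 0) = 0"
    unfolding h_def using r(1) by (auto intro!: sg_divide sg_diff sg_proj sg_const)
  show ?thesis
  proof (rule that)
    show "smooth_germ n (\<lambda>p. W (p(i := h p)))" by (rule sg_upd[OF W i h])
    show "\<forall>\<^sub>F p in param_nhds n. f p = W ((p(i := (p i)\<^sup>2))(i := h (p(i := (p i)\<^sup>2))))"
      using eventually_in_cube[OF r(1), of n]
    proof eventually_elim
      case (elim p)
      have pi: "\<bar>p i\<bar> < r" using elim i by (auto simp: cube_def)
      then have lt: "(p i)\<^sup>2 < r\<^sup>2" by (metis abs_ge_zero power2_abs power_strict_mono zero_less_numeral)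
      define x where "x = (p i)\<^sup>2 / (r\<^sup>2 - (p i)\<^sup>2)"
      have x: "x \<ge> 0" using lt by (simp add: x_def)
      have "1 + x = r\<^sup>2 / (r\<^sup>2 - (p i)\<^sup>2)" using lt by (simp add: x_def field_simps)
      then have "x / (1 + x) = (p i)\<^sup>2 / r\<^sup>2" using lt by (simp add: x_def)
      then have w: "half_chart r x = \<bar>p i\<bar>" using x r(1) by (simp add: half_chart_def real_sqrt_divide)
      have "f (p(i := \<bar>p i\<bar>)) = f p"
      proof (cases "p i \<ge> 0")
        case True then show ?thesis by simp
      next
        case False
        have "p \<in> cube n e" using elim cube_mono[of r e n] r by auto
        then show ?thesis using False e(3) by (simp add: even_cube_def)
      qed
      moreover have "W (p(i := x)) = f (p(i := half_chart r x))"
      proof (cases "x = 0")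
        case True
        then show ?thesis
          using sums_unique[OF sums_scaleR_left[OF seeley_c_sums[of 0]], of "f (p(i := 0))"] by (simp add: W_def even_ext_def seeley_sum_def)
      next
        case False then show ?thesis using x by (simp add: W_def even_ext_def)
      qed
      moreover have "h (p(i := (p i)\<^sup>2)) = x" by (simp add: h_def x_def)
      ultimately show ?case by (simp only: w fun_upd_upd)
    qed
  qed
qed

text \<open>
  Whitney's theorem for the even part and for the odd part divided by the coordinate. In other
  words: division of f by \<open>t\<^sup>2 - s\<close>, with a remainder that is linear in t.
\<close>

lemma sg_even_odd_split:
  fixes f :: "(nat \<Rightarrow> real) \<Rightarrow> 'b::banach"
  assumes f: "smooth_germ n f" and i: "i < n"
  obtains a b where "smooth_germ n a" "smooth_germ n b"
    "\<forall>\<^sub>F p in param_nhds n. f p = a (p(i := (p i)\<^sup>2)) + p i *\<^sub>R b (p(i := (p i)\<^sup>2))"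
proof -
  have neg: "smooth_germ n (\<lambda>p. - p i)" by (intro sg_minus sg_proj)
  have fn: "smooth_germ n (\<lambda>p. f (p(i := - p i)))" by (rule sg_upd[OF f i neg]) simp
  define ev where "ev p = (1/2) *\<^sub>R (f p + f (p(i := - p i)))" for p
  define od where "od p = (1/2) *\<^sub>R (f p - f (p(i := - p i)))" for p
  have ev: "smooth_germ n ev" unfolding ev_def by (intro sg_scaleR sg_const sg_add f fn)
  have od: "smooth_germ n od" unfolding od_def by (intro sg_scaleR sg_const sg_diff f fn)
  obtain Q where Q: "smooth_germ n Q" "\<forall>\<^sub>F p in param_nhds n. od p - od (p(i := 0)) = p i *\<^sub>R Q p"
    using hadamard[OF od i] by blast
  have odQ: "\<forall>\<^sub>F p in param_nhds n. od p = p i *\<^sub>R Q p"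
    using Q(2) by eventually_elim (simp add: od_def)
  then have odQ': "\<forall>\<^sub>F p in param_nhds n. od (p(i := - p i)) = (p(i := - p i)) i *\<^sub>R Q (p(i := - p i))"
    by (rule eventually_upd[OF _ i neg]) simp
  have Qev: "\<forall>\<^sub>F p in param_nhds n. Q (p(i := - p i)) = Q p"
    using odQ odQ'
  proof eventually_elim
    case (elim p)
    show ?case
    proof (cases "p i = 0")
      case True then show ?thesis by (metis fun_upd_triv minus_zero)
    next
      case False
      have "od (p(i := - p i)) = - od p" by (simp add: od_def algebra_simps)
      then have "p i *\<^sub>R Q (p(i := - p i)) = p i *\<^sub>R Q p" using elim by simp
      then show ?thesis using False by simp
    qed
  qed
  have evev: "\<forall>\<^sub>F p in param_nhds n. ev (p(i := - p i)) = ev p"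
    by (rule always_eventually) (simp add: ev_def add.commute)
  obtain a where a: "smooth_germ n a" "\<forall>\<^sub>F p in param_nhds n. ev p = a (p(i := (p i)\<^sup>2))"
    using whitney_even[OF ev i evev] by blast
  obtain b where b: "smooth_germ n b" "\<forall>\<^sub>F p in param_nhds n. Q p = b (p(i := (p i)\<^sup>2))"
    using whitney_even[OF Q(1) i Qev] by blast
  show ?thesis
  proof (rule that[OF a(1) b(1)])
    show "\<forall>\<^sub>F p in param_nhds n. f p = a (p(i := (p i)\<^sup>2)) + p i *\<^sub>R b (p(i := (p i)\<^sup>2))"
      using a(2) b(2) odQ
    proof eventually_elim
      case (elim p)
      have "f p = ev p + od p"
        by (simp add: ev_def od_def scaleR_add_right[symmetric] scaleR_half_double)
      then show ?case using elim by simp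
    qed
  qed
qed

section \<open>Implicit functions\<close>

lemma ift_estimate:
  fixes a b h x :: real
  assumes "\<bar>x * (1 - b) - h * a\<bar> \<le> \<epsilon> * (\<bar>x\<bar> + \<bar>h\<bar>)" "\<bar>x\<bar> \<le> L * \<bar>h\<bar>" "\<bar>b\<bar> \<le> 1/2" "h \<noteq> 0" "\<epsilon> \<ge> 0"
  shows "\<bar>x / h - a / (1 - b)\<bar> \<le> \<epsilon> * (2 * (L + 1))"
proof -
  have b: "1 - b \<ge> 1/2" using assms(3) by (simp add: abs_le_iff)
  have "x / h - a / (1 - b) = (x * (1 - b) - h * a) / (h * (1 - b))"
    using assms(4) b by (simp add: field_simps)
  then have "\<bar>x / h - a / (1 - b)\<bar> = \<bar>x * (1 - b) - h * a\<bar> / (\<bar>h\<bar> * (1 - b))"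
    using b by (simp add: abs_mult)
  also have "\<dots> \<le> (\<epsilon> * (\<bar>x\<bar> + \<bar>h\<bar>)) / (\<bar>h\<bar> * (1/2))"
    using assms b by (intro frac_le mult_left_mono) auto
  also have "\<dots> \<le> (\<epsilon> * (L * \<bar>h\<bar> + \<bar>h\<bar>)) / (\<bar>h\<bar> * (1/2))"
    using assms by (intro divide_right_mono mult_left_mono) auto
  also have "\<dots> = \<epsilon> * (2 * (L + 1))" using assms(4) by (simp add: field_simps)
  finally show ?thesis .
qed

lemma fixed_point_lipschitz:
  fixes x y z :: real
  assumes "\<bar>x - z\<bar> \<le> 1/2 * \<bar>x - y\<bar>" shows "\<bar>x - y\<bar> \<le> 2 * \<bar>z - y\<bar>"
proof -
  have "\<bar>x - y\<bar> \<le> \<bar>x - z\<bar> + \<bar>z - y\<bar>" by linarith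
  also have "\<dots> \<le> 1/2 * \<bar>x - y\<bar> + \<bar>z - y\<bar>" using assms by (rule add_right_mono)
  finally show ?thesis by simp
qed

lemma cube_Suc_upd: "p \<in> cube n d \<Longrightarrow> d \<le> e \<Longrightarrow> \<bar>y\<bar> < e \<Longrightarrow> p(n := y) \<in> cube (Suc n) e"
  by (auto simp: cube_def less_Suc_eq intro: less_le_trans)

text \<open>
  The unknown is the last coordinate. As \<open>\<rho>\<close> vanishes on the subspace in which the first m
  coordinates are zero, its derivative in the direction of the unknown is small near 0. So the
  equation is a contractive fixed point equation, and the derivatives of its solution are those
  predicted by implicit differentiation.
\<close>

lemma ift_scalar:
  fixes \<rho> :: "(nat \<Rightarrow> real) \<Rightarrow> real"
  assumes \<rho>: "smooth_germ (Suc n) \<rho>" and m: "m \<le> n"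
    and van: "\<forall>\<^sub>F p in param_nhds (Suc n). (\<forall>i<m. p i = 0) \<longrightarrow> \<rho> p = 0"
  obtains \<phi> where "smooth_germ n \<phi>"
    "\<forall>\<^sub>F p in param_nhds n. (\<forall>i<m. p i = 0) \<longrightarrow> \<phi> p = 0"
    "\<forall>\<^sub>F p in param_nhds n. \<rho> (p(n := \<phi> p)) = \<phi> p"
proof -
  obtain e1 where e1: "e1 > 0" "smooth_cube (Suc n) e1 \<rho>" using \<rho> sg_cube by blast
  obtain D where D: "\<And>i p. i < Suc n \<Longrightarrow> p \<in> cube (Suc n) e1 \<Longrightarrow> has_partial \<rho> i (D i p) p"
    "\<And>i. i < Suc n \<Longrightarrow> smooth_cube (Suc n) e1 (D i)" using smooth_cube_partials[OF e1(2)] by metis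
  obtain e2 where e2: "e2 > 0" "\<forall>p\<in>cube (Suc n) e2. (\<forall>i<m. p i = 0) \<longrightarrow> \<rho> p = 0"
    using van by (auto simp: eventually_param_nhds)
  have D0: "D n (\<lambda>_. 0) = 0"
  proof -
    have "((\<lambda>t. \<rho> ((\<lambda>_. 0)(n := t))) has_vector_derivative D n (\<lambda>_. 0)) (at ((\<lambda>_. 0) n))"
      by (rule D(1)) (use e1 in \<open>auto intro: zero_in_cube\<close>)
    moreover have "((\<lambda>t. \<rho> ((\<lambda>_. 0)(n := t))) has_vector_derivative 0) (at 0)"
    proof (rule has_vector_derivative_transform_within_open[OF has_vector_derivative_const, of "{-e2<..<e2}"])
      fix t assume "t \<in> {-e2<..<e2}"
      then have "(\<lambda>_. 0)(n := t) \<in> cube (Suc n) e2" by (auto simp: cube_def abs_less_iff)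
      moreover have "\<forall>i<m. ((\<lambda>_. 0)(n := t)) i = 0" using m by auto
      ultimately show "0 = \<rho> ((\<lambda>_. 0)(n := t))" using e2(2) by auto
    qed (use e2 in auto)
    ultimately show ?thesis using vector_derivative_unique_at by metis
  qed
  have "smooth_germ (Suc n) (D n)" by (rule sgI[OF e1(1) D(2)]) simp
  from sg_near[OF this, of "1/2"] obtain e3 where e3: "e3 > 0" "\<forall>p\<in>cube (Suc n) e3. \<bar>D n p\<bar> < 1/2"
    by (auto simp: eventually_param_nhds D0)
  define e where "e = min e1 (min e2 e3)"
  have e: "e > 0" "e \<le> e1" "e \<le> e2" "e \<le> e3" using e1 e2 e3 by (auto simp: e_def)
  have sub: "cube (Suc n) e \<subseteq> cube (Suc n) e1" "cube (Suc n) e \<subseteq> cube (Suc n) e2" "cube (Suc n) e \<subseteq> cube (Suc n) e3"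
    using cube_mono e by blast+
  have Db: "\<bar>D n p\<bar> \<le> 1/2" if "p \<in> cube (Suc n) e" for p using e3(2) sub(3) that by force
  have "\<forall>\<^sub>F p in param_nhds (Suc n). norm (\<rho> p - \<rho> (\<lambda>_. 0)) < e / 4"
    by (rule sg_near[OF \<rho>]) (use e in simp)
  moreover have "\<rho> (\<lambda>_. 0) = 0" using e2 zero_in_cube by auto
  ultimately obtain d0 where d0: "d0 > 0" "\<forall>p\<in>cube (Suc n) d0. \<bar>\<rho> p\<bar> < e / 4"
    by (auto simp: eventually_param_nhds)
  define d where "d = min d0 e"
  have d: "d > 0" "d \<le> d0" "d \<le> e" using d0 e by (auto simp: d_def)
  \<comment> \<open>the derivative in the last direction is at most 1/2: a contraction\<close>
  have lip: "\<bar>\<rho> (p(n := y)) - \<rho> (p(n := y'))\<bar> \<le> 1/2 * \<bar>y - y'\<bar>"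
    if p: "p \<in> cube n d" and y: "\<bar>y\<bar> < e" "\<bar>y'\<bar> < e" for p y y'
  proof -
    have "norm (\<rho> (p(n := y)) - \<rho> (p(n := y')) - (y - y') *\<^sub>R 0) \<le> \<bar>y - y'\<bar> * (1/2)"
    proof (rule vector_bound_linearization[where f = "\<lambda>s. \<rho> (p(n := s))" and f' = "\<lambda>s. D n (p(n := s))"])
      fix s assume "s \<in> closed_segment y' y"
      then have "\<bar>s\<bar> < e" using y by (auto simp: closed_segment_eq_real_ivl split: if_splits)
      then have q: "p(n := s) \<in> cube (Suc n) e" by (rule cube_Suc_upd[OF p d(3)])
      then show "norm (D n (p(n := s)) - 0) \<le> 1/2" using Db by simp
      show "((\<lambda>s. \<rho> (p(n := s))) has_vector_derivative D n (p(n := s))) (at s)"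
        using D(1)[of n "p(n := s)"] q sub(1) by auto
    qed
    then show ?thesis by simp
  qed
  have ex: "\<exists>!y. y \<in> {-(e/2)..e/2} \<and> \<rho> (p(n := y)) = y" if p: "p \<in> cube n d" for p
  proof -
    have "p \<in> cube (Suc n) d0" using p d by (auto simp: cube_def less_Suc_eq intro: less_le_trans)
    moreover have "p(n := 0) = p" using p by (auto simp: cube_def)
    ultimately have r0: "\<bar>\<rho> (p(n := 0))\<bar> < e / 4" using d0(2) by simp
    have "\<exists>!y\<in>{-(e/2)..e/2}. \<rho> (p(n := y)) = y"
    proof (rule Banach_fix[where c = "1/2"])
      show "(\<lambda>y. \<rho> (p(n := y))) ` {-(e/2)..e/2} \<subseteq> {-(e/2)..e/2}"
      proof safe
        fix y assume "y \<in> {-(e/2)..e/2}"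
        then have y: "\<bar>y\<bar> \<le> e / 2" by (auto simp: abs_le_iff)
        then have "\<bar>\<rho> (p(n := y)) - \<rho> (p(n := 0))\<bar> \<le> 1/2 * \<bar>y - 0\<bar>"
          using e by (intro lip p) auto
        also have "1/2 * \<bar>y - 0\<bar> \<le> e / 4" using y by simp
        finally have 1: "\<bar>\<rho> (p(n := y)) - \<rho> (p(n := 0))\<bar> \<le> e / 4" .
        have "\<bar>\<rho> (p(n := y))\<bar> \<le> \<bar>\<rho> (p(n := y)) - \<rho> (p(n := 0))\<bar> + \<bar>\<rho> (p(n := 0))\<bar>" by linarith
        also have "\<dots> \<le> e / 4 + e / 4" by (rule add_mono[OF 1 less_imp_le[OF r0]])
        finally have "\<bar>\<rho> (p(n := y))\<bar> \<le> e / 2" by simp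
        then show "\<rho> (p(n := y)) \<in> {-(e/2)..e/2}" by (auto simp: abs_le_iff)
      qed
      show "dist (\<rho> (p(n := x))) (\<rho> (p(n := y))) \<le> 1/2 * dist x y"
        if "x \<in> {-(e/2)..e/2}" "y \<in> {-(e/2)..e/2}" for x y
        unfolding dist_real_def using that e by (intro lip p) auto
    qed (use e in \<open>auto simp: complete_eq_closed\<close>)
    then show ?thesis by blast
  qed
  define \<phi> where "\<phi> p = (THE y. y \<in> {-(e/2)..e/2} \<and> \<rho> (p(n := y)) = y)" for p
  have \<phi>: "\<bar>\<phi> p\<bar> \<le> e / 2" "\<rho> (p(n := \<phi> p)) = \<phi> p" if "p \<in> cube n d" for p
    using theI'[OF ex[OF that]] unfolding \<phi>_def by (auto simp: abs_le_iff)
  have \<phi>e: "\<bar>\<phi> p\<bar> < e" if "p \<in> cube n d" for p using \<phi>(1)[OF that] e by linarith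
  have Pin: "p(n := \<phi> p) \<in> cube (Suc n) e" if "p \<in> cube n d" for p
    by (rule cube_Suc_upd[OF that d(3) \<phi>e[OF that]])
  have lip\<phi>: "\<bar>\<phi> q - \<phi> p\<bar> \<le> 2 * \<bar>\<rho> (q(n := \<phi> p)) - \<rho> (p(n := \<phi> p))\<bar>"
    if p: "p \<in> cube n d" and q: "q \<in> cube n d" for p q
  proof -
    have "\<bar>\<rho> (q(n := \<phi> q)) - \<rho> (q(n := \<phi> p))\<bar> \<le> 1/2 * \<bar>\<phi> q - \<phi> p\<bar>"
      by (rule lip[OF q \<phi>e[OF q] \<phi>e[OF p]])
    then have "\<bar>\<phi> q - \<rho> (q(n := \<phi> p))\<bar> \<le> 1/2 * \<bar>\<phi> q - \<phi> p\<bar>" by (simp only: \<phi>(2)[OF q])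
    from fixed_point_lipschitz[OF this] show ?thesis by (simp only: \<phi>(2)[OF p])
  qed
  have cont\<phi>: "continuous_on (cube n d) \<phi>"
    unfolding continuous_on_def
  proof
    fix p assume p: "p \<in> cube n d"
    have "continuous_on (cube n d) (\<lambda>q. \<rho> (q(n := \<phi> p)))"
    proof (rule continuous_on_compose2[OF smooth_cube_cont[OF e1(2)]])
      have "continuous_on (cube n d) (\<lambda>q. (q(n := \<phi> p)) l)" for l
        using continuous_on_product_then_coordinatewise[OF continuous_on_id, of "cube n d" l] by (cases "l = n") simp_all
      then show "continuous_on (cube n d) (\<lambda>q. q(n := \<phi> p))" unfolding continuous_on_tup_coords by blast
      show "(\<lambda>q. q(n := \<phi> p)) ` cube n d \<subseteq> cube (Suc n) e1"
        using cube_Suc_upd[OF _ d(3) \<phi>e[OF p]] sub(1) by blast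
    qed
    then have "((\<lambda>q. \<rho> (q(n := \<phi> p))) \<longlongrightarrow> \<rho> (p(n := \<phi> p))) (at p within cube n d)"
      using p unfolding continuous_on_def by blast
    then have "((\<lambda>q. 2 * \<bar>\<rho> (q(n := \<phi> p)) - \<rho> (p(n := \<phi> p))\<bar>) \<longlongrightarrow> 2 * \<bar>\<rho> (p(n := \<phi> p)) - \<rho> (p(n := \<phi> p))\<bar>) (at p within cube n d)"
      by (intro tendsto_intros)
    then have "((\<lambda>q. 2 * \<bar>\<rho> (q(n := \<phi> p)) - \<rho> (p(n := \<phi> p))\<bar>) \<longlongrightarrow> 0) (at p within cube n d)" by simp
    moreover have "\<forall>\<^sub>F q in at p within cube n d. norm (\<phi> q - \<phi> p) \<le> 2 * \<bar>\<rho> (q(n := \<phi> p)) - \<rho> (p(n := \<phi> p))\<bar>"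
      unfolding eventually_at_filter by (rule always_eventually) (use lip\<phi>[OF p] in auto)
    ultimately have "((\<lambda>q. \<phi> q - \<phi> p) \<longlongrightarrow> 0) (at p within cube n d)" by (rule Lim_null_comparison[rotated])
    then show "(\<phi> \<longlongrightarrow> \<phi> p) (at p within cube n d)" by (simp add: LIM_zero_iff)
  qed
  have deriv: "has_partial \<phi> j (D j (p(n := \<phi> p)) * inverse (1 - D n (p(n := \<phi> p)))) p"
    if j: "j < n" and p: "p \<in> cube n d" for j p
  proof -
    define P where "P = p(n := \<phi> p)"
    define a where "a = D j P"
    define b where "b = D n P"
    define x where "x t = \<phi> (p(j := t)) - \<phi> p" for t
    have P: "P \<in> cube (Suc n) e" unfolding P_def by (rule Pin[OF p])
    have b: "\<bar>b\<bar> \<le> 1/2" unfolding b_def by (rule Db[OF P])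
    have pj: "p j \<in> {-d<..<d}" using p j by (auto simp: cube_def abs_less_iff)
    have x0: "(x \<longlongrightarrow> 0) (at (p j))"
    proof -
      have "continuous_on {-d<..<d} (\<lambda>t. \<phi> (p(j := t)))"
      proof (rule continuous_on_compose2[OF cont\<phi>])
        have "continuous_on {-d<..<d} (\<lambda>t. (p(j := t)) l)" for l by (cases "l = j") simp_all
        then show "continuous_on {-d<..<d} (\<lambda>t. p(j := t))" unfolding continuous_on_tup_coords by blast
        show "(\<lambda>t. p(j := t)) ` {-d<..<d} \<subseteq> cube n d" by (simp add: image_subset_iff cube_upd[OF p j] abs_less_iff)
      qed
      then have "isCont (\<lambda>t. \<phi> (p(j := t))) (p j)" using pj by (simp add: continuous_on_eq_continuous_at)
      then show ?thesis unfolding x_def isCont_def by (simp add: LIM_zero_iff)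
    qed
    have est: "\<forall>\<^sub>F t in at (p j). \<bar>x t * (1 - b) - (t - p j) * a\<bar> \<le> \<epsilon> * (\<bar>x t\<bar> + \<bar>t - p j\<bar>)
        \<and> \<bar>x t\<bar> \<le> 2 * (\<bar>a\<bar> + \<epsilon>) * \<bar>t - p j\<bar>" if \<epsilon>: "\<epsilon> > 0" for \<epsilon>
    proof -
      have P1: "P \<in> cube (Suc n) e1" using P sub by auto
      obtain \<delta>1 where \<delta>1: "\<delta>1 > 0" "\<forall>q\<in>cube (Suc n) e1. (\<forall>i<Suc n. \<bar>q i - P i\<bar> < \<delta>1) \<longrightarrow> norm (D j q - D j P) < \<epsilon>"
        using continuous_on_cube_eps_delta[OF smooth_cube_cont[OF D(2)[OF less_SucI[OF j]]] P1 \<epsilon>] by (elim exE conjE)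
      obtain \<delta>2 where \<delta>2: "\<delta>2 > 0" "\<forall>q\<in>cube (Suc n) e1. (\<forall>i<Suc n. \<bar>q i - P i\<bar> < \<delta>2) \<longrightarrow> norm (D n q - D n P) < \<epsilon>"
        using continuous_on_cube_eps_delta[OF smooth_cube_cont[OF D(2)[OF lessI]] P1 \<epsilon>] by (elim exE conjE)
      define \<delta> where "\<delta> = min \<delta>1 \<delta>2"
      have \<delta>: "\<delta> > 0" "\<delta> \<le> \<delta>1" "\<delta> \<le> \<delta>2" using \<delta>1 \<delta>2 by (auto simp: \<delta>_def)
      have "\<forall>\<^sub>F t in at (p j). \<bar>x t\<bar> < \<delta>" using x0 \<delta>(1) by (auto simp: tendsto_iff dist_real_def)
      moreover have "\<forall>\<^sub>F t in at (p j). \<bar>t - p j\<bar> < \<delta>"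
        using \<delta>(1) unfolding eventually_at by (intro exI[of _ \<delta>]) (auto simp: dist_real_def)
      moreover have "\<forall>\<^sub>F t in at (p j). t \<in> {-d<..<d}"
        by (rule eventually_at_in_open'[OF open_greaterThanLessThan pj])
      ultimately show ?thesis
      proof eventually_elim
        case (elim t)
        define q where "q = p(j := t)"
        have q: "q \<in> cube n d" unfolding q_def using elim(3) by (simp add: cube_upd[OF p j] abs_less_iff)
        have near: "(p(j := s))(n := y) \<in> cube (Suc n) e1 \<and> (\<forall>i<Suc n. \<bar>((p(j := s))(n := y)) i - P i\<bar> < \<delta>)"
          if s: "s \<in> closed_segment (p j) t" and y: "y \<in> closed_segment (\<phi> p) (\<phi> q)" for s y
        proof -
          have "\<bar>s - p j\<bar> \<le> \<bar>t - p j\<bar>" "\<bar>s\<bar> < d" using s elim(3) pj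
            by (auto simp: closed_segment_eq_real_ivl abs_less_iff split: if_splits)
          moreover have "\<bar>y - \<phi> p\<bar> \<le> \<bar>x t\<bar>" "\<bar>y\<bar> < e" using y \<phi>e[OF p] \<phi>e[OF q]
            by (auto simp: closed_segment_eq_real_ivl x_def q_def split: if_splits)
          moreover have "p(j := s) \<in> cube n d" using calculation by (simp add: cube_upd[OF p j])
          ultimately show ?thesis
            using cube_Suc_upd[of "p(j := s)" n d e y] d(3) sub(1) elim(1,2) j \<delta>(1) by (auto simp: P_def less_Suc_eq)
        qed
        have A: "norm (\<rho> (q(n := \<phi> q)) - \<rho> (q(n := \<phi> p)) - (\<phi> q - \<phi> p) *\<^sub>R b) \<le> \<bar>\<phi> q - \<phi> p\<bar> * \<epsilon>"
        proof (rule vector_bound_linearization[where f = "\<lambda>s. \<rho> (q(n := s))" and f' = "\<lambda>s. D n (q(n := s))"])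
          fix y assume y: "y \<in> closed_segment (\<phi> p) (\<phi> q)"
          note n = near[OF ends_in_segment(2) y, folded q_def]
          show "((\<lambda>s. \<rho> (q(n := s))) has_vector_derivative D n (q(n := y))) (at y)"
            using D(1)[of n "q(n := y)"] n by auto
          show "norm (D n (q(n := y)) - b) \<le> \<epsilon>" unfolding b_def
            using \<delta>2(2) n \<delta>(3) by (meson less_imp_le less_le_trans)
        qed
        have B: "norm (\<rho> (q(n := \<phi> p)) - \<rho> (p(n := \<phi> p)) - (t - p j) *\<^sub>R a) \<le> \<bar>t - p j\<bar> * \<epsilon>"
        proof -
          have nj: "(p(j := s))(n := \<phi> p) = P(j := s)" for s using j by (simp add: P_def fun_upd_twist)
          have "norm (\<rho> (P(j := t)) - \<rho> (P(j := p j)) - (t - p j) *\<^sub>R a) \<le> \<bar>t - p j\<bar> * \<epsilon>"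
          proof (rule vector_bound_linearization[where f = "\<lambda>s. \<rho> (P(j := s))" and f' = "\<lambda>s. D j (P(j := s))"])
            fix s assume s: "s \<in> closed_segment (p j) t"
            note n = near[OF s ends_in_segment(1), unfolded nj]
            show "((\<lambda>s. \<rho> (P(j := s))) has_vector_derivative D j (P(j := s))) (at s)"
              using D(1)[of j "P(j := s)"] n j by auto
            show "norm (D j (P(j := s)) - a) \<le> \<epsilon>" unfolding a_def
              using \<delta>1(2) n \<delta>(2) by (meson less_imp_le less_le_trans)
          qed
          moreover have "P(j := p j) = p(n := \<phi> p)" "q(n := \<phi> p) = P(j := t)" using nj[of "p j"] nj[of t] by (simp_all add: q_def)
          ultimately show ?thesis by simp
        qed
        have xt: "x t = \<phi> q - \<phi> p" by (simp add: x_def q_def)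
        have eq: "\<rho> (q(n := \<phi> q)) - \<rho> (p(n := \<phi> p)) = x t" using \<phi>(2)[OF p] \<phi>(2)[OF q] xt by simp
        have "\<bar>x t * (1 - b) - (t - p j) * a\<bar> \<le> \<bar>x t\<bar> * \<epsilon> + \<bar>t - p j\<bar> * \<epsilon>"
          using A B eq unfolding xt[symmetric] by (simp add: algebra_simps abs_le_iff)
        moreover have "\<bar>x t\<bar> \<le> 2 * (\<bar>a\<bar> + \<epsilon>) * \<bar>t - p j\<bar>"
        proof -
          have "\<bar>\<rho> (q(n := \<phi> p)) - \<rho> (p(n := \<phi> p))\<bar> \<le> \<bar>(t - p j) * a\<bar> + \<bar>t - p j\<bar> * \<epsilon>"
            using B by (simp add: abs_le_iff) linarith
          then have "2 * \<bar>\<rho> (q(n := \<phi> p)) - \<rho> (p(n := \<phi> p))\<bar> \<le> 2 * (\<bar>(t - p j) * a\<bar> + \<bar>t - p j\<bar> * \<epsilon>)" by simp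
          with lip\<phi>[OF p q] have "\<bar>x t\<bar> \<le> 2 * (\<bar>(t - p j) * a\<bar> + \<bar>t - p j\<bar> * \<epsilon>)" unfolding xt by (rule order_trans)
          also have "\<dots> = 2 * (\<bar>a\<bar> + \<epsilon>) * \<bar>t - p j\<bar>" by (simp only: abs_mult) (simp add: algebra_simps)
          finally show ?thesis .
        qed
        ultimately show ?case by (simp add: algebra_simps)
      qed
    qed
    have "((\<lambda>t. x t / (t - p j)) \<longlongrightarrow> a / (1 - b)) (at (p j))"
    proof (rule tendstoI)
      fix \<epsilon> :: real assume \<epsilon>: "\<epsilon> > 0"
      define L where "L = 2 * (\<bar>a\<bar> + 1)"
      have L: "L > 0" by (simp add: L_def)
      define \<eta> where "\<eta> = min 1 (\<epsilon> / (4 * (L + 1)))"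
      have \<eta>: "\<eta> > 0" "\<eta> \<le> 1" "\<eta> \<le> \<epsilon> / (4 * (L + 1))" using \<epsilon> L by (auto simp: \<eta>_def)
      show "\<forall>\<^sub>F t in at (p j). dist (x t / (t - p j)) (a / (1 - b)) < \<epsilon>"
        using est[OF \<eta>(1)] eventually_neq_at_within[of "p j" "p j" UNIV]
      proof eventually_elim
        case (elim t)
        have "2 * (\<bar>a\<bar> + \<eta>) * \<bar>t - p j\<bar> \<le> L * \<bar>t - p j\<bar>"
          using \<eta>(2) by (intro mult_right_mono) (auto simp: L_def)
        then have "\<bar>x t\<bar> \<le> L * \<bar>t - p j\<bar>" using elim(1) by linarith
        then have "\<bar>x t / (t - p j) - a / (1 - b)\<bar> \<le> \<eta> * (2 * (L + 1))"
          using elim b \<eta>(1) by (intro ift_estimate) auto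
        also have "\<dots> \<le> \<epsilon> / (4 * (L + 1)) * (2 * (L + 1))"
          using \<eta>(3) L by (intro mult_right_mono) auto
        also have "\<dots> = \<epsilon> / 2" using L by (simp add: field_simps)
        also have "\<dots> < \<epsilon>" using \<epsilon> by simp
        finally show ?case by (simp add: dist_real_def)
      qed
    qed
    then have "((\<lambda>t. \<phi> (p(j := t))) has_real_derivative a / (1 - b)) (at (p j))"
      unfolding has_field_derivative_iff x_def by simp
    then show ?thesis
      unfolding has_real_derivative_iff_has_vector_derivative a_def b_def P_def divide_inverse .
  qed
  have Ptup: "p(n := \<phi> p) = tup (Suc n) (\<lambda>i. (if i < n then (\<lambda>p. p i) else \<phi>) p)" if "p \<in> cube n d" for p
    using that by (auto simp: tup_def cube_def fun_eq_iff)
  have "Ck_on n k (cube n d) \<phi>" for k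
  proof (induction k)
    case 0 then show ?case using cont\<phi> by (simp only: Ck_0)
  next
    case (Suc k)
    have comp: "Ck_on n k (cube n d) (\<lambda>p. D j (p(n := \<phi> p)))" if j: "j < Suc n" for j
    proof (rule Ck_cong)
      show "Ck_on n k (cube n d) (\<lambda>p. D j (tup (Suc n) (\<lambda>i. (if i < n then (\<lambda>p. p i) else \<phi>) p)))"
      proof (rule Ck_comp)
        show "Ck_on (Suc n) k (cube (Suc n) e1) (D j)" using D(2)[OF j] by (simp add: smooth_cube_def)
        show "Ck_on n k (cube n d) (if i < n then \<lambda>p. p i else \<phi>)" if "i < Suc n" for i
          using Suc Ck_proj by simp
        show "\<bar>(if i < n then \<lambda>p. p i else \<phi>) q\<bar> < e1" if "i < Suc n" "q \<in> cube n d" for i q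
          using that \<phi>e[OF that(2)] e d by (auto simp: cube_def intro: less_le_trans)
      qed
    qed (simp add: Ptup)
    show ?case unfolding Ck_Suc
    proof (intro conjI cont\<phi> exI[of _ "\<lambda>j p. D j (p(n := \<phi> p)) * inverse (1 + (-1) * D n (p(n := \<phi> p)))"] allI impI ballI)
      fix j p assume j: "j < n" and "p \<in> cube n d"
      then show "has_partial \<phi> j (D j (p(n := \<phi> p)) * inverse (1 + (-1) * D n (p(n := \<phi> p)))) p"
        using deriv by simp
    next
      fix j assume j: "j < n"
      show "Ck_on n k (cube n d) (\<lambda>p. D j (p(n := \<phi> p)) * inverse (1 + (-1) * D n (p(n := \<phi> p))))"
      proof (rule Ck_bilinear[OF bounded_bilinear_mult comp Ck_inverse])
        show "Ck_on n k (cube n d) (\<lambda>p. 1 + (-1) * D n (p(n := \<phi> p)))"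
          by (rule Ck_add[OF Ck_const Ck_bilinear[OF bounded_bilinear_mult Ck_const comp]]) simp
        show "1 + (-1) * D n (p(n := \<phi> p)) \<noteq> 0" if "p \<in> cube n d" for p
          using Db[OF Pin[OF that]] by (auto simp: abs_le_iff)
      qed (use j in simp)
    qed
  qed
  then have sm: "smooth_germ n \<phi>" using d(1) by (auto simp: smooth_cube_def intro: sgI)
  show ?thesis
  proof (rule that[OF sm])
    show "\<forall>\<^sub>F p in param_nhds n. \<rho> (p(n := \<phi> p)) = \<phi> p"
      using \<phi>(2) d(1) by (auto simp: eventually_param_nhds)
    have "\<phi> p = 0" if p: "p \<in> cube n d" and z: "\<forall>i<m. p i = 0" for p
    proof -
      have "p(n := 0) \<in> cube (Suc n) e" using cube_Suc_upd[OF p d(3), of 0] e by simp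
      moreover have "\<forall>i<m. (p(n := 0)) i = 0" using z by simp
      ultimately have "\<rho> (p(n := 0)) = 0" using e2(2) sub(2) by blast
      moreover have "0 \<in> {-(e/2)..e/2}" using e by simp
      ultimately show ?thesis unfolding \<phi>_def using ex[OF p] by (intro the1_equality) auto
    qed
    then show "\<forall>\<^sub>F p in param_nhds n. (\<forall>i<m. p i = 0) \<longrightarrow> \<phi> p = 0"
      using d(1) by (auto simp: eventually_param_nhds)
  qed
qed

text \<open>
  The unknowns are eliminated one after the other, from the last one on. Vanishing for zero
  parameters is inherited by the solution and therefore by the remaining equations after the
  substitution.
\<close>

lemma ift:
  fixes \<rho> :: "nat \<Rightarrow> (nat \<Rightarrow> real) \<Rightarrow> real"
  assumes "\<And>i. i < r \<Longrightarrow> smooth_germ (m + r) (\<rho> i)"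
    and "\<And>i. i < r \<Longrightarrow> \<forall>\<^sub>F p in param_nhds (m + r). (\<forall>j<m. p j = 0) \<longrightarrow> \<rho> i p = 0"
  shows "\<exists>\<phi>. (\<forall>i<r. smooth_germ m (\<phi> i) \<and> \<phi> i (\<lambda>_. 0) = 0 \<and>
     (\<forall>\<^sub>F p in param_nhds m. \<rho> i (tup (m + r) (\<lambda>j. if j < m then p j else \<phi> (j - m) p)) = \<phi> i p))"
  using assms
proof (induction r arbitrary: \<rho>)
  case 0
  then show ?case by simp
next
  case (Suc r)
  obtain \<psi> where \<psi>: "smooth_germ (m + r) \<psi>"
    "\<forall>\<^sub>F p in param_nhds (m + r). (\<forall>i<m. p i = 0) \<longrightarrow> \<psi> p = 0"
    "\<forall>\<^sub>F p in param_nhds (m + r). \<rho> r (p(m + r := \<psi> p)) = \<psi> p"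
    using ift_scalar[of "m + r" "\<rho> r" m] Suc.prems[of r] by auto
  have \<psi>0: "\<psi> (\<lambda>_. 0) = 0" using param_nhds_at_0[OF \<psi>(2)] by simp
  define g where "g i = (if i < m + r then (\<lambda>p. p i) else \<psi>)" for i
  have g: "smooth_germ (m + r) (g i)" "g i (\<lambda>_. 0) = 0" for i
    using \<psi>(1) \<psi>0 sg_proj by (auto simp: g_def)
  have up: "\<forall>\<^sub>F p in param_nhds (m + r). tup (m + Suc r) (\<lambda>i. g i p) = p(m + r := \<psi> p)"
    using eventually_coord_0 by eventually_elim (auto simp: tup_def g_def fun_eq_iff)
  define \<rho>' where "\<rho>' i p = \<rho> i (tup (m + Suc r) (\<lambda>j. g j p))" for i p
  have "\<exists>\<phi>. (\<forall>i<r. smooth_germ m (\<phi> i) \<and> \<phi> i (\<lambda>_. 0) = 0 \<and>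
     (\<forall>\<^sub>F p in param_nhds m. \<rho>' i (tup (m + r) (\<lambda>j. if j < m then p j else \<phi> (j - m) p)) = \<phi> i p))"
  proof (rule Suc.IH)
    fix i assume i: "i < r"
    show "smooth_germ (m + r) (\<rho>' i)"
      unfolding \<rho>'_def by (rule sg_comp[OF Suc.prems(1) g]) (use i in auto)
    have "\<forall>\<^sub>F p in param_nhds (m + r). (\<forall>j<m. tup (m + Suc r) (\<lambda>j. g j p) j = 0) \<longrightarrow> \<rho>' i p = 0"
      unfolding \<rho>'_def by (rule eventually_tup[OF Suc.prems(2) g]) (use i in auto)
    then show "\<forall>\<^sub>F p in param_nhds (m + r). (\<forall>j<m. p j = 0) \<longrightarrow> \<rho>' i p = 0"
      by eventually_elim (auto simp: tup_def g_def)
  qed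
  then obtain \<phi> where \<phi>: "\<And>i. i < r \<Longrightarrow> smooth_germ m (\<phi> i)" "\<And>i. i < r \<Longrightarrow> \<phi> i (\<lambda>_. 0) = 0"
    "\<And>i. i < r \<Longrightarrow> \<forall>\<^sub>F p in param_nhds m. \<rho>' i (tup (m + r) (\<lambda>j. if j < m then p j else \<phi> (j - m) p)) = \<phi> i p"
    by blast
  define h where "h j = (if j < m then (\<lambda>p. p j) else \<phi> (j - m))" for j
  have h: "smooth_germ m (h j)" "h j (\<lambda>_. 0) = 0" if "j < m + r" for j
    using \<phi>(1,2)[of "j - m"] that sg_proj by (auto simp: h_def)
  define T where "T p = tup (m + r) (\<lambda>j. h j p)" for p
  have T: "T p = tup (m + r) (\<lambda>j. if j < m then p j else \<phi> (j - m) p)" for p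
    unfolding T_def h_def by (intro arg_cong[where f = "tup (m + r)"]) auto
  define \<phi>' where "\<phi>' i = (if i < r then \<phi> i else (\<lambda>p. \<psi> (T p)))" for i
  have T': "(T p)(m + r := \<psi> (T p)) = tup (m + Suc r) (\<lambda>j. if j < m then p j else \<phi>' (j - m) p)" for p
  proof (rule ext)
    fix j show "((T p)(m + r := \<psi> (T p))) j = tup (m + Suc r) (\<lambda>j. if j < m then p j else \<phi>' (j - m) p) j"
    proof (cases "j = m + r")
      case True then show ?thesis by (simp add: tup_def \<phi>'_def)
    next
      case False
      have "T p j = tup (m + r) (\<lambda>j. if j < m then p j else \<phi> (j - m) p) j" by (simp only: T)
      then show ?thesis using False by (auto simp: tup_def \<phi>'_def)
    qed
  qed
  have Tev: "\<forall>\<^sub>F p in param_nhds m. P (T p)" if "eventually P (param_nhds (m + r))" for P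
    unfolding T_def by (rule eventually_tup[OF that h])
  show ?case
  proof (intro exI[of _ \<phi>'] allI impI)
    fix i assume "i < Suc r"
    show "smooth_germ m (\<phi>' i) \<and> \<phi>' i (\<lambda>_. 0) = 0 \<and>
     (\<forall>\<^sub>F p in param_nhds m. \<rho> i (tup (m + Suc r) (\<lambda>j. if j < m then p j else \<phi>' (j - m) p)) = \<phi>' i p)"
    proof (cases "i < r")
      case True
      have "\<forall>\<^sub>F p in param_nhds m. \<rho> i (tup (m + Suc r) (\<lambda>j. if j < m then p j else \<phi>' (j - m) p)) = \<phi>' i p"
        using \<phi>(3)[OF True] Tev[OF up]
      proof eventually_elim
        case (elim p)
        then show ?case using True unfolding T[symmetric] T'[symmetric] by (simp add: \<rho>'_def \<phi>'_def)
      qed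
      then show ?thesis using \<phi>(1,2)[OF True] True by (simp add: \<phi>'_def)
    next
      case False
      then have i: "i = r" using \<open>i < Suc r\<close> by simp
      have "T (\<lambda>_. 0) = (\<lambda>_. 0)" using h(2) by (auto simp: T_def tup_def fun_eq_iff)
      then have "\<phi>' i (\<lambda>_. 0) = 0" using False \<psi>0 by (simp add: \<phi>'_def)
      moreover have "smooth_germ m (\<phi>' i)"
        using sg_comp[OF \<psi>(1) h] False by (simp add: \<phi>'_def T_def)
      moreover have "\<forall>\<^sub>F p in param_nhds m. \<rho> i (tup (m + Suc r) (\<lambda>j. if j < m then p j else \<phi>' (j - m) p)) = \<phi>' i p"
        using Tev[OF \<psi>(3)] by eventually_elim (subst T'[symmetric], simp add: i \<phi>'_def)
      ultimately show ?thesis by blast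
    qed
  qed
qed

section \<open>Normal form of equivariant germs\<close>

lemma sg_upd2:
  assumes "smooth_germ n F" "i < n" "j < n" "i \<noteq> j" "smooth_germ n g" "g (\<lambda>_. 0) = 0" "smooth_germ n h" "h (\<lambda>_. 0) = 0"
  shows "smooth_germ n (\<lambda>p. F (p(i := g p, j := h p)))"
    and "eventually P (param_nhds n) \<Longrightarrow> \<forall>\<^sub>F p in param_nhds n. P (p(i := g p, j := h p))"
proof -
  define k where "k l = (if l = i then g else if l = j then h else (\<lambda>p. p l))" for l
  have k: "smooth_germ n (k l)" "k l (\<lambda>_. 0) = 0" for l using assms sg_proj by (auto simp: k_def)
  have up: "\<forall>\<^sub>F p in param_nhds n. tup n (\<lambda>l. k l p) = p(i := g p, j := h p)"
    using eventually_coord_0 by eventually_elim (use assms in \<open>auto simp: tup_def k_def fun_eq_iff\<close>)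
  show "smooth_germ n (\<lambda>p. F (p(i := g p, j := h p)))"
  proof (rule sg_cong)
    show "smooth_germ n (\<lambda>p. F (tup n (\<lambda>l. k l p)))" by (rule sg_comp[OF assms(1) k])
    show "\<forall>\<^sub>F p in param_nhds n. F (tup n (\<lambda>l. k l p)) = F (p(i := g p, j := h p))"
      using up by eventually_elim simp
  qed
  show "\<forall>\<^sub>F p in param_nhds n. P (p(i := g p, j := h p))" if "eventually P (param_nhds n)"
  proof -
    have "\<forall>\<^sub>F p in param_nhds n. P (tup n (\<lambda>l. k l p))" by (rule eventually_tup[OF that k])
    then show ?thesis using up by eventually_elim simp
  qed
qed

text \<open>
  The quarter turn R4, acting on the first two coordinates of a point whose other coordinates are
  parameters.
\<close>

definition rot :: "(nat \<Rightarrow> real) \<Rightarrow> nat \<Rightarrow> real" where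
  "rot p = p(0 := - p 1, 1 := p 0)"

definition zc :: "(nat \<Rightarrow> real) \<Rightarrow> complex" where
  "zc p = Complex (p 0) (p 1)"

definition nsq :: "(nat \<Rightarrow> real) \<Rightarrow> real" where
  "nsq p = (p 0)\<^sup>2 + (p 1)\<^sup>2"

text \<open>
  As \<open>Re (z ^ 4) = 2 (x\<^sup>2 - y\<^sup>2)\<^sup>2 - N\<^sup>2\<close>, this invariant together with N carries the same information
  as N and the real part of \<open>z ^ 4\<close>.
\<close>

definition dsq :: "(nat \<Rightarrow> real) \<Rightarrow> real" where
  "dsq p = ((p 0)\<^sup>2 - (p 1)\<^sup>2)\<^sup>2"

definition inv2 :: "(nat \<Rightarrow> real) \<Rightarrow> nat \<Rightarrow> real" where
  "inv2 p = p(0 := nsq p, 1 := dsq p)"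

lemma rot_simps [simp]: "rot p 0 = - p 1" "rot p 1 = p 0" "rot p (Suc 0) = p 0" "i \<ge> 2 \<Longrightarrow> rot p i = p i"
  by (auto simp: rot_def)

lemma inv2_rot [simp]: "inv2 (rot p) = inv2 p" and nsq_rot [simp]: "nsq (rot p) = nsq p"
  by (auto simp: inv2_def rot_def nsq_def dsq_def add.commute power2_commute)

lemma zc_rot [simp]: "zc (rot p) = \<i> * zc p"
  by (simp add: zc_def rot_def complex_eq_iff)

lemma sg_zc: "smooth_germ n zc"
  unfolding zc_def[abs_def] by (intro sg_Complex sg_proj)

lemma sg_nsq: "smooth_germ n nsq"
  unfolding nsq_def[abs_def] by (intro sg_add sg_power sg_proj)

lemma sg_dsq: "smooth_germ n dsq"
  unfolding dsq_def[abs_def] by (intro sg_add sg_diff sg_power sg_proj)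

lemma sg_inv2: "n \<ge> 2 \<Longrightarrow> smooth_germ n F \<Longrightarrow> smooth_germ n (\<lambda>p. F (inv2 p))"
  unfolding inv2_def by (intro sg_upd2(1) sg_nsq sg_dsq) (auto simp: nsq_def dsq_def)

lemma eventually_inv2: "n \<ge> 2 \<Longrightarrow> eventually P (param_nhds n) \<Longrightarrow> \<forall>\<^sub>F p in param_nhds n. P (inv2 p)"
  unfolding inv2_def by (intro sg_upd2(2)[OF sg_nsq] sg_nsq sg_dsq) (auto simp: nsq_def dsq_def)

lemma eventually_rot: "n \<ge> 2 \<Longrightarrow> eventually P (param_nhds n) \<Longrightarrow> \<forall>\<^sub>F p in param_nhds n. P (rot p)"
  unfolding rot_def by (rule sg_upd2(2)[OF sg_nsq]) (auto intro: sg_minus sg_proj)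

text \<open>
  Splitting K into even and odd parts in x and in y, and using \<open>K (-z) = - K z\<close>, leaves
  \<open>x k1 + y k2\<close> with functions of \<open>X = x\<^sup>2\<close> and \<open>Y = y\<^sup>2\<close>. The quarter turn interchanges X and Y and
  forces \<open>2 K = x \<kappa>(X, Y) + i y \<kappa>(Y, X)\<close>. A last splitting, with respect to \<open>D = X - Y\<close>, gives
  \<open>\<kappa> = \<alpha> + D \<beta>\<close> with functions of \<open>N\<close> and \<open>D\<^sup>2\<close>, hence \<open>2 K = \<alpha> z + \<beta> D cnj z\<close>, and
  \<open>2 D cnj z = N z + cnj z ^ 3\<close>.
\<close>

lemma equivariant_normal_form:
  fixes K :: "(nat \<Rightarrow> real) \<Rightarrow> complex"
  assumes K: "smooth_germ n K" and n: "n \<ge> 2" and eq: "\<forall>\<^sub>F p in param_nhds n. K (rot p) = \<i> * K p"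
  obtains A B where "smooth_germ n A" "smooth_germ n B"
    "\<forall>\<^sub>F p in param_nhds n. K p = A (inv2 p) * zc p + B (inv2 p) * cnj (zc p) ^ 3"
proof -
  define sq where "sq p = p(0 := (p 0)\<^sup>2, 1 := (p 1)\<^sup>2)" for p :: "nat \<Rightarrow> real"
  define sw where "sw p = p(0 := p 1, 1 := p 0)" for p :: "nat \<Rightarrow> real"
  have n01: "0 < n" "1 < n" using n by auto
  obtain a b where ab: "smooth_germ n a" "smooth_germ n b"
    "\<forall>\<^sub>F p in param_nhds n. K p = a (p(0 := (p 0)\<^sup>2)) + p 0 *\<^sub>R b (p(0 := (p 0)\<^sup>2))"
    using sg_even_odd_split[OF K n01(1)] by blast
  obtain a1 a2 where a: "smooth_germ n a1" "smooth_germ n a2"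
    "\<forall>\<^sub>F p in param_nhds n. a p = a1 (p(1 := (p 1)\<^sup>2)) + p 1 *\<^sub>R a2 (p(1 := (p 1)\<^sup>2))"
    using sg_even_odd_split[OF ab(1) n01(2)] by blast
  obtain b1 b2 where b: "smooth_germ n b1" "smooth_germ n b2"
    "\<forall>\<^sub>F p in param_nhds n. b p = b1 (p(1 := (p 1)\<^sup>2)) + p 1 *\<^sub>R b2 (p(1 := (p 1)\<^sup>2))"
    using sg_even_odd_split[OF ab(2) n01(2)] by blast
  have sq0: "smooth_germ n (\<lambda>p. (p 0)\<^sup>2)" by (intro sg_power sg_proj)
  have form: "\<forall>\<^sub>F p in param_nhds n. K p = a1 (sq p) + p 1 *\<^sub>R a2 (sq p) + p 0 *\<^sub>R b1 (sq p) + (p 0 * p 1) *\<^sub>R b2 (sq p)"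
    using ab(3) eventually_upd[OF a(3) n01(1) sq0 zero_power2] eventually_upd[OF b(3) n01(1) sq0 zero_power2]
    by eventually_elim (simp add: sq_def scaleR_add_right)
  have eq2: "\<forall>\<^sub>F p in param_nhds n. K (rot (rot p)) = - K p"
    using eq eventually_rot[OF n eq] by eventually_elim simp
  have sqrr: "sq (rot (rot p)) = sq p" for p by (simp add: sq_def rot_def fun_eq_iff)
  have form2: "\<forall>\<^sub>F p in param_nhds n. K p = p 1 *\<^sub>R a2 (sq p) + p 0 *\<^sub>R b1 (sq p)"
    using form eventually_rot[OF n eventually_rot[OF n form]] eq2
  proof eventually_elim
    case (elim p)
    have "2 *\<^sub>R K p = K p - K (rot (rot p))" using elim(3) by (simp add: scaleR_2)
    also have "\<dots> = 2 *\<^sub>R (p 1 *\<^sub>R a2 (sq p) + p 0 *\<^sub>R b1 (sq p))"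
      unfolding elim(1,2) sqrr by (simp add: scaleR_2)
    finally show ?case by simp
  qed
  define \<kappa> where "\<kappa> p = b1 p - \<i> * a2 (sw p)" for p
  have sw: "smooth_germ n (\<lambda>p. a2 (sw p))"
    unfolding sw_def by (rule sg_upd2(1)[OF a(2)]) (use n01 in \<open>auto intro: sg_proj\<close>)
  have \<kappa>: "smooth_germ n \<kappa>" unfolding \<kappa>_def[abs_def] by (intro sg_diff sg_mult sg_const b sw)
  have sqr: "sq (rot p) = sw (sq p)" "sw (sw p) = p" for p by (auto simp: sq_def sw_def rot_def fun_eq_iff)
  have form3: "\<forall>\<^sub>F p in param_nhds n. K p = (1/2) * (of_real (p 0) * \<kappa> (sq p) + \<i> * of_real (p 1) * \<kappa> (sw (sq p)))"
    using form2 eventually_rot[OF n form2] eq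
  proof eventually_elim
    case (elim p)
    have "2 * K p = K p - \<i> * K (rot p)" using elim(3) by (simp flip: mult.assoc)
    also have "\<dots> = of_real (p 0) * \<kappa> (sq p) + \<i> * of_real (p 1) * \<kappa> (sw (sq p))"
      unfolding elim(1,2) \<kappa>_def sqr by (simp add: scaleR_conv_of_real algebra_simps)
    finally have e: "2 * K p = of_real (p 0) * \<kappa> (sq p) + \<i> * of_real (p 1) * \<kappa> (sw (sq p))" .
    show ?case unfolding e[symmetric] by simp
  qed
  define \<kappa>' where "\<kappa>' p = \<kappa> (p(0 := (p 0 + p 1) / 2, 1 := (p 0 - p 1) / 2))" for p
  have \<kappa>': "smooth_germ n \<kappa>'"
    unfolding \<kappa>'_def[abs_def]
    by (rule sg_upd2(1)[OF \<kappa>]) (use n01 in \<open>auto intro!: sg_divide sg_add sg_diff sg_proj sg_const\<close>)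
  obtain \<alpha> \<beta> where c: "smooth_germ n \<alpha>" "smooth_germ n \<beta>"
    "\<forall>\<^sub>F p in param_nhds n. \<kappa>' p = \<alpha> (p(1 := (p 1)\<^sup>2)) + p 1 *\<^sub>R \<beta> (p(1 := (p 1)\<^sup>2))"
    using sg_even_odd_split[OF \<kappa>' n01(2)] by blast
  define D where "D p = (p 0)\<^sup>2 - (p 1)\<^sup>2" for p :: "nat \<Rightarrow> real"
  have Dsg: "smooth_germ n D" "smooth_germ n (\<lambda>p. - D p)" unfolding D_def[abs_def] by (intro sg_minus sg_diff sg_power sg_proj)+
  have c1: "\<forall>\<^sub>F p in param_nhds n. \<kappa>' (p(0 := nsq p, 1 := D p)) = \<alpha> (inv2 p) + D p *\<^sub>R \<beta> (inv2 p)"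
    using sg_upd2(2)[OF sg_nsq n01 _ sg_nsq _ Dsg(1) _ c(3)] by (simp add: inv2_def D_def dsq_def nsq_def)
  have "\<forall>\<^sub>F p in param_nhds n. \<kappa>' (p(0 := nsq p, 1 := - D p)) = \<alpha> (inv2 p) + (- D p) *\<^sub>R \<beta> (inv2 p)"
    using sg_upd2(2)[OF sg_nsq n01 _ sg_nsq _ Dsg(2) _ c(3)] by (simp add: inv2_def D_def dsq_def nsq_def power2_commute)
  then have c2: "\<forall>\<^sub>F p in param_nhds n. \<kappa>' (p(0 := nsq p, 1 := - D p)) = \<alpha> (inv2 p) - D p *\<^sub>R \<beta> (inv2 p)"
    by simp
  have k1: "\<kappa>' (p(0 := nsq p, 1 := D p)) = \<kappa> (sq p)" "\<kappa>' (p(0 := nsq p, 1 := - D p)) = \<kappa> (sw (sq p))" for p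
    unfolding \<kappa>'_def by (rule arg_cong[where f = \<kappa>], simp add: fun_eq_iff sq_def sw_def nsq_def D_def)+
  define A where "A p = (1/2) * \<alpha> p + (1/4) * of_real (p 0) * \<beta> p" for p
  define B where "B p = (1/4) * \<beta> p" for p
  have A: "smooth_germ n A" unfolding A_def[abs_def] by (intro sg_add sg_mult sg_const c sg_of_real sg_proj)
  have B: "smooth_germ n B" unfolding B_def[abs_def] by (intro sg_mult sg_const c)
  show ?thesis
  proof (rule that[OF A B])
    show "\<forall>\<^sub>F p in param_nhds n. K p = A (inv2 p) * zc p + B (inv2 p) * cnj (zc p) ^ 3"
      using form3 c1 c2
    proof eventually_elim
      case (elim p)
      have Dz: "of_real (D p) * cnj (zc p) = (1/2) * (of_real (nsq p) * zc p + cnj (zc p) ^ 3)"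
        by (simp add: complex_eq_iff zc_def D_def nsq_def power2_eq_square power3_eq_cube field_simps)
      have z: "of_real (p 0) + \<i> * of_real (p 1) = zc p" "of_real (p 0) - \<i> * of_real (p 1) = cnj (zc p)"
        by (simp_all add: complex_eq_iff zc_def)
      have "K p = (1/2) * (\<alpha> (inv2 p) * zc p + \<beta> (inv2 p) * (of_real (D p) * cnj (zc p)))"
        unfolding elim(1) k1[symmetric] elim(2,3) z[symmetric] by (simp add: scaleR_conv_of_real algebra_simps)
      also have "\<dots> = A (inv2 p) * zc p + B (inv2 p) * cnj (zc p) ^ 3"
        unfolding Dz A_def B_def by (simp add: inv2_def algebra_simps)
      finally show ?case .
    qed
  qed
qed

section \<open>Division by the cubic models\<close>

text \<open>
  Translation by w reduces this to Hadamard's lemma.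
\<close>

lemma hadamard_two_points:
  fixes C :: "(nat \<Rightarrow> real) \<Rightarrow> 'b::banach"
  assumes C: "smooth_germ n C" and i: "i < n" and w: "smooth_germ n w" "w (\<lambda>_. 0) = 0"
    and indep: "\<And>p x. w (p(i := x)) = w p"
  obtains Q where "smooth_germ n Q" "\<forall>\<^sub>F p in param_nhds n. C p - C (p(i := w p)) = (p i - w p) *\<^sub>R Q p"
proof -
  have g: "smooth_germ n (\<lambda>p. p i + w p)" "smooth_germ n (\<lambda>p. p i - w p)" by (intro sg_add sg_diff sg_proj w)+
  have "smooth_germ n (\<lambda>p. C (p(i := p i + w p)))" by (rule sg_upd[OF C i g(1)]) (simp add: w)
  from hadamard[OF this i] obtain Q where Q: "smooth_germ n Q"
    "\<forall>\<^sub>F p in param_nhds n. C (p(i := p i + w p)) - C ((p(i := 0))(i := (p(i := 0)) i + w (p(i := 0)))) = p i *\<^sub>R Q p" by blast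
  show ?thesis
  proof (rule that)
    show "smooth_germ n (\<lambda>p. Q (p(i := p i - w p)))" by (rule sg_upd[OF Q(1) i g(2)]) (simp add: w)
    have "\<forall>\<^sub>F p in param_nhds n. (\<lambda>p. C (p(i := p i + w p)) - C ((p(i := 0))(i := (p(i := 0)) i + w (p(i := 0)))) = p i *\<^sub>R Q p) (p(i := p i - w p))"
      by (rule eventually_upd[OF Q(2) i g(2)]) (simp add: w)
    then show "\<forall>\<^sub>F p in param_nhds n. C p - C (p(i := w p)) = (p i - w p) *\<^sub>R Q (p(i := p i - w p))"
      by eventually_elim (simp add: indep)
  qed
qed

text \<open>
  Completing the square turns the divisor into \<open>t\<^sup>2 - s\<close>; the splitting into even and odd parts
  then leaves functions of \<open>t\<^sup>2\<close>, whose values at \<open>t\<^sup>2\<close> and s differ by a multiple of \<open>t\<^sup>2 - s\<close>.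
\<close>

lemma quadratic_division:
  fixes g :: "(nat \<Rightarrow> real) \<Rightarrow> 'b::banach"
  assumes g: "smooth_germ n g" and i: "i < n"
    and b: "smooth_germ n b1" "smooth_germ n b0" "b1 (\<lambda>_. 0) = 0" "b0 (\<lambda>_. 0) = 0"
    and indep: "\<And>p x. b1 (p(i := x)) = b1 p" "\<And>p x. b0 (p(i := x)) = b0 p"
  obtains V a0 a1 where "smooth_germ n V" "smooth_germ n a0" "smooth_germ n a1"
    "\<And>p x. a0 (p(i := x)) = a0 p" "\<And>p x. a1 (p(i := x)) = a1 p"
    "\<forall>\<^sub>F p in param_nhds n. g p = ((p i)\<^sup>2 + b1 p * p i + b0 p) *\<^sub>R V p + (a0 p + p i *\<^sub>R a1 p)"
proof -
  define h where "h p = b1 p / 2" for p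
  define s where "s p = (b1 p)\<^sup>2 / 4 - b0 p" for p
  have h: "smooth_germ n h" "h (\<lambda>_. 0) = 0" "h (p(i := x)) = h p" for p x
    unfolding h_def using b indep by (auto intro!: sg_divide sg_const)
  have s: "smooth_germ n s" "s (\<lambda>_. 0) = 0" "s (p(i := x)) = s p" for p x
    unfolding s_def using b indep by (auto intro!: sg_divide sg_diff sg_power sg_const)
  have m: "smooth_germ n (\<lambda>p. p i - h p)" and pl: "smooth_germ n (\<lambda>p. p i + h p)" by (intro sg_diff sg_add sg_proj h)+
  have "smooth_germ n (\<lambda>p. g (p(i := p i - h p)))" by (rule sg_upd[OF g i m]) (simp add: h)
  from sg_even_odd_split[OF this i] obtain a c where ac: "smooth_germ n a" "smooth_germ n c"
    "\<forall>\<^sub>F p in param_nhds n. g (p(i := p i - h p)) = a (p(i := (p i)\<^sup>2)) + p i *\<^sub>R c (p(i := (p i)\<^sup>2))" by blast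
  have "\<forall>\<^sub>F p in param_nhds n. (\<lambda>p. g (p(i := p i - h p)) = a (p(i := (p i)\<^sup>2)) + p i *\<^sub>R c (p(i := (p i)\<^sup>2))) (p(i := p i + h p))"
    by (rule eventually_upd[OF ac(3) i pl]) (simp add: h)
  then have form: "\<forall>\<^sub>F p in param_nhds n. g p = a (p(i := (p i + h p)\<^sup>2)) + (p i + h p) *\<^sub>R c (p(i := (p i + h p)\<^sup>2))"
    by eventually_elim (simp add: h)
  obtain Qa where Qa: "smooth_germ n Qa" "\<forall>\<^sub>F p in param_nhds n. a p - a (p(i := s p)) = (p i - s p) *\<^sub>R Qa p"
    using hadamard_two_points[OF ac(1) i s] by blast
  obtain Qc where Qc: "smooth_germ n Qc" "\<forall>\<^sub>F p in param_nhds n. c p - c (p(i := s p)) = (p i - s p) *\<^sub>R Qc p"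
    using hadamard_two_points[OF ac(2) i s] by blast
  define t where "t p = (p i + h p)\<^sup>2" for p
  have t: "smooth_germ n t" "t (\<lambda>_. 0) = 0" unfolding t_def by (intro sg_power pl) (simp add: h)
  have ts: "t p - s p = (p i)\<^sup>2 + b1 p * p i + b0 p" for p
    by (simp add: t_def s_def h_def power2_eq_square field_simps)
  have Qa': "\<forall>\<^sub>F p in param_nhds n. a (p(i := t p)) - a (p(i := s p)) = (t p - s p) *\<^sub>R Qa (p(i := t p))"
    using eventually_upd[OF Qa(2) i t] by eventually_elim (simp add: s)
  have Qc': "\<forall>\<^sub>F p in param_nhds n. c (p(i := t p)) - c (p(i := s p)) = (t p - s p) *\<^sub>R Qc (p(i := t p))"
    using eventually_upd[OF Qc(2) i t] by eventually_elim (simp add: s)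
  show ?thesis
  proof (rule that[of "\<lambda>p. Qa (p(i := t p)) + (p i + h p) *\<^sub>R Qc (p(i := t p))"
        "\<lambda>p. a (p(i := s p)) + h p *\<^sub>R c (p(i := s p))" "\<lambda>p. c (p(i := s p))"])
    show "smooth_germ n (\<lambda>p. Qa (p(i := t p)) + (p i + h p) *\<^sub>R Qc (p(i := t p)))"
      by (intro sg_add sg_scaleR pl sg_upd[OF Qa(1) i t] sg_upd[OF Qc(1) i t] sg_proj h)
    show "smooth_germ n (\<lambda>p. a (p(i := s p)) + h p *\<^sub>R c (p(i := s p)))"
      by (intro sg_add sg_scaleR h sg_upd[OF ac(1) i s(1,2)] sg_upd[OF ac(2) i s(1,2)])
    show "smooth_germ n (\<lambda>p. c (p(i := s p)))" by (rule sg_upd[OF ac(2) i s(1,2)])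
    show "\<forall>\<^sub>F p in param_nhds n. g p = ((p i)\<^sup>2 + b1 p * p i + b0 p) *\<^sub>R (Qa (p(i := t p)) + (p i + h p) *\<^sub>R Qc (p(i := t p)))
        + (a (p(i := s p)) + h p *\<^sub>R c (p(i := s p)) + p i *\<^sub>R c (p(i := s p)))"
      using form Qa' Qc'
    proof eventually_elim
      case (elim p)
      have 1: "g p = a (p(i := t p)) + (p i + h p) *\<^sub>R c (p(i := t p))" using elim(1) by (simp add: t_def)
      have 2: "a (p(i := t p)) = a (p(i := s p)) + (t p - s p) *\<^sub>R Qa (p(i := t p))" using elim(2) by (metis diff_add_cancel add.commute)
      have 3: "c (p(i := t p)) = c (p(i := s p)) + (t p - s p) *\<^sub>R Qc (p(i := t p))" using elim(3) by (metis diff_add_cancel add.commute)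
      show ?case unfolding ts[symmetric] 1 2 3 by (simp add: algebra_simps)
    qed
  qed (simp_all add: s h)
qed

definition model :: "complex \<Rightarrow> complex \<Rightarrow> complex \<Rightarrow> complex" where
  "model l0 l1 z = cnj z ^ 3 + (l0 + l1 * (z * cnj z)) * z"

text \<open>
  Modulo the model, \<open>N\<^sup>2 = |l0 + l1 N|\<^sup>2\<close> in front of z. Divided by \<open>1 - |l1|\<^sup>2\<close> this is the monic
  equation \<open>N\<^sup>2 + quad1 N + quad0 = 0\<close>.
\<close>

definition quad1 :: "complex \<Rightarrow> complex \<Rightarrow> real" where
  "quad1 l0 l1 = 2 * Re (l0 * cnj l1) / ((cmod l1)\<^sup>2 - 1)"

definition quad0 :: "complex \<Rightarrow> complex \<Rightarrow> real" where
  "quad0 l0 l1 = (cmod l0)\<^sup>2 / ((cmod l1)\<^sup>2 - 1)"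

lemma nsq_zc: "of_real (nsq p) = zc p * cnj (zc p)"
  by (simp add: complex_eq_iff zc_def nsq_def power2_eq_square)

text \<open>
  With \<open>P = l0 + l1 N\<close> and \<open>G = cnj z ^ 3 + P z\<close>, the terms with \<open>cnj P cnj z ^ 3\<close> cancel in
  \<open>cnj z ^ 2 cnj G - cnj P G\<close>, and \<open>(N\<^sup>2 - |P|\<^sup>2) z\<close> remains.
\<close>

lemma syzygy_quadratic:
  fixes z l0 l1 :: complex
  assumes "(cmod l1)\<^sup>2 \<noteq> 1"
  defines "N \<equiv> z * cnj z"
  shows "(N\<^sup>2 + of_real (quad1 l0 l1) * N + of_real (quad0 l0 l1)) * z =
    of_real (inverse (1 - (cmod l1)\<^sup>2)) * (cnj z ^ 2 * cnj (model l0 l1 z) - cnj (l0 + l1 * N) * model l0 l1 z)"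
proof -
  define d where "d = 1 - (cmod l1)\<^sup>2"
  have d: "d \<noteq> 0" using assms by (simp add: d_def)
  have dd: "of_real d = 1 - l1 * cnj l1" by (simp add: d_def complex_norm_square del: of_real_power)
  have Re2: "2 * of_real (Re (l0 * cnj l1)) = l0 * cnj l1 + cnj l0 * l1"
    using complex_add_cnj[of "l0 * cnj l1"] by simp
  have quad1: "of_real d * of_real (quad1 l0 l1) = - (l0 * cnj l1 + cnj l0 * l1)"
  proof -
    have "d * quad1 l0 l1 = - (2 * Re (l0 * cnj l1))" using d by (simp add: quad1_def d_def field_simps)
    then have "complex_of_real (d * quad1 l0 l1) = - (2 * of_real (Re (l0 * cnj l1)))" by simp
    then show ?thesis using Re2 by (simp only: of_real_mult)
  qed
  have quad0: "of_real d * of_real (quad0 l0 l1) = - (l0 * cnj l0)"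
  proof -
    have "d * quad0 l0 l1 = - (cmod l0)\<^sup>2" using d by (simp add: quad0_def d_def field_simps)
    then have "complex_of_real (d * quad0 l0 l1) = - of_real ((cmod l0)\<^sup>2)" by simp
    then show ?thesis by (simp only: of_real_mult complex_norm_square)
  qed
  have "of_real d * ((N\<^sup>2 + of_real (quad1 l0 l1) * N + of_real (quad0 l0 l1)) * z)
      = (of_real d * N\<^sup>2 + (of_real d * of_real (quad1 l0 l1)) * N + of_real d * of_real (quad0 l0 l1)) * z"
    by (simp add: algebra_simps)
  also have "\<dots> = cnj z ^ 2 * cnj (model l0 l1 z) - cnj (l0 + l1 * N) * model l0 l1 z"
    unfolding quad1 quad0 unfolding dd
    by (simp add: model_def N_def power2_eq_square power3_eq_cube algebra_simps)
  finally show ?thesis unfolding d_def[symmetric] using d by (simp add: field_simps)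
qed

text \<open>
  Here \<open>z\<^sup>2 cnj G + N G = (z ^ 4 + cnj z ^ 4 + N (P + cnj P)) z\<close>, which expresses \<open>(x\<^sup>2 - y\<^sup>2)\<^sup>2 z\<close>
  through functions of N times z.
\<close>

lemma syzygy_linear:
  fixes p :: "nat \<Rightarrow> real"
  shows "of_real (dsq p - ((nsq p)\<^sup>2 - nsq p * Re (l0 + l1 * of_real (nsq p))) / 2) * zc p
    = 1/4 * ((zc p)\<^sup>2 * cnj (model l0 l1 (zc p)) + of_real (nsq p) * model l0 l1 (zc p))"
proof -
  define z where "z = zc p"
  define P where "P = l0 + l1 * of_real (nsq p)"
  have N: "of_real (nsq p) = z * cnj z" by (simp add: z_def nsq_zc)
  have D: "4 * of_real (dsq p) = z ^ 4 + cnj z ^ 4 + 2 * z\<^sup>2 * cnj z ^ 2"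
    by (simp add: complex_eq_iff zc_def z_def dsq_def power2_eq_square numeral_eq_Suc algebra_simps)
  have R: "2 * of_real (Re P) = P + cnj P" by (simp add: complex_add_cnj)
  have "4 * of_real (dsq p - ((nsq p)\<^sup>2 - nsq p * Re P) / 2) = 4 * of_real (dsq p) - 2 * (of_real (nsq p))\<^sup>2 + of_real (nsq p) * (2 * complex_of_real (Re P))"
    by (simp add: field_simps)
  also have "\<dots> = z ^ 4 + cnj z ^ 4 + z * cnj z * (P + cnj P)"
    unfolding D R N by (simp add: power_mult_distrib)
  finally have A: "4 * of_real (dsq p - ((nsq p)\<^sup>2 - nsq p * Re P) / 2) = z ^ 4 + cnj z ^ 4 + z * cnj z * (P + cnj P)" .
  have "model l0 l1 z = cnj z ^ 3 + P * z" by (simp add: model_def P_def N)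
  then have B: "z\<^sup>2 * cnj (model l0 l1 z) + (z * cnj z) * model l0 l1 z = (z ^ 4 + cnj z ^ 4 + z * cnj z * (P + cnj P)) * z"
    by (simp add: numeral_eq_Suc algebra_simps)
  have "of_real (dsq p - ((nsq p)\<^sup>2 - nsq p * Re P) / 2) * z = 1/4 * ((4 * of_real (dsq p - ((nsq p)\<^sup>2 - nsq p * Re P) / 2)) * z)"
    by simp
  also have "\<dots> = 1/4 * (z\<^sup>2 * cnj (model l0 l1 z) + of_real (nsq p) * model l0 l1 z)"
    unfolding A B[symmetric] N ..
  finally show ?thesis unfolding P_def z_def .
qed

lemma sg_cmod2: "smooth_germ n f \<Longrightarrow> smooth_germ n (\<lambda>p. (cmod (f p))\<^sup>2)"
  unfolding cmod_power2 by (intro sg_add sg_power sg_Re sg_Im)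

text \<open>
  The normal form, with \<open>cnj z ^ 3\<close> replaced by \<open>- P z\<close>, leaves a function of N and
  \<open>(x\<^sup>2 - y\<^sup>2)\<^sup>2\<close> times z. The second argument is replaced by the function w of N that
  \<open>syzygy_linear\<close> prescribes, and the result is divided by the quadratic polynomial of
  \<open>syzygy_quadratic\<close>. The quotients are functions of the invariants only, which accounts for the
  symmetry of \<open>\<sigma>\<close> and \<open>\<tau>\<close>.
\<close>

lemma division:
  fixes K l0 l1 :: "(nat \<Rightarrow> real) \<Rightarrow> complex"
  assumes K: "smooth_germ n K" and n: "n \<ge> 2" and eq: "\<forall>\<^sub>F p in param_nhds n. K (rot p) = \<i> * K p"
    and l: "smooth_germ n l0" "smooth_germ n l1" "l0 (\<lambda>_. 0) = 0" "(cmod (l1 (\<lambda>_. 0)))\<^sup>2 \<noteq> 1"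
    and indep: "\<And>p i x. i < 2 \<Longrightarrow> l0 (p(i := x)) = l0 p" "\<And>p i x. i < 2 \<Longrightarrow> l1 (p(i := x)) = l1 p"
  obtains \<sigma> \<tau> r0 r1 where "smooth_germ n \<sigma>" "smooth_germ n \<tau>" "smooth_germ n r0" "smooth_germ n r1"
    "\<And>p. \<sigma> (rot p) = \<sigma> p" "\<And>p. \<tau> (rot p) = - \<tau> p"
    "\<And>p x y. r0 (p(0 := x, 1 := y)) = r0 p" "\<And>p x y. r1 (p(0 := x, 1 := y)) = r1 p"
    "\<forall>\<^sub>F p in param_nhds n. K p = \<sigma> p * model (l0 p) (l1 p) (zc p) + \<tau> p * cnj (model (l0 p) (l1 p) (zc p))
        + (r0 p + r1 p * of_real (nsq p)) * zc p"
proof -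
  have n01: "0 < n" "1 < n" using n by auto
  obtain A B where AB: "smooth_germ n A" "smooth_germ n B"
    "\<forall>\<^sub>F p in param_nhds n. K p = A (inv2 p) * zc p + B (inv2 p) * cnj (zc p) ^ 3"
    using equivariant_normal_form[OF K n eq] by blast
  define C where "C p = A p - (l0 p + l1 p * of_real (p 0)) * B p" for p
  have C: "smooth_germ n C" unfolding C_def[abs_def]
    by (intro sg_diff sg_add sg_mult l AB sg_of_real sg_proj)
  define w where "w p = ((p 0)\<^sup>2 - p 0 * Re (l0 p + l1 p * of_real (p 0))) / 2" for p
  have w: "smooth_germ n w" "w (\<lambda>_. 0) = 0" unfolding w_def[abs_def]
    by (auto intro!: sg_divide sg_diff sg_power sg_mult sg_Re sg_add sg_of_real sg_proj sg_const l)
  have wi: "w (p(1 := x)) = w p" for p x using indep[of 1] by (simp add: w_def)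
  obtain Q where Q: "smooth_germ n Q" "\<forall>\<^sub>F p in param_nhds n. C p - C (p(1 := w p)) = (p 1 - w p) *\<^sub>R Q p"
    using hadamard_two_points[OF C n01(2) w wi] by blast
  define g where "g p = C (p(1 := w p))" for p
  have g: "smooth_germ n g" unfolding g_def[abs_def] by (rule sg_upd[OF C n01(2) w])
  have gi: "g (p(1 := x)) = g p" for p x by (simp add: g_def wi[unfolded One_nat_def])
  define \<beta>1 where "\<beta>1 p = quad1 (l0 p) (l1 p)" for p
  define \<beta>0 where "\<beta>0 p = quad0 (l0 p) (l1 p)" for p
  have \<beta>: "smooth_germ n \<beta>1" "smooth_germ n \<beta>0" "\<beta>1 (\<lambda>_. 0) = 0" "\<beta>0 (\<lambda>_. 0) = 0"
    unfolding \<beta>1_def \<beta>0_def quad1_def quad0_def using l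
    by (auto intro!: sg_divide sg_diff sg_const sg_cmod2 sg_mult sg_Re sg_Im sg_add sg_cnj)
  have \<beta>i: "\<beta>1 (p(i := x)) = \<beta>1 p" "\<beta>0 (p(i := x)) = \<beta>0 p" if "i < 2" for p i x
    using indep[OF that] by (simp_all add: \<beta>1_def \<beta>0_def)
  have \<beta>i0: "\<beta>1 (p(0 := x)) = \<beta>1 p" "\<beta>0 (p(0 := x)) = \<beta>0 p" for p x
    by (rule \<beta>i, simp)+
  obtain V a0 a1 where V: "smooth_germ n V" "smooth_germ n a0" "smooth_germ n a1"
    "\<And>p x. a0 (p(0 := x)) = a0 p" "\<And>p x. a1 (p(0 := x)) = a1 p"
    "\<forall>\<^sub>F p in param_nhds n. g p = ((p 0)\<^sup>2 + \<beta>1 p * p 0 + \<beta>0 p) *\<^sub>R V p + (a0 p + p 0 *\<^sub>R a1 p)"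
    using quadratic_division[OF g n01(1) \<beta> \<beta>i0] by blast
  define c where "c p = inverse (1 - (cmod (l1 p))\<^sup>2)" for p
  have c: "smooth_germ n c" unfolding c_def using l by (auto intro!: sg_inverse sg_diff sg_const sg_cmod2)
  define nz where "nz p = p(1 := 0)" for p :: "nat \<Rightarrow> real"
  have sgz: "smooth_germ n (\<lambda>p. F (nz p))" if "smooth_germ n F" for F :: "_ \<Rightarrow> complex"
    unfolding nz_def by (rule sg_upd[OF that n01(2) sg_const]) simp
  have Vz: "\<forall>\<^sub>F p in param_nhds n. g p = ((p 0)\<^sup>2 + \<beta>1 p * p 0 + \<beta>0 p) *\<^sub>R V (nz p) + (a0 (nz p) + p 0 *\<^sub>R a1 (nz p))"
  proof -
    have "\<forall>\<^sub>F p in param_nhds n. (\<lambda>p. g p = ((p 0)\<^sup>2 + \<beta>1 p * p 0 + \<beta>0 p) *\<^sub>R V p + (a0 p + p 0 *\<^sub>R a1 p)) (p(1 := (\<lambda>_. 0) p))"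
      by (rule eventually_upd[OF V(6) n01(2) sg_const]) simp
    then show ?thesis by eventually_elim (simp add: gi[unfolded One_nat_def] \<beta>i nz_def)
  qed
  have linv: "l0 (inv2 p) = l0 p" "l1 (inv2 p) = l1 p" "l0 (rot p) = l0 p" "l1 (rot p) = l1 p" for p
    using indep[of 0] indep[of 1] by (simp_all add: inv2_def rot_def)
  define r0 where "r0 p = a0 (p(0 := 0, 1 := 0))" for p
  define r1 where "r1 p = a1 (p(0 := 0, 1 := 0))" for p
  have r: "smooth_germ n r0" "smooth_germ n r1"
    unfolding r0_def[abs_def] r1_def[abs_def] using n01 V(2,3) by (auto intro!: sg_upd2(1) sg_const)
  have rn: "a0 (nz (inv2 p)) = r0 p" "a1 (nz (inv2 p)) = r1 p" for p
  proof -
    have e: "nz (inv2 p) = (p(0 := 0, 1 := 0))(0 := nsq p)" by (auto simp: nz_def inv2_def fun_eq_iff)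
    show "a0 (nz (inv2 p)) = r0 p" "a1 (nz (inv2 p)) = r1 p" unfolding r0_def r1_def e by (rule V(4), rule V(5))
  qed
  define \<sigma> where "\<sigma> p = B (inv2 p) + 1/4 * of_real (nsq p) * Q (inv2 p)
    - of_real (c p) * V (nz (inv2 p)) * cnj (l0 p + l1 p * of_real (nsq p))" for p
  define \<tau> where "\<tau> p = 1/4 * (zc p)\<^sup>2 * Q (inv2 p) + of_real (c p) * V (nz (inv2 p)) * cnj (zc p) ^ 2" for p
  show ?thesis
  proof (rule that[OF _ _ r])
    show "smooth_germ n \<sigma>" unfolding \<sigma>_def[abs_def]
      by (intro sg_diff sg_add sg_mult sg_const sg_of_real sg_cnj sg_nsq sg_inv2[OF n] sgz c l AB Q V)
    show "smooth_germ n \<tau>" unfolding \<tau>_def[abs_def]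
      by (intro sg_add sg_mult sg_power sg_const sg_of_real sg_cnj sg_zc sg_inv2[OF n] sgz c l AB Q V)
    show "\<sigma> (rot p) = \<sigma> p" for p by (simp add: \<sigma>_def linv c_def)
    show "\<tau> (rot p) = - \<tau> p" for p by (simp add: \<tau>_def linv c_def power_mult_distrib algebra_simps)
    show "r0 (p(0 := x, 1 := y)) = r0 p" "r1 (p(0 := x, 1 := y)) = r1 p" for p x y
      by (simp_all add: r0_def r1_def fun_upd_twist)
    have ne: "\<forall>\<^sub>F p in param_nhds n. (cmod (l1 p))\<^sup>2 \<noteq> 1"
    proof -
      have "\<forall>\<^sub>F p in param_nhds n. norm ((cmod (l1 p))\<^sup>2 - (cmod (l1 (\<lambda>_. 0)))\<^sup>2) < \<bar>(cmod (l1 (\<lambda>_. 0)))\<^sup>2 - 1\<bar>"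
        by (rule sg_near[OF sg_cmod2[OF l(2)]]) (use l(4) in simp)
      then show ?thesis by eventually_elim auto
    qed
    show "\<forall>\<^sub>F p in param_nhds n. K p = \<sigma> p * model (l0 p) (l1 p) (zc p) + \<tau> p * cnj (model (l0 p) (l1 p) (zc p))
        + (r0 p + r1 p * of_real (nsq p)) * zc p"
      using AB(3) eventually_inv2[OF n Q(2)] eventually_inv2[OF n Vz] ne
    proof eventually_elim
      case (elim p)
      define z where "z = zc p"
      define N where "N = complex_of_real (nsq p)"
      define P where "P = l0 p + l1 p * N"
      define G where "G = model (l0 p) (l1 p) z"
      have Nz: "N = z * cnj z" by (simp add: N_def z_def nsq_zc)
      have G: "G = cnj z ^ 3 + P * z" by (simp add: G_def model_def P_def Nz)
      have i2: "inv2 p 0 = nsq p" "inv2 p (Suc 0) = dsq p" "inv2 p 1 = dsq p" by (simp_all add: inv2_def)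
      have 1: "K p = C (inv2 p) * z + B (inv2 p) * G"
        unfolding elim(1) C_def G i2 linv P_def by (simp add: z_def N_def algebra_simps)
      have wv: "w (inv2 p) = ((nsq p)\<^sup>2 - nsq p * Re (l0 p + l1 p * of_real (nsq p))) / 2"
        by (simp only: w_def i2 linv)
      have 2: "C (inv2 p) = g (inv2 p) + of_real (dsq p - w (inv2 p)) * Q (inv2 p)"
        using elim(2) unfolding g_def i2 scaleR_conv_of_real by (simp add: algebra_simps)
      have 3: "g (inv2 p) = (N\<^sup>2 + of_real (\<beta>1 p) * N + of_real (\<beta>0 p)) * V (nz (inv2 p)) + (r0 p + N * r1 p)"
        unfolding elim(3) rn i2 scaleR_conv_of_real by (simp add: N_def \<beta>1_def \<beta>0_def linv)
      have 4: "of_real (dsq p - w (inv2 p)) * z = 1/4 * (z\<^sup>2 * cnj G + N * G)"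
        unfolding wv N_def z_def G_def by (rule syzygy_linear)
      have 5: "(N\<^sup>2 + of_real (\<beta>1 p) * N + of_real (\<beta>0 p)) * z = of_real (c p) * (cnj z ^ 2 * cnj G - cnj P * G)"
        unfolding \<beta>1_def \<beta>0_def c_def G_def P_def Nz by (rule syzygy_quadratic[OF elim(4)])
      have "K p = ((N\<^sup>2 + of_real (\<beta>1 p) * N + of_real (\<beta>0 p)) * z) * V (nz (inv2 p)) + (r0 p + N * r1 p) * z
         + (of_real (dsq p - w (inv2 p)) * z) * Q (inv2 p) + B (inv2 p) * G"
        unfolding 1 2 3 by (simp add: algebra_simps)
      also have "\<dots> = \<sigma> p * G + \<tau> p * cnj G + (r0 p + r1 p * N) * z"
        unfolding 4 5 \<sigma>_def \<tau>_def N_def[symmetric] z_def[symmetric] P_def[symmetric] by (simp only: algebra_simps)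
      finally show ?case by (simp add: G_def z_def N_def)
    qed
  qed
qed

section \<open>Complex notation for the germs and the group action\<close>

definition toC :: "real^2 \<Rightarrow> complex" where "toC v = Complex (v $ 1) (v $ 2)"
definition ofC :: "complex \<Rightarrow> real^2" where "ofC c = vector [Re c, Im c]"
definition pt :: "(nat \<Rightarrow> real) \<Rightarrow> real^2" where "pt p = vector [p 0, p 1]"
definition par :: "(nat \<Rightarrow> real) \<Rightarrow> nat \<Rightarrow> real" where "par p = (\<lambda>i. p (i + 2))"
definition join :: "real^2 \<Rightarrow> (nat \<Rightarrow> real) \<Rightarrow> nat \<Rightarrow> real" where
  "join x \<mu> = (\<lambda>i. if i = 0 then x $ 1 else if i = 1 then x $ 2 else \<mu> (i - 2))"

lemma toC_ofC [simp]: "toC (ofC c) = c" by (simp add: toC_def ofC_def)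
lemma ofC_toC [simp]: "ofC (toC v) = v" by (simp add: toC_def ofC_def vec_eq_iff forall_2)
lemma toC_pt [simp]: "toC (pt p) = zc p" by (simp add: toC_def pt_def zc_def)
lemma toC_inj: "toC v = toC w \<Longrightarrow> v = w" by (metis ofC_toC)
lemma pt_nth [simp]: "pt p $ 1 = p 0" "pt p $ 2 = p 1" by (simp_all add: pt_def)
lemma join_pt_par [simp]: "join (pt p) (par p) = p"
  by (auto simp: join_def par_def fun_eq_iff pt_def intro: arg_cong)
lemma pt_join [simp]: "pt (join x \<mu>) = x" by (simp add: pt_def join_def vec_eq_iff forall_2)
lemma par_join [simp]: "par (join x \<mu>) = \<mu>" by (auto simp: par_def join_def fun_eq_iff)
lemma zc_join [simp]: "zc (join x \<mu>) = toC x" by (simp add: zc_def toC_def join_def)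
lemma par_rot [simp]: "par (rot p) = par p" by (auto simp: par_def rot_def fun_eq_iff)

lemma R4_pt: "R4 *v pt p = pt (rot p)"
  by (simp add: R4_def pt_def rot_def vec_eq_iff forall_2 matrix_vector_mult_def sum_2)

lemma toC_R4: "toC (R4 *v v) = \<i> * toC v"
  by (simp add: R4_def toC_def complex_eq_iff matrix_vector_mult_def sum_2)

lemma smooth_family_germ_alt: "smooth_family_germ l G \<longleftrightarrow> smooth_germ (l + 2) (\<lambda>p. G (pt p) (par p))"
  by (simp add: smooth_family_germ_def pt_def par_def)

lemma open_contains_square:
  assumes "open U" "(0::real^2) \<in> U"
  shows "\<exists>e>0. \<forall>x. \<bar>x $ 1\<bar> < e \<and> \<bar>x $ 2\<bar> < e \<longrightarrow> x \<in> U"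
proof -
  obtain d where d: "d > 0" "ball 0 d \<subseteq> U" using assms openE by blast
  have "x \<in> U" if "\<bar>x $ 1\<bar> < d / 2" "\<bar>x $ 2\<bar> < d / 2" for x
  proof -
    have "norm x \<le> \<bar>x $ 1\<bar> + \<bar>x $ 2\<bar>" using norm_le_l1_cart[of x] by (simp add: sum_2)
    then have "norm x < d" using that by linarith
    then show ?thesis using d(2) by auto
  qed
  then show ?thesis using d(1) by (intro exI[of _ "d / 2"]) auto
qed

lemma open_square: "open {x::real^2. \<bar>x $ 1\<bar> < e \<and> \<bar>x $ 2\<bar> < e}"
  by (intro open_Collect_conj open_Collect_less continuous_intros)

lemma eventually_family_nhds:
  "eventually P (family_nhds l) \<longleftrightarrow> (\<forall>\<^sub>F p in param_nhds (l + 2). P (pt p, par p))"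
proof
  assume "eventually P (family_nhds l)"
  then obtain S where S: "openin (prod_topology euclidean (Euclidean_space l)) S" "(0, \<lambda>_. 0) \<in> S" "\<forall>x\<in>S. P x"
    unfolding family_nhds_def eventually_nhdsin by (auto simp: topspace_E)
  then obtain U V where UV: "open U" "openin (Euclidean_space l) V" "(0::real^2) \<in> U" "(\<lambda>_. 0) \<in> V" "U \<times> V \<subseteq> S"
    unfolding openin_prod_topology_alt by (metis open_openin)
  obtain e1 where e1: "e1 > 0" "\<forall>x. \<bar>x $ 1\<bar> < e1 \<and> \<bar>x $ 2\<bar> < e1 \<longrightarrow> x \<in> U" using open_contains_square[OF UV(1,3)] by blast
  obtain e2 where e2: "e2 > 0" "cube l e2 \<subseteq> V" using open_E_contains_cube[OF UV(2,4)] by blast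
  have "P (pt p, par p)" if p: "p \<in> cube (l + 2) (min e1 e2)" for p
  proof -
    have "pt p \<in> U" using p e1(2) by (simp add: cube_def)
    moreover have "par p \<in> cube l e2" using p by (auto simp: cube_def par_def)
    ultimately show ?thesis using e2(2) UV(5) S(3) by blast
  qed
  then show "\<forall>\<^sub>F p in param_nhds (l + 2). P (pt p, par p)"
    unfolding eventually_param_nhds using e1(1) e2(1) by (intro exI[of _ "min e1 e2"]) auto
next
  assume "\<forall>\<^sub>F p in param_nhds (l + 2). P (pt p, par p)"
  then obtain e where e: "e > 0" "\<forall>p\<in>cube (l + 2) e. P (pt p, par p)" by (auto simp: eventually_param_nhds)
  let ?S = "{x::real^2. \<bar>x $ 1\<bar> < e \<and> \<bar>x $ 2\<bar> < e} \<times> cube l e"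
  have "openin (prod_topology euclidean (Euclidean_space l)) ?S"
    using open_square openin_cube by (simp add: openin_prod_Times_iff)
  moreover have "(0, \<lambda>_. 0) \<in> ?S" using e(1) by (simp add: zero_in_cube)
  moreover have "\<forall>x\<in>?S. P x"
  proof safe
    fix x :: "real^2" and \<mu> assume x: "\<bar>x $ 1\<bar> < e" "\<bar>x $ 2\<bar> < e" "\<mu> \<in> cube l e"
    then have "join x \<mu> \<in> cube (l + 2) e" by (auto simp: cube_def join_def)
    then show "P (x, \<mu>)" using e(2) by force
  qed
  ultimately show "eventually P (family_nhds l)" unfolding family_nhds_def eventually_nhdsin by blast
qed

lemma R4_in_Z4: "R4 \<in> Z4"
proof -
  have "(((**) R4) ^^ 1) (mat 1) = R4" by simp
  then show ?thesis unfolding Z4_def by (metis rangeI)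
qed

lemma eventually_rot_pow:
  assumes "n \<ge> 2" "eventually P (param_nhds n)" shows "\<forall>\<^sub>F p in param_nhds n. P ((rot ^^ j) p)"
proof (induction j)
  case 0 then show ?case using assms by simp
next
  case (Suc j)
  then show ?case using eventually_rot[OF assms(1) Suc] by (simp add: funpow_swap1)
qed

lemma R4_pow_pt: "(((**) R4 ^^ j) (mat 1)) *v pt p = pt ((rot ^^ j) p)"
  by (induction j) (simp_all add: matrix_vector_mul_assoc[symmetric] R4_pt)

lemma par_rot_pow [simp]: "par ((rot ^^ j) p) = par p"
  by (induction j) simp_all

text \<open>
  Equivariance under the generator implies equivariance under its powers because the quarter turn
  maps small neighbourhoods of the origin to such neighbourhoods.
\<close>

lemma equivariant_family_iff:
  "equivariant_family l G \<longleftrightarrow>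
     (\<forall>\<^sub>F p in param_nhds (l + 2). toC (G (pt (rot p)) (par p)) = \<i> * toC (G (pt p) (par p)))"
proof
  assume "equivariant_family l G"
  then have "\<forall>\<^sub>F (x, \<mu>) in family_nhds l. G (R4 *v x) \<mu> = R4 *v G x \<mu>"
    using R4_in_Z4 by (auto simp: equivariant_family_def)
  then show "\<forall>\<^sub>F p in param_nhds (l + 2). toC (G (pt (rot p)) (par p)) = \<i> * toC (G (pt p) (par p))"
    unfolding eventually_family_nhds by eventually_elim (simp add: R4_pt toC_R4)
next
  assume A: "\<forall>\<^sub>F p in param_nhds (l + 2). toC (G (pt (rot p)) (par p)) = \<i> * toC (G (pt p) (par p))"
  have B: "\<forall>\<^sub>F p in param_nhds (l + 2). G (((**) R4 ^^ j) (mat 1) *v pt p) (par p) = ((**) R4 ^^ j) (mat 1) *v G (pt p) (par p)" for j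
  proof (induction j)
    case 0 then show ?case by simp
  next
    case (Suc j)
    have "\<forall>\<^sub>F p in param_nhds (l + 2). toC (G (pt (rot ((rot ^^ j) p))) (par ((rot ^^ j) p))) = \<i> * toC (G (pt ((rot ^^ j) p)) (par ((rot ^^ j) p)))"
      by (rule eventually_rot_pow[OF _ A]) simp
    with Suc show ?case
    proof eventually_elim
      case (elim p)
      have "G (pt (rot ((rot ^^ j) p))) (par p) = R4 *v G (pt ((rot ^^ j) p)) (par p)"
        using elim(2) by (intro toC_inj) (simp add: toC_R4)
      then show ?case using elim(1) unfolding R4_pow_pt by (simp add: matrix_vector_mul_assoc[symmetric])
    qed
  qed
  show "equivariant_family l G"
    unfolding equivariant_family_def eventually_family_nhds Z4_def using B by auto
qed

lemma equivariant_matrix_familyI: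
  assumes A: "\<forall>\<^sub>F p in param_nhds (l + 2). S (pt (rot p)) (par p) ** R4 = R4 ** S (pt p) (par p)"
  shows "equivariant_matrix_family l S"
proof -
  have B: "\<forall>\<^sub>F p in param_nhds (l + 2). S (((**) R4 ^^ j) (mat 1) *v pt p) (par p) ** ((**) R4 ^^ j) (mat 1) = ((**) R4 ^^ j) (mat 1) ** S (pt p) (par p)" for j
  proof (induction j)
    case 0 then show ?case by simp
  next
    case (Suc j)
    have "\<forall>\<^sub>F p in param_nhds (l + 2). S (pt (rot ((rot ^^ j) p))) (par ((rot ^^ j) p)) ** R4 = R4 ** S (pt ((rot ^^ j) p)) (par ((rot ^^ j) p))"
      by (rule eventually_rot_pow[OF _ A]) simp
    with Suc show ?case
    proof eventually_elim
      case (elim p)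
      have "S (pt (rot ((rot ^^ j) p))) (par p) ** (R4 ** ((**) R4 ^^ j) (mat 1)) = (S (pt (rot ((rot ^^ j) p))) (par p) ** R4) ** ((**) R4 ^^ j) (mat 1)"
        by (simp add: matrix_mul_assoc)
      also have "\<dots> = R4 ** (S (pt ((rot ^^ j) p)) (par p) ** ((**) R4 ^^ j) (mat 1))"
        using elim(2) by (simp add: matrix_mul_assoc)
      also have "\<dots> = (R4 ** ((**) R4 ^^ j) (mat 1)) ** S (pt p) (par p)"
        using elim(1) unfolding R4_pow_pt by (simp add: matrix_mul_assoc)
      finally show ?case unfolding R4_pow_pt by simp
    qed
  qed
  show ?thesis
    unfolding equivariant_matrix_family_def eventually_family_nhds Z4_def using B by auto
qed

text \<open>
  The matrix of the real-linear map \<open>w \<mapsto> \<sigma> w + \<tau> cnj w\<close> of the complex plane.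
\<close>

definition mat2 :: "complex \<Rightarrow> complex \<Rightarrow> real^2^2" where
  "mat2 \<sigma> \<tau> = vector [vector [Re (\<sigma> + \<tau>), Im (\<tau> - \<sigma>)], vector [Im (\<sigma> + \<tau>), Re (\<sigma> - \<tau>)]]"

lemma toC_mat2: "toC (mat2 \<sigma> \<tau> *v v) = \<sigma> * toC v + \<tau> * cnj (toC v)"
  by (simp add: mat2_def toC_def complex_eq_iff matrix_vector_mult_def sum_2 algebra_simps)

lemma mat2_id: "mat2 1 0 = mat 1"
  by (simp add: mat2_def mat_def vec_eq_iff forall_2)

lemma mat2_R4: "mat2 \<sigma> (- \<tau>) ** R4 = R4 ** mat2 \<sigma> \<tau>"
  by (simp add: mat2_def R4_def vec_eq_iff forall_2 matrix_matrix_mult_def sum_2)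

lemma sg_vector2: "smooth_germ n f \<Longrightarrow> smooth_germ n g \<Longrightarrow> smooth_germ n (\<lambda>p. vector [f p, g p] :: real^2)"
proof -
  assume *: "smooth_germ n f" "smooth_germ n g"
  have "(\<lambda>p. vector [f p, g p] :: real^2) = (\<lambda>p. f p *\<^sub>R vector [1, 0] + g p *\<^sub>R vector [0, 1])"
    by (simp add: fun_eq_iff vec_eq_iff forall_2)
  moreover have "smooth_germ n (\<lambda>p. f p *\<^sub>R vector [1, 0] + g p *\<^sub>R (vector [0, 1] :: real^2))"
    by (intro sg_add sg_scaleR sg_const *)
  ultimately show ?thesis by simp
qed

lemma sg_ofC: "smooth_germ n f \<Longrightarrow> smooth_germ n (\<lambda>p. ofC (f p))"
  unfolding ofC_def by (intro sg_vector2 sg_Re sg_Im)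

lemma sg_toC: "smooth_germ n f \<Longrightarrow> smooth_germ n (\<lambda>p. toC (f p))"
  unfolding toC_def by (intro sg_Complex sg_linear[OF bounded_linear_vec_nth])

lemma sg_mat2:
  assumes "smooth_germ n f" "smooth_germ n g" shows "smooth_germ n (\<lambda>p. mat2 (f p) (g p))"
proof -
  have "(\<lambda>p. mat2 (f p) (g p)) = (\<lambda>p. Re (f p + g p) *\<^sub>R vector [vector [1, 0], vector [0, 0]]
     + Im (g p - f p) *\<^sub>R vector [vector [0, 1], vector [0, 0]]
     + Im (f p + g p) *\<^sub>R vector [vector [0, 0], vector [1, 0]]
     + Re (f p - g p) *\<^sub>R vector [vector [0, 0], vector [0, 1]])"
    by (simp add: fun_eq_iff mat2_def vec_eq_iff forall_2)
  moreover have "smooth_germ n (\<lambda>p. Re (f p + g p) *\<^sub>R vector [vector [1, 0], vector [0, 0]]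
     + Im (g p - f p) *\<^sub>R vector [vector [0, 1], vector [0, 0]]
     + Im (f p + g p) *\<^sub>R vector [vector [0, 0], vector [1, 0]]
     + Re (f p - g p) *\<^sub>R (vector [vector [0, 0], vector [0, 1]] :: real^2^2))"
    by (intro sg_add sg_scaleR sg_const sg_Re sg_Im sg_diff assms)
  ultimately show ?thesis by simp
qed

lemma model_0_3: "model 0 3 (Complex x y) = Complex (4 * x ^ 3) (4 * y ^ 3)"
  by (simp add: model_def complex_eq_iff power3_eq_cube algebra_simps)

text \<open>
  The reciprocal of the factor c(N) in \<open>F\<^sub>4 = c(N) (cnj z ^ 3 + 3 N z)\<close>.
\<close>

definition cinv :: "real \<Rightarrow> real \<Rightarrow> complex" where
  "cinv k N = - (4 * \<i> * of_real (1 + N) / of_real k)"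

lemma cinv_F4:
  assumes "k \<noteq> 0"
  shows "cinv k ((cmod (toC v))\<^sup>2) * toC (F4 k v) = model 0 3 (toC v)"
proof -
  define x y where "x = v $ 1" and "y = v $ 2"
  have t: "toC v = Complex x y" by (simp add: toC_def x_def y_def)
  define M where "M = 1 + x\<^sup>2 + y\<^sup>2"
  have M: "M \<noteq> 0" unfolding M_def by (metis add.assoc add_pos_nonneg less_numeral_extra(3) sum_power2_ge_zero zero_less_one)
  have "toC (F4 k v) = Complex (- (k * y ^ 3 / M)) (k * x ^ 3 / M)"
    by (simp add: toC_def F4_def x_def y_def Let_def M_def)
  moreover have "1 + (cmod (toC v))\<^sup>2 = M" unfolding t by (simp add: M_def cmod_power2 add.assoc)
  then have "cinv k ((cmod (toC v))\<^sup>2) = Complex 0 (- (4 * M / k))"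
    unfolding cinv_def by (simp add: complex_eq_iff)
  ultimately show ?thesis unfolding t model_0_3 using M assms
    by (simp add: complex_eq_iff)
qed

lemma toC_G4:
  "toC (G4 k v \<alpha> \<beta> \<delta>) = toC (F4 k v) + (Complex \<alpha> \<beta> + \<i> * of_real \<delta> * of_real ((cmod (toC v))\<^sup>2)) * toC v"
  by (simp add: G4_def toC_def Let_def complex_eq_iff cmod_power2 algebra_simps)

lemma toC_F4_R4: "toC (F4 k (R4 *v v)) = \<i> * toC (F4 k v)"
  by (simp add: F4_def R4_def toC_def Let_def complex_eq_iff matrix_vector_mult_def sum_2 add.commute add.left_commute)

lemma G4_unfolding: "Z4_unfolding 3 (F4 k) (\<lambda>v p. G4 k v (p 0) (p 1) (p 2))"
  unfolding Z4_unfolding_def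
proof (intro conjI)
  have nz: "1 + p\<^sup>2 + q\<^sup>2 \<noteq> 0" for p q :: real
    by (metis add.assoc add_pos_nonneg less_numeral_extra(3) sum_power2_ge_zero zero_less_one)
  have F: "smooth_germ n (\<lambda>p. F4 k (pt p))" for n
    unfolding F4_def Let_def pt_nth
    by (intro sg_vector2 sg_minus sg_divide sg_mult sg_add sg_power sg_const sg_proj nz)
  show "smooth_family_germ 3 (\<lambda>v p. G4 k v (p 0) (p 1) (p 2))"
    unfolding smooth_family_germ_alt G4_def Let_def pt_nth par_def
    by (intro F sg_add sg_scaleR sg_vector2 sg_minus sg_mult sg_power sg_proj)
  show "equivariant_family 3 (\<lambda>v p. G4 k v (p 0) (p 1) (p 2))"
    unfolding equivariant_family_iff
    by (rule always_eventually)
       (simp add: toC_G4 R4_pt[symmetric] toC_F4_R4 toC_R4 norm_mult algebra_simps)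
  show "\<forall>\<^sub>F x in nhds 0. G4 k x 0 0 0 = F4 k x"
    by (rule always_eventually) (simp add: G4_def Let_def)
qed

section \<open>Reduction of unfoldings to the cubic models\<close>

lemma nsq_cmod: "nsq p = (cmod (zc p))\<^sup>2"
  by (simp add: nsq_def zc_def cmod_power2)

lemma model_rot: "model l0 l1 (\<i> * z) = \<i> * model l0 l1 z"
  by (simp add: model_def power3_eq_cube algebra_simps)

lemma sg_model: "smooth_germ n l0 \<Longrightarrow> smooth_germ n l1 \<Longrightarrow> smooth_germ n z \<Longrightarrow> smooth_germ n (\<lambda>p. model (l0 p) (l1 p) (z p))"
  unfolding model_def by (intro sg_add sg_mult sg_power sg_cnj)

lemma sg_cinv: "k \<noteq> 0 \<Longrightarrow> smooth_germ n f \<Longrightarrow> smooth_germ n (\<lambda>p. cinv k (f p))"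
proof -
  assume "smooth_germ n f"
  moreover have "cinv k x = of_real (1 + x) * (- (4 * \<i> / of_real k))" for x by (simp add: cinv_def)
  ultimately show ?thesis by (simp only:) (intro sg_mult sg_of_real sg_add sg_const)
qed

text \<open>
  The coefficients of the model enter as four additional coordinates. In these coordinates
  \<open>h - model 0 3\<close> is divided by the model; the value for zero parameters is subtracted from
  quotients and remainder, so that they vanish there. If the remainder equals
  \<open>(l0 + (l1 - 3) N) z\<close>, then it turns \<open>model 0 3\<close> into \<open>model l0 l1\<close>, and this is an equation for
  the coefficients to which \<open>ift\<close> applies.
\<close>

lemma reduction:
  fixes h :: "(nat \<Rightarrow> real) \<Rightarrow> complex"
  assumes h: "smooth_germ (m + 2) h"
    and eq: "\<forall>\<^sub>F p in param_nhds (m + 2). h (rot p) = \<i> * h p"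
    and h0: "\<forall>\<^sub>F p in param_nhds (m + 2). (\<forall>i\<ge>2. p i = 0) \<longrightarrow> h p = model 0 3 (zc p)"
  obtains l0 l1 s t where "smooth_germ m l0" "smooth_germ m l1" "l0 (\<lambda>_. 0) = 0" "l1 (\<lambda>_. 0) = 3"
    "smooth_germ (m + 2) s" "smooth_germ (m + 2) t"
    "\<And>p. s (rot p) = s p" "\<And>p. t (rot p) = - t p"
    "\<And>p. (\<And>i. i \<ge> 2 \<Longrightarrow> p i = 0) \<Longrightarrow> s p = 0" "\<And>p. (\<And>i. i \<ge> 2 \<Longrightarrow> p i = 0) \<Longrightarrow> t p = 0"
    "\<forall>\<^sub>F p in param_nhds (m + 2). h p = (1 + s p) * model (l0 (par p)) (l1 (par p)) (zc p)
       + t p * cnj (model (l0 (par p)) (l1 (par p)) (zc p))"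
proof -
  let ?n = "m + 6"
  \<comment> \<open>the unfolding as a family that does not depend on the coefficients\<close>
  define fg where "fg p = tup (m + 2) p" for p :: "nat \<Rightarrow> real"
  define K where "K p = h (fg p) - model 0 3 (zc p)" for p
  have fg: "smooth_germ ?n (\<lambda>p. F (fg p))" if "smooth_germ (m + 2) F" for F :: "_ \<Rightarrow> complex"
    unfolding fg_def by (rule sg_comp[OF that sg_proj]) simp
  have fge: "\<forall>\<^sub>F p in param_nhds ?n. P (fg p)" if "eventually P (param_nhds (m + 2))" for P
    unfolding fg_def by (rule eventually_tup[OF that sg_proj]) simp
  have fgr: "fg (rot p) = rot (fg p)" for p by (auto simp: fg_def tup_def rot_def fun_eq_iff)
  have K: "smooth_germ ?n K" unfolding K_def[abs_def]
    by (intro sg_diff fg[OF h] sg_model sg_const sg_zc)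
  have Keq: "\<forall>\<^sub>F p in param_nhds ?n. K (rot p) = \<i> * K p"
    using fge[OF eq] by eventually_elim (simp add: K_def fgr model_rot algebra_simps)
  define c0 where "c0 p = Complex (p (m + 2)) (p (m + 3))" for p :: "nat \<Rightarrow> real"
  define c1 where "c1 p = 3 + Complex (p (m + 4)) (p (m + 5))" for p :: "nat \<Rightarrow> real"
  have c: "smooth_germ ?n c0" "smooth_germ ?n c1" "c0 (\<lambda>_. 0) = 0" "c1 (\<lambda>_. 0) = 3"
    unfolding c0_def[abs_def] c1_def[abs_def] by (auto intro!: sg_add sg_const sg_Complex sg_proj simp: complex_eq_iff)
  have cinv: "c0 (p(i := x)) = c0 p" "c1 (p(i := x)) = c1 p" if "i < 2" for p i x
    using that by (simp_all add: c0_def c1_def)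
  have n2: "?n \<ge> 2" by simp
  have c13: "(cmod (c1 (\<lambda>_. 0)))\<^sup>2 \<noteq> 1" by (simp add: c)
  obtain \<sigma> \<tau> r0 r1 where D: "smooth_germ ?n \<sigma>" "smooth_germ ?n \<tau>" "smooth_germ ?n r0" "smooth_germ ?n r1"
    "\<And>p. \<sigma> (rot p) = \<sigma> p" "\<And>p. \<tau> (rot p) = - \<tau> p"
    "\<And>p x y. r0 (p(0 := x, 1 := y)) = r0 p" "\<And>p x y. r1 (p(0 := x, 1 := y)) = r1 p"
    "\<forall>\<^sub>F p in param_nhds ?n. K p = \<sigma> p * model (c0 p) (c1 p) (zc p) + \<tau> p * cnj (model (c0 p) (c1 p) (zc p))
        + (r0 p + r1 p * of_real (nsq p)) * zc p"
    using division[OF K n2 Keq c(1,2,3) c13 cinv] by blast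
  \<comment> \<open>\<open>K\<close> vanishes for zero parameters, so subtracting quotients and remainder there changes nothing\<close>
  define ze where "ze p = tup ?n (\<lambda>i. if 2 \<le> i \<and> i < m + 2 then 0 else p i)" for p :: "nat \<Rightarrow> real"
  have ze_sg: "smooth_germ ?n (\<lambda>p. F (ze p))" if "smooth_germ ?n F" for F :: "_ \<Rightarrow> complex"
  proof -
    have "smooth_germ ?n (\<lambda>p. F (tup ?n (\<lambda>i. (if 2 \<le> i \<and> i < m + 2 then (\<lambda>_. 0) else (\<lambda>p. p i)) p)))"
      by (rule sg_comp[OF that]) (auto intro: sg_const sg_proj)
    then show ?thesis unfolding ze_def by (simp add: if_distrib[of "\<lambda>f. f _"] cong: if_cong)
  qed
  have ze_ev: "\<forall>\<^sub>F p in param_nhds ?n. P (ze p)" if "eventually P (param_nhds ?n)" for P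
  proof -
    have "\<forall>\<^sub>F p in param_nhds ?n. P (tup ?n (\<lambda>i. (if 2 \<le> i \<and> i < m + 2 then (\<lambda>_. 0) else (\<lambda>p. p i)) p))"
      by (rule eventually_tup[OF that]) (auto intro: sg_const sg_proj)
    then show ?thesis unfolding ze_def by (simp add: if_distrib[of "\<lambda>f. f _"] cong: if_cong)
  qed
  have ze: "zc (ze p) = zc p" "c0 (ze p) = c0 p" "c1 (ze p) = c1 p" "nsq (ze p) = nsq p" "ze (rot p) = rot (ze p)" for p
    by (auto simp: ze_def zc_def c0_def c1_def nsq_def tup_def rot_def fun_eq_iff)
  have ze_upd: "ze (p(0 := x, 1 := y)) = (ze p)(0 := x, 1 := y)" for p x y
    by (auto simp: ze_def tup_def fun_eq_iff)
  define \<sigma>' where "\<sigma>' p = \<sigma> p - \<sigma> (ze p)" for p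
  define \<tau>' where "\<tau>' p = \<tau> p - \<tau> (ze p)" for p
  define q0 where "q0 p = r0 p - r0 (ze p)" for p
  define q1 where "q1 p = r1 p - r1 (ze p)" for p
  have sg': "smooth_germ ?n \<sigma>'" "smooth_germ ?n \<tau>'" "smooth_germ ?n q0" "smooth_germ ?n q1"
    unfolding \<sigma>'_def[abs_def] \<tau>'_def[abs_def] q0_def[abs_def] q1_def[abs_def] by (intro sg_diff D ze_sg)+
  have q_upd: "q0 (p(0 := x, 1 := y)) = q0 p" "q1 (p(0 := x, 1 := y)) = q1 p" for p x y
    unfolding q0_def q1_def ze_upd by (simp_all only: D(7,8))
  have K0: "\<forall>\<^sub>F p in param_nhds ?n. K (ze p) = 0"
    using ze_ev[OF fge[OF h0]]
  proof eventually_elim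
    case (elim p)
    have "\<forall>i\<ge>2. fg (ze p) i = 0" by (auto simp: fg_def ze_def tup_def)
    moreover have "zc (fg (ze p)) = zc (ze p)" by (simp add: zc_def fg_def tup_def)
    ultimately show ?case using elim by (simp add: K_def)
  qed
  have D': "\<forall>\<^sub>F p in param_nhds ?n. K p = \<sigma>' p * model (c0 p) (c1 p) (zc p) + \<tau>' p * cnj (model (c0 p) (c1 p) (zc p))
        + (q0 p + q1 p * of_real (nsq p)) * zc p"
    using D(9) ze_ev[OF D(9)] K0
  proof eventually_elim
    case (elim p)
    have "K p = K p - K (ze p)" using elim(3) by simp
    also have "\<dots> = (\<sigma> p * model (c0 p) (c1 p) (zc p) + \<tau> p * cnj (model (c0 p) (c1 p) (zc p)) + (r0 p + r1 p * of_real (nsq p)) * zc p)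
      - (\<sigma> (ze p) * model (c0 p) (c1 p) (zc p) + \<tau> (ze p) * cnj (model (c0 p) (c1 p) (zc p)) + (r0 (ze p) + r1 (ze p) * of_real (nsq p)) * zc p)"
      unfolding elim(2)[unfolded ze] using elim(1) by simp
    also have "\<dots> = \<sigma>' p * model (c0 p) (c1 p) (zc p) + \<tau>' p * cnj (model (c0 p) (c1 p) (zc p)) + (q0 p + q1 p * of_real (nsq p)) * zc p"
      by (simp only: \<sigma>'_def \<tau>'_def q0_def q1_def algebra_simps)
    finally show ?case .
  qed
  have ze_id: "ze p = p" if "\<And>i. 2 \<le> i \<Longrightarrow> i < m + 2 \<Longrightarrow> p i = 0" "\<And>i. i \<ge> ?n \<Longrightarrow> p i = 0" for p
    using that by (auto simp: ze_def tup_def fun_eq_iff)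
  \<comment> \<open>the remainder does not depend on z, so the equations live over parameters and coefficients\<close>
  define up where "up q = tup ?n (\<lambda>i. if i < 2 then 0 else q (i - 2))" for q :: "nat \<Rightarrow> real"
  have up_sg: "smooth_germ (m + 4) (\<lambda>q. F (up q))" if "smooth_germ ?n F" for F :: "_ \<Rightarrow> complex"
  proof -
    have "smooth_germ (m + 4) (\<lambda>q. F (tup ?n (\<lambda>i. (if i < 2 then (\<lambda>_. 0) else (\<lambda>q. q (i - 2))) q)))"
      by (rule sg_comp[OF that]) (auto intro: sg_const sg_proj)
    then show ?thesis unfolding up_def by (simp add: if_distrib[of "\<lambda>f. f _"] cong: if_cong)
  qed
  define \<rho> where "\<rho> i q = (if i = 0 then Re (q0 (up q)) else if i = 1 then Im (q0 (up q))
      else if i = 2 then Re (q1 (up q)) else Im (q1 (up q)))" for i :: nat and q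
  have \<rho>: "smooth_germ (m + 4) (\<rho> i)" for i
    unfolding \<rho>_def[abs_def] by (cases "i = 0"; cases "i = 1"; cases "i = 2") (simp_all add: sg_Re sg_Im up_sg sg')
  have "\<rho> i q = 0" if "\<forall>j<m. q j = 0" for i q
  proof -
    have "ze (up q) = up q" by (rule ze_id) (use that in \<open>auto simp: up_def tup_def\<close>)
    then show ?thesis by (simp add: \<rho>_def q0_def q1_def)
  qed
  then have \<rho>0: "\<forall>\<^sub>F q in param_nhds (m + 4). (\<forall>j<m. q j = 0) \<longrightarrow> \<rho> i q = 0" for i
    by (simp add: always_eventually)
  have "\<exists>\<phi>. (\<forall>i<4. smooth_germ m (\<phi> i) \<and> \<phi> i (\<lambda>_. 0) = 0 \<and>
     (\<forall>\<^sub>F p in param_nhds m. \<rho> i (tup (m + 4) (\<lambda>j. if j < m then p j else \<phi> (j - m) p)) = \<phi> i p))"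
    by (rule ift) (rule \<rho> \<rho>0)+
  then obtain \<phi> where \<phi>4: "\<forall>i<4. smooth_germ m (\<phi> i) \<and> \<phi> i (\<lambda>_. 0) = 0 \<and>
     (\<forall>\<^sub>F p in param_nhds m. \<rho> i (tup (m + 4) (\<lambda>j. if j < m then p j else \<phi> (j - m) p)) = \<phi> i p)" by (elim exE)
  have \<phi>: "smooth_germ m (\<phi> i)" "\<phi> i (\<lambda>_. 0) = 0"
    "\<forall>\<^sub>F p in param_nhds m. \<rho> i (tup (m + 4) (\<lambda>j. if j < m then p j else \<phi> (j - m) p)) = \<phi> i p" if "i < 4" for i
    by (rule conjunct1[OF \<phi>4[rule_format, OF that]],
        rule conjunct1[OF conjunct2[OF \<phi>4[rule_format, OF that]]],
        rule conjunct2[OF conjunct2[OF \<phi>4[rule_format, OF that]]])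
  define l0 where "l0 \<mu> = Complex (\<phi> 0 \<mu>) (\<phi> 1 \<mu>)" for \<mu>
  define l1 where "l1 \<mu> = 3 + Complex (\<phi> 2 \<mu>) (\<phi> 3 \<mu>)" for \<mu>
  have l: "smooth_germ m l0" "smooth_germ m l1" "l0 (\<lambda>_. 0) = 0" "l1 (\<lambda>_. 0) = 3"
    unfolding l0_def[abs_def] l1_def[abs_def] using \<phi>(1,2)
    by (auto intro!: sg_add sg_const sg_Complex simp: complex_eq_iff)
  define pr where "pr p = tup m (\<lambda>i. p (i + 2))" for p :: "nat \<Rightarrow> real"
  have pr_ev: "\<forall>\<^sub>F p in param_nhds (m + 2). P (pr p)" if "eventually P (param_nhds m)" for P
    unfolding pr_def by (rule eventually_tup[OF that sg_proj]) simp
  have pr_sg: "smooth_germ (m + 2) (\<lambda>p. F (pr p))" if "smooth_germ m F" for F :: "_ \<Rightarrow> real"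
    unfolding pr_def by (rule sg_comp[OF that sg_proj]) simp
  have pr_par: "\<forall>\<^sub>F p in param_nhds (m + 2). pr p = par p"
    using eventually_coord_0 by eventually_elim (auto simp: pr_def par_def tup_def fun_eq_iff)
  have pr_rot: "pr (rot p) = pr p" for p by (auto simp: pr_def tup_def rot_def fun_eq_iff)
  define T where "T p = tup ?n (\<lambda>i. if i < m + 2 then p i else \<phi> (i - (m + 2)) (pr p))" for p
  define g where "g i = (if i < m + 2 then (\<lambda>p. p i) else (\<lambda>p. \<phi> (i - (m + 2)) (pr p)))" for i
  have T_alt: "T p = tup ?n (\<lambda>i. g i p)" for p
    by (auto simp: T_def tup_def g_def fun_eq_iff)
  have pr0: "pr (\<lambda>_. 0) = (\<lambda>_. 0)" by (auto simp: pr_def tup_def)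
  have g: "smooth_germ (m + 2) (g i)" "g i (\<lambda>_. 0) = 0" if "i < ?n" for i
  proof -
    have j: "i - (m + 2) < 4" if "\<not> i < m + 2" using that \<open>i < ?n\<close> by auto
    show "smooth_germ (m + 2) (g i)"
      unfolding g_def using sg_proj pr_sg[OF \<phi>(1)[OF j]] by (cases "i < m + 2") simp_all
    show "g i (\<lambda>_. 0) = 0"
      unfolding g_def using pr0 \<phi>(2)[OF j] by (cases "i < m + 2") simp_all
  qed
  have T_sg: "smooth_germ (m + 2) (\<lambda>p. F (T p))" if "smooth_germ ?n F" for F :: "_ \<Rightarrow> complex"
    unfolding T_alt by (rule sg_comp[OF that g])
  have T_ev: "\<forall>\<^sub>F p in param_nhds (m + 2). P (T p)" if "eventually P (param_nhds ?n)" for P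
    unfolding T_alt by (rule eventually_tup[OF that g])
  have T_rot: "T (rot p) = rot (T p)" for p
    unfolding T_def pr_rot by (auto simp: tup_def rot_def fun_eq_iff)
  have T_zero: "ze (T p) = T p" if "\<And>i. i \<ge> 2 \<Longrightarrow> p i = 0" for p
    by (rule ze_id) (use that in \<open>auto simp: T_def tup_def\<close>)
  have T_fg: "\<forall>\<^sub>F p in param_nhds (m + 2). fg (T p) = p"
    using eventually_coord_0 by eventually_elim (auto simp: fg_def T_def tup_def fun_eq_iff)
  have T_c: "zc (T p) = zc p" "nsq (T p) = nsq p" "c0 (T p) = l0 (pr p)" "c1 (T p) = l1 (pr p)" for p
  proof -
    have i: "m + 3 - (m + 2) = 1" "m + 4 - (m + 2) = 2" "m + 5 - (m + 2) = 3" by auto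
    show "zc (T p) = zc p" "nsq (T p) = nsq p" "c0 (T p) = l0 (pr p)" "c1 (T p) = l1 (pr p)"
      by (simp_all add: zc_def nsq_def c0_def c1_def l0_def l1_def T_def tup_def i)
  qed
  have T_up: "(T p)(0 := 0, 1 := 0) = up (tup (m + 4) (\<lambda>j. if j < m then pr p j else \<phi> (j - m) (pr p)))" for p
  proof (rule ext)
    fix i
    show "((T p)(0 := 0, 1 := 0)) i = up (tup (m + 4) (\<lambda>j. if j < m then pr p j else \<phi> (j - m) (pr p))) i"
    proof (cases "i < 2")
      case True
      then have "i = 0 \<or> i = 1" by auto
      then show ?thesis by (auto simp: up_def tup_def)
    next
      case False
      then have "i - 2 - m = i - (m + 2)" "i = i - 2 + 2" by auto
      then show ?thesis using False by (auto simp: up_def tup_def T_def pr_def)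
    qed
  qed
  have i4: "0 < (4::nat)" "1 < (4::nat)" "2 < (4::nat)" "3 < (4::nat)" by auto
  have Tq: "\<forall>\<^sub>F p in param_nhds (m + 2). q0 (T p) = l0 (pr p) \<and> q1 (T p) = l1 (pr p) - 3"
    using pr_ev[OF \<phi>(3)[OF i4(1)]] pr_ev[OF \<phi>(3)[OF i4(2)]] pr_ev[OF \<phi>(3)[OF i4(3)]] pr_ev[OF \<phi>(3)[OF i4(4)]]
  proof eventually_elim
    case (elim p)
    have "q0 (T p) = q0 ((T p)(0 := 0, 1 := 0))" "q1 (T p) = q1 ((T p)(0 := 0, 1 := 0))" by (simp_all only: q_upd)
    then show ?case using elim unfolding T_up by (simp add: \<rho>_def l0_def l1_def complex_eq_iff)
  qed
  show ?thesis
  proof (rule that[OF l, of "\<lambda>p. \<sigma>' (T p)" "\<lambda>p. \<tau>' (T p)"])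
    show "smooth_germ (m + 2) (\<lambda>p. \<sigma>' (T p))" "smooth_germ (m + 2) (\<lambda>p. \<tau>' (T p))" by (intro T_sg sg')+
    show "\<sigma>' (T (rot p)) = \<sigma>' (T p)" "\<tau>' (T (rot p)) = - \<tau>' (T p)" for p
      by (simp_all add: T_rot \<sigma>'_def \<tau>'_def ze D)
    show "\<sigma>' (T p) = 0" "\<tau>' (T p) = 0" if "\<And>i. i \<ge> 2 \<Longrightarrow> p i = 0" for p
      using T_zero[OF that] by (simp_all add: \<sigma>'_def \<tau>'_def)
    show "\<forall>\<^sub>F p in param_nhds (m + 2). h p = (1 + \<sigma>' (T p)) * model (l0 (par p)) (l1 (par p)) (zc p)
       + \<tau>' (T p) * cnj (model (l0 (par p)) (l1 (par p)) (zc p))"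
      using T_ev[OF D'] T_fg Tq pr_par
    proof eventually_elim
      case (elim p)
      define G where "G = model (l0 (pr p)) (l1 (pr p)) (zc p)"
      define R where "R = (l0 (pr p) + (l1 (pr p) - 3) * of_real (nsq p)) * zc p"
      have A: "h p - model 0 3 (zc p) = \<sigma>' (T p) * G + \<tau>' (T p) * cnj G + R"
        using elim(1,2,3) by (simp add: K_def T_c G_def R_def)
      have B: "G = model 0 3 (zc p) + R"
        by (simp add: G_def R_def model_def nsq_zc algebra_simps)
      have "h p = \<sigma>' (T p) * G + \<tau>' (T p) * cnj G + (model 0 3 (zc p) + R)" using A by (simp add: diff_eq_eq add_ac)
      then have "h p = (1 + \<sigma>' (T p)) * G + \<tau>' (T p) * cnj G" unfolding B[symmetric] by (simp add: algebra_simps)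
      then show ?case by (simp add: G_def elim(4))
    qed
  qed
qed

section \<open>The unfolding as a family of cubic models\<close>

text \<open>
  For \<open>|E| = 1\<close> one has \<open>(1 + E)\<^sup>2 = E |1 + E|\<^sup>2\<close>, so that \<open>(1 + E) / |1 + E|\<close> is a square root of E.
\<close>

lemma unit_sqrt:
  assumes E: "smooth_germ n E" "E (\<lambda>_. 0) = 1" "\<forall>\<^sub>F p in param_nhds n. cmod (E p) = 1"
  obtains e where "smooth_germ n e" "e (\<lambda>_. 0) = 1" "\<forall>\<^sub>F p in param_nhds n. cmod (e p) = 1 \<and> e p ^ 2 = E p"
proof -
  define w where "w p = 2 + 2 * Re (E p)" for p
  have w: "smooth_germ n w" unfolding w_def[abs_def] by (intro sg_add sg_mult sg_const sg_Re E)
  have w0: "w (\<lambda>_. 0) = 4" by (simp add: w_def E)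
  define e where "e p = (1 + E p) * of_real (inverse (sqrt (w p)))" for p
  have sw: "smooth_germ n (\<lambda>p. sqrt (w p))" by (rule sg_sqrt[OF w]) (simp add: w0)
  have e: "smooth_germ n e" unfolding e_def[abs_def]
    by (intro sg_mult sg_add sg_const sg_of_real sg_inverse sw E) (simp add: w0)
  have "\<forall>\<^sub>F p in param_nhds n. norm (w p - w (\<lambda>_. 0)) < 4" by (rule sg_near[OF w]) simp
  then have "\<forall>\<^sub>F p in param_nhds n. cmod (e p) = 1 \<and> e p ^ 2 = E p"
    using E(3)
  proof eventually_elim
    case (elim p)
    have wp: "w p > 0" using elim(1) by (simp add: w0)
    have EE: "E p * cnj (E p) = 1" using elim(2) complex_norm_square[of "E p"] by simp
    have wc: "of_real (w p) = 2 + E p + cnj (E p)" using complex_add_cnj[of "E p"] by (simp add: w_def add.assoc)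
    have s: "complex_of_real (inverse (sqrt (w p))) ^ 2 * of_real (w p) = 1"
      using wp by (simp flip: of_real_power of_real_mult add: power_inverse)
    have "(1 + E p) ^ 2 = E p * of_real (w p)" unfolding wc using EE by (simp add: power2_eq_square algebra_simps)
    then have "e p ^ 2 = E p * (complex_of_real (inverse (sqrt (w p))) ^ 2 * of_real (w p))"
      by (simp add: e_def power_mult_distrib)
    then have e2: "e p ^ 2 = E p" unfolding s by simp
    then have "cmod (e p) ^ 2 = 1" using elim(2) by (metis norm_power)
    then have "cmod (e p) = 1" by (metis abs_norm_cancel power2_eq_1_iff abs_of_nonneg norm_ge_zero abs_minus abs_one)
    then show ?case using e2 by blast
  qed
  then show ?thesis using that[OF e] by (simp add: e_def w0 E)
qed

text \<open>
  Since \<open>e ^ 3 cnj (e z) ^ 3 = cnj z ^ 3\<close>, the left hand side is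
  \<open>cnj z ^ 3 + E (3 N + (1 + N) (b + D N)) z\<close> with \<open>E = e ^ 4\<close>, \<open>b = - 4 i a / k\<close> and
  \<open>D = 4 \<delta> / k\<close>. Reducing \<open>N\<^sup>2 z\<close> by \<open>syzygy_quadratic\<close> and comparing coefficients leads to
  \<open>l0 = E (b - D quad0)\<close> and \<open>l1 - l0 = E (3 + D (1 - quad1 + quad0))\<close>. As the second bracket is
  real, E is the phase of \<open>l1 - l0\<close>; its modulus then determines \<open>\<delta>\<close>, and the first equation a.
\<close>

lemma G4_as_model:
  fixes l0 l1 E e z :: complex
  assumes k: "k \<noteq> 0" and l1: "(cmod l1)\<^sup>2 \<noteq> 1" and u: "1 - quad1 l0 l1 + quad0 l0 l1 \<noteq> 0"
    and E: "l1 - l0 = E * of_real (cmod (l1 - l0))" "cmod e = 1" "e ^ 4 = E"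
  defines "\<delta> \<equiv> (k / 4) * (cmod (l1 - l0) - 3) / (1 - quad1 l0 l1 + quad0 l0 l1)"
  defines "a \<equiv> (\<i> * of_real k / 4) * (cnj E * l0 + of_real (4 * \<delta> / k * quad0 l0 l1))"
  defines "v \<equiv> E * of_real (4 * \<delta> / k * inverse (1 - (cmod l1)\<^sup>2))"
  shows "cinv k ((cmod z)\<^sup>2) * e ^ 3 * toC (G4 k (ofC (e * z)) (Re a) (Im a) \<delta>)
    = (1 - v * cnj (l0 + l1 * (z * cnj z))) * model l0 l1 z + v * cnj z ^ 2 * cnj (model l0 l1 z)"
proof -
  define N where "N = z * cnj z"
  define w1 where "w1 = complex_of_real (quad1 l0 l1)"
  define w0 where "w0 = complex_of_real (quad0 l0 l1)"
  define D where "D = complex_of_real (4 * \<delta> / k)"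
  define G where "G = model l0 l1 z"
  have ez: "cmod (e * z) = cmod z" using E(2) by (simp add: norm_mult)
  have Nz: "of_real ((cmod z)\<^sup>2) = N" by (simp only: N_def complex_norm_square)
  have ee: "e * cnj e = 1" using E(2) complex_norm_square[of e] by simp
  have EE: "E * cnj E = 1"
  proof -
    have "cmod E = 1" using E(2) unfolding E(3)[symmetric] by (simp add: norm_power)
    then show ?thesis using complex_norm_square[of E] by simp
  qed
  have e3: "e ^ 3 * cnj e ^ 3 = 1" using ee by (metis power_mult_distrib power_one)
  have c: "cinv k ((cmod z)\<^sup>2) = - (4 * \<i> / of_real k) * (1 + N)"
    by (simp add: cinv_def Nz[symmetric])
  have ca: "- (4 * \<i> / of_real k) * a = cnj E * l0 + D * w0"
    using k by (simp add: a_def D_def w0_def field_simps)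
  have cd: "- (4 * \<i> / of_real k) * (\<i> * of_real \<delta>) = D" using k by (simp add: D_def field_simps)
  have F: "cinv k ((cmod z)\<^sup>2) * toC (F4 k (ofC (e * z))) = model 0 3 (e * z)"
    using cinv_F4[OF k, of "ofC (e * z)"] by (simp add: ez)
  have aa: "Complex (Re a) (Im a) = a" by simp
  have g: "e ^ 3 * model 0 3 (e * z) = cnj z ^ 3 + E * 3 * N * z"
  proof -
    have "e ^ 3 * model 0 3 (e * z) = (e ^ 3 * cnj e ^ 3) * cnj z ^ 3 + 3 * (e * cnj e) * (e ^ 4) * N * z"
      by (simp add: model_def N_def power_mult_distrib numeral_eq_Suc algebra_simps)
    then show ?thesis unfolding e3 ee E(3) by simp
  qed
  have "cinv k ((cmod z)\<^sup>2) * e ^ 3 * toC (G4 k (ofC (e * z)) (Re a) (Im a) \<delta>)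
     = e ^ 3 * (cinv k ((cmod z)\<^sup>2) * toC (F4 k (ofC (e * z)))) + cinv k ((cmod z)\<^sup>2) * (a + \<i> * of_real \<delta> * N) * (e ^ 3 * e) * z"
    unfolding toC_G4 aa toC_ofC ez Nz by (simp only: algebra_simps)
  also have "e ^ 3 * e = E" using E(3) by (simp add: numeral_eq_Suc algebra_simps)
  also have "cinv k ((cmod z)\<^sup>2) * (a + \<i> * of_real \<delta> * N) = (1 + N) * (- (4 * \<i> / of_real k) * a + - (4 * \<i> / of_real k) * (\<i> * of_real \<delta>) * N)"
    unfolding c by (simp only: algebra_simps)
  also have "\<dots> = (1 + N) * (cnj E * l0 + D * w0 + D * N)" unfolding ca cd ..
  finally have 1: "cinv k ((cmod z)\<^sup>2) * e ^ 3 * toC (G4 k (ofC (e * z)) (Re a) (Im a) \<delta>)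
     = cnj z ^ 3 + E * 3 * N * z + (1 + N) * (cnj E * l0 + D * w0 + D * N) * E * z" unfolding F g .
  have syz: "(N\<^sup>2 + w1 * N + w0) * z = of_real (inverse (1 - (cmod l1)\<^sup>2)) * (cnj z ^ 2 * cnj G - cnj (l0 + l1 * N) * G)"
    unfolding N_def w1_def w0_def G_def by (rule syzygy_quadratic[OF l1])
  have v: "v = E * D * of_real (inverse (1 - (cmod l1)\<^sup>2))" by (simp add: v_def D_def)
  have Du: "3 + D * (1 - w1 + w0) = of_real (cmod (l1 - l0))"
  proof -
    have "4 * ((k / 4) * x / y) / k * y = x" if "y \<noteq> 0" for x y :: real using k that by simp
    from this[OF u] have "4 * \<delta> / k * (1 - quad1 l0 l1 + quad0 l0 l1) = cmod (l1 - l0) - 3" unfolding \<delta>_def .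
    moreover have "D * (1 - w1 + w0) = of_real (4 * \<delta> / k * (1 - quad1 l0 l1 + quad0 l0 l1))"
      by (simp only: D_def w1_def w0_def of_real_mult of_real_diff of_real_add of_real_1)
    ultimately have "D * (1 - w1 + w0) = of_real (cmod (l1 - l0) - 3)" by (simp only:)
    then show ?thesis by simp
  qed
  have L: "E * (3 + D * (1 - w1 + w0)) = l1 - l0" unfolding Du using E(1) by simp
  have "(1 - v * cnj (l0 + l1 * N)) * G + v * cnj z ^ 2 * cnj G
     = G + E * D * (of_real (inverse (1 - (cmod l1)\<^sup>2)) * (cnj z ^ 2 * cnj G - cnj (l0 + l1 * N) * G))"
    unfolding v by (simp add: algebra_simps)
  also have "\<dots> = G + E * D * ((N\<^sup>2 + w1 * N + w0) * z)" unfolding syz ..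
  also have "\<dots> = cnj z ^ 3 + l0 * z + (l0 + (l1 - l0)) * N * z + E * D * ((N\<^sup>2 + w1 * N + w0) * z)"
    by (simp add: G_def model_def N_def algebra_simps)
  also have "\<dots> = cnj z ^ 3 + E * 3 * N * z + (1 + N) * ((E * cnj E) * l0 + E * D * w0 + E * D * N) * z"
    unfolding L[symmetric] EE by (simp add: power2_eq_square algebra_simps)
  also have "\<dots> = cinv k ((cmod z)\<^sup>2) * e ^ 3 * toC (G4 k (ofC (e * z)) (Re a) (Im a) \<delta>)"
    unfolding 1 by (simp add: algebra_simps)
  finally show ?thesis unfolding N_def G_def by simp
qed

section \<open>Versality\<close>

lemma sg_cmod: "smooth_germ n f \<Longrightarrow> f (\<lambda>_. 0) \<noteq> 0 \<Longrightarrow> smooth_germ n (\<lambda>p. cmod (f p))"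
  unfolding cmod_def
  by (rule sg_sqrt) (auto intro!: sg_add sg_power sg_Re sg_Im simp: complex_eq_iff sum_power2_gt_zero_iff)

lemma sg_eventually_ne:
  fixes f :: "_ \<Rightarrow> 'b::real_normed_vector"
  assumes "smooth_germ n f" "f (\<lambda>_. 0) \<noteq> c" shows "\<forall>\<^sub>F p in param_nhds n. f p \<noteq> c"
proof -
  have "\<forall>\<^sub>F p in param_nhds n. norm (f p - f (\<lambda>_. 0)) < norm (f (\<lambda>_. 0) - c)"
    by (rule sg_near[OF assms(1)]) (use assms(2) in simp)
  then show ?thesis by eventually_elim (auto simp: norm_minus_commute)
qed

lemma eventually_pt:
  assumes "eventually P (nhds (0::real^2))" shows "\<forall>\<^sub>F p in param_nhds (m + 2). P (pt p)"
proof -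
  obtain U where U: "open U" "0 \<in> U" "\<forall>x\<in>U. P x" using assms by (auto simp: eventually_nhds)
  with open_contains_square[of U] obtain e where "e > 0" "\<forall>x. \<bar>x $ 1\<bar> < e \<and> \<bar>x $ 2\<bar> < e \<longrightarrow> P x" by blast
  then show ?thesis
    unfolding eventually_param_nhds by (intro exI[of _ e]) (auto simp: cube_def)
qed

lemma eventually_par:
  assumes "eventually P (param_nhds m)" shows "\<forall>\<^sub>F p in param_nhds (m + 2). P (par p)"
proof -
  obtain e where e: "e > 0" "\<forall>p\<in>cube m e. P p" using assms by (auto simp: eventually_param_nhds)
  then show ?thesis unfolding eventually_param_nhds by (intro exI[of _ e]) (auto simp: cube_def par_def)
qed

lemma sg_par:
  assumes "smooth_germ m F" shows "smooth_germ (m + 2) (\<lambda>p. F (par p))"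
proof (rule sg_cong)
  show "smooth_germ (m + 2) (\<lambda>p. F (tup m (\<lambda>i. p (i + 2))))" by (rule sg_comp[OF assms sg_proj]) simp
  have "\<forall>\<^sub>F p in param_nhds (m + 2). tup m (\<lambda>i. p (i + 2)) = par p"
    using eventually_coord_0 by eventually_elim (auto simp: par_def tup_def fun_eq_iff)
  then show "\<forall>\<^sub>F p in param_nhds (m + 2). F (tup m (\<lambda>i. p (i + 2))) = F (par p)" by eventually_elim simp
qed

lemma cinv_props: "k \<noteq> 0 \<Longrightarrow> cinv k ((cmod z)\<^sup>2) \<noteq> 0" "cnj (cinv k x) = - cinv k x"
proof -
  have "1 + (cmod z)\<^sup>2 > 0" by (simp add: add_pos_nonneg)
  then have "complex_of_real (1 + (cmod z)\<^sup>2) \<noteq> 0" by (metis of_real_eq_0_iff less_irrefl)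
  then show "k \<noteq> 0 \<Longrightarrow> cinv k ((cmod z)\<^sup>2) \<noteq> 0" by (simp add: cinv_def)
  show "cnj (cinv k x) = - cinv k x" by (simp add: cinv_def)
qed

text \<open>
  If both \<open>c hh\<close> and \<open>c e ^ 3 y\<close> are multiples of the same G, the second relation is solved for G
  and inserted into the first. The matrix \<open>w \<mapsto> p w + q cnj w\<close> has determinant \<open>|p|\<^sup>2 - |q|\<^sup>2\<close>, and its
  inverse is \<open>w \<mapsto> (cnj p w - q cnj w) / (|p|\<^sup>2 - |q|\<^sup>2)\<close>. As c is purely imaginary, cancelling it
  costs only a sign in the coefficient of \<open>cnj y\<close>.
\<close>

lemma combine_multipliers:
  fixes c y s t s' t' e G hh :: complex
  assumes c: "c \<noteq> 0" "cnj c = - c"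
    and h: "c * hh = (1 + s) * G + t * cnj G"
    and g: "c * e ^ 3 * y = (1 + s') * G + t' * cnj G"
    and D: "(cmod (1 + s'))\<^sup>2 - (cmod t')\<^sup>2 \<noteq> 0"
  defines "d \<equiv> complex_of_real (inverse ((cmod (1 + s'))\<^sup>2 - (cmod t')\<^sup>2))"
  defines "\<alpha> \<equiv> cnj (1 + s') * d" and "\<beta> \<equiv> - t' * d"
  shows "hh = ((1 + s) * \<alpha> + t * cnj \<beta>) * e ^ 3 * y + - ((1 + s) * \<beta> + t * cnj \<alpha>) * cnj e ^ 3 * cnj y"
proof -
  define g' where "g' = c * e ^ 3 * y"
  define A where "A = 1 + s'"
  have g': "g' = A * G + t' * cnj G" using g by (simp add: g'_def A_def)
  have cg: "cnj g' = - c * cnj e ^ 3 * cnj y" using c(2) by (simp add: g'_def)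
  have dd: "d * (A * cnj A - t' * cnj t') = 1"
  proof -
    have "complex_of_real ((cmod (1 + s'))\<^sup>2 - (cmod t')\<^sup>2) = A * cnj A - t' * cnj t'"
      by (simp only: of_real_diff complex_norm_square A_def)
    then show ?thesis using D unfolding d_def by (metis of_real_mult of_real_1 left_inverse)
  qed
  have "\<alpha> * g' + \<beta> * cnj g' = d * (A * cnj A - t' * cnj t') * G"
    unfolding g' \<alpha>_def \<beta>_def A_def[symmetric] by (simp add: algebra_simps)
  then have G: "G = \<alpha> * g' + \<beta> * cnj g'" using dd by simp
  have "c * hh = (1 + s) * (\<alpha> * g' + \<beta> * cnj g') + t * cnj (\<alpha> * g' + \<beta> * cnj g')" using h G by metis
  also have "\<dots> = ((1 + s) * \<alpha> + t * cnj \<beta>) * g' + ((1 + s) * \<beta> + t * cnj \<alpha>) * cnj g'"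
    by (simp add: algebra_simps)
  also have "\<dots> = c * (((1 + s) * \<alpha> + t * cnj \<beta>) * e ^ 3 * y + - ((1 + s) * \<beta> + t * cnj \<alpha>) * cnj e ^ 3 * cnj y)"
    unfolding cg unfolding g'_def by (simp add: algebra_simps)
  finally show ?thesis using c(1) by simp
qed

lemma G4_versal:
  assumes k: "k \<noteq> 0" and H: "Z4_unfolding m (F4 k) H"
  shows "factors_through m H 3 (\<lambda>v p. G4 k v (p 0) (p 1) (p 2))"
proof -
  let ?n = "m + 2"
  have Hs: "smooth_germ ?n (\<lambda>p. H (pt p) (par p))" using H by (simp only: Z4_unfolding_def smooth_family_germ_alt)
  have He: "\<forall>\<^sub>F p in param_nhds ?n. toC (H (pt (rot p)) (par p)) = \<i> * toC (H (pt p) (par p))"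
    using H by (simp only: Z4_unfolding_def equivariant_family_iff)
  have H0: "\<forall>\<^sub>F x in nhds 0. H x (\<lambda>_. 0) = F4 k x" using H by (simp only: Z4_unfolding_def)
  define h where "h p = cinv k (nsq p) * toC (H (pt p) (par p))" for p
  have h: "smooth_germ ?n h" unfolding h_def[abs_def] by (intro sg_mult sg_cinv k sg_nsq sg_toC Hs)
  have he: "\<forall>\<^sub>F p in param_nhds ?n. h (rot p) = \<i> * h p"
    using He by eventually_elim (simp add: h_def)
  have h0: "\<forall>\<^sub>F p in param_nhds ?n. (\<forall>i\<ge>2. p i = 0) \<longrightarrow> h p = model 0 3 (zc p)"
    using eventually_pt[OF H0, of m]
  proof eventually_elim
    case (elim p)
    show ?case
    proof
      assume "\<forall>i\<ge>2. p i = 0"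
      then have "par p = (\<lambda>_. 0)" by (simp add: par_def)
      then show "h p = model 0 3 (zc p)" using cinv_F4[OF k, of "pt p"] elim by (simp add: h_def nsq_cmod)
    qed
  qed
  obtain l0 l1 s t where l: "smooth_germ m l0" "smooth_germ m l1" "l0 (\<lambda>_. 0) = 0" "l1 (\<lambda>_. 0) = 3"
    and st: "smooth_germ ?n s" "smooth_germ ?n t" "\<And>p. s (rot p) = s p" "\<And>p. t (rot p) = - t p"
    and st0: "\<And>p. (\<And>i. i \<ge> 2 \<Longrightarrow> p i = 0) \<Longrightarrow> s p = 0" "\<And>p. (\<And>i. i \<ge> 2 \<Longrightarrow> p i = 0) \<Longrightarrow> t p = 0"
    and red: "\<forall>\<^sub>F p in param_nhds ?n. h p = (1 + s p) * model (l0 (par p)) (l1 (par p)) (zc p)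
       + t p * cnj (model (l0 (par p)) (l1 (par p)) (zc p))"
    using reduction[OF h he h0] by blast
  define w where "w \<mu> = 1 - quad1 (l0 \<mu>) (l1 \<mu>) + quad0 (l0 \<mu>) (l1 \<mu>)" for \<mu>
  define r where "r \<mu> = cmod (l1 \<mu> - l0 \<mu>)" for \<mu>
  define E where "E \<mu> = (l1 \<mu> - l0 \<mu>) * of_real (inverse (r \<mu>))" for \<mu>
  have bs: "smooth_germ m (\<lambda>\<mu>. quad0 (l0 \<mu>) (l1 \<mu>))" "smooth_germ m (\<lambda>\<mu>. quad1 (l0 \<mu>) (l1 \<mu>))"
    unfolding quad0_def quad1_def using l by (auto intro!: sg_divide sg_diff sg_const sg_cmod2 sg_mult sg_Re sg_Im sg_add sg_cnj)
  have bz: "quad0 (l0 (\<lambda>_. 0)) (l1 (\<lambda>_. 0)) = 0" "quad1 (l0 (\<lambda>_. 0)) (l1 (\<lambda>_. 0)) = 0" using l by (simp_all add: quad0_def quad1_def)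
  have w: "smooth_germ m w" "w (\<lambda>_. 0) = 1"
    unfolding w_def[abs_def] by (auto intro!: sg_add sg_diff sg_const bs simp: bz)
  have r: "smooth_germ m r" "r (\<lambda>_. 0) = 3"
    unfolding r_def[abs_def] using l by (auto intro!: sg_cmod sg_diff)
  have "smooth_germ m E"
    unfolding E_def[abs_def] by (intro sg_mult sg_diff sg_of_real sg_inverse l r(1)) (simp add: r)
  then have E: "smooth_germ m E" "E (\<lambda>_. 0) = 1" by (simp_all add: E_def r l)
  have rE: "\<forall>\<^sub>F \<mu> in param_nhds m. r \<mu> \<noteq> 0" by (rule sg_eventually_ne[OF r(1)]) (simp add: r)
  have Eu: "\<forall>\<^sub>F \<mu> in param_nhds m. cmod (E \<mu>) = 1"
    using rE by eventually_elim (simp add: E_def norm_mult r_def norm_inverse)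
  have Er: "\<forall>\<^sub>F \<mu> in param_nhds m. l1 \<mu> - l0 \<mu> = E \<mu> * of_real (r \<mu>)"
    using rE by eventually_elim (simp add: E_def)
  obtain e1 where e1: "smooth_germ m e1" "e1 (\<lambda>_. 0) = 1" "\<forall>\<^sub>F \<mu> in param_nhds m. cmod (e1 \<mu>) = 1 \<and> e1 \<mu> ^ 2 = E \<mu>"
    using unit_sqrt[OF E Eu] by blast
  have e1u: "\<forall>\<^sub>F \<mu> in param_nhds m. cmod (e1 \<mu>) = 1" using e1(3) by eventually_elim simp
  obtain e where e: "smooth_germ m e" "e (\<lambda>_. 0) = 1" "\<forall>\<^sub>F \<mu> in param_nhds m. cmod (e \<mu>) = 1 \<and> e \<mu> ^ 2 = e1 \<mu>"
    using unit_sqrt[OF e1(1,2) e1u] by blast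
  have e4: "\<forall>\<^sub>F \<mu> in param_nhds m. cmod (e \<mu>) = 1 \<and> e \<mu> ^ 4 = E \<mu>"
    using e1(3) e(3)
  proof eventually_elim
    case (elim \<mu>)
    have "e \<mu> ^ 4 = (e \<mu> ^ 2) ^ 2" by (simp flip: power_mult)
    then show ?case using elim by simp
  qed
  define \<delta> where "\<delta> \<mu> = (k / 4) * (r \<mu> - 3) / w \<mu>" for \<mu>
  have \<delta>: "smooth_germ m \<delta>" "\<delta> (\<lambda>_. 0) = 0"
    unfolding \<delta>_def[abs_def] using w r by (auto intro!: sg_divide sg_mult sg_diff sg_const)
  define a where "a \<mu> = (\<i> * of_real k / 4) * (cnj (E \<mu>) * l0 \<mu> + of_real (4 * \<delta> \<mu> / k * quad0 (l0 \<mu>) (l1 \<mu>)))" for \<mu>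
  have a0: "a (\<lambda>_. 0) = 0" unfolding a_def by (simp add: l \<delta>)
  have a: "smooth_germ m a"
    unfolding a_def[abs_def] by (intro sg_mult sg_const sg_add sg_cnj E l sg_of_real sg_divide \<delta> bs) (rule k)
  define v where "v \<mu> = E \<mu> * of_real (4 * \<delta> \<mu> / k * inverse (1 - (cmod (l1 \<mu>))\<^sup>2))" for \<mu>
  have v0: "v (\<lambda>_. 0) = 0" unfolding v_def by (simp add: \<delta>)
  have v: "smooth_germ m v"
    unfolding v_def[abs_def] by (intro sg_mult sg_const E sg_of_real sg_divide \<delta> k sg_inverse sg_diff sg_cmod2 l) (simp add: l)
  define \<Lambda> where "\<Lambda> \<mu> = (\<lambda>i::nat. if i = 0 then Re (a \<mu>) else if i = 1 then Im (a \<mu>) else if i = 2 then \<delta> \<mu> else 0)" for \<mu> :: "nat \<Rightarrow> real"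
  have l1ne: "\<forall>\<^sub>F \<mu> in param_nhds m. (cmod (l1 \<mu>))\<^sup>2 \<noteq> 1"
    by (rule sg_eventually_ne[OF sg_cmod2[OF l(2)]]) (simp add: l)
  have wne: "\<forall>\<^sub>F \<mu> in param_nhds m. w \<mu> \<noteq> 0" by (rule sg_eventually_ne[OF w(1)]) (simp add: w)
  \<comment> \<open>the multiplier relating the rotated \<open>G\<^sub>4\<close> to the model, and its inverse\<close>
  define s' where "s' p = - v (par p) * cnj (l0 (par p) + l1 (par p) * of_real (nsq p))" for p
  define t' where "t' p = v (par p) * cnj (zc p) ^ 2" for p
  have s't': "smooth_germ ?n s'" "smooth_germ ?n t'"
    unfolding s'_def[abs_def] t'_def[abs_def]
    by (intro sg_mult sg_minus sg_cnj sg_add sg_power sg_of_real sg_par v l sg_nsq sg_zc)+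
  have par0: "par (\<lambda>_. 0) = (\<lambda>_. 0)" by (simp add: par_def)
  define \<Delta> where "\<Delta> p = (cmod (1 + s' p))\<^sup>2 - (cmod (t' p))\<^sup>2" for p
  have "smooth_germ ?n \<Delta>"
    unfolding \<Delta>_def[abs_def] by (intro sg_diff sg_cmod2 sg_add sg_const s't')
  then have \<Delta>: "smooth_germ ?n \<Delta>" "\<Delta> (\<lambda>_. 0) = 1" by (simp_all add: \<Delta>_def s'_def t'_def par0 v0)
  define d where "d p = complex_of_real (inverse (\<Delta> p))" for p
  have d: "smooth_germ ?n d" unfolding d_def[abs_def] by (intro sg_of_real sg_inverse \<Delta>) (simp add: \<Delta>)
  define \<alpha> where "\<alpha> p = cnj (1 + s' p) * d p" for p
  define \<beta> where "\<beta> p = - t' p * d p" for p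
  have \<alpha>\<beta>: "smooth_germ ?n \<alpha>" "smooth_germ ?n \<beta>"
    unfolding \<alpha>_def[abs_def] \<beta>_def[abs_def] by (intro sg_mult sg_cnj sg_add sg_minus sg_const s't' d)+
  define \<sigma>S where "\<sigma>S p = ((1 + s p) * \<alpha> p + t p * cnj (\<beta> p)) * e (par p) ^ 3" for p
  define \<tau>S where "\<tau>S p = - ((1 + s p) * \<beta> p + t p * cnj (\<alpha> p)) * cnj (e (par p)) ^ 3" for p
  have S: "smooth_germ ?n \<sigma>S" "smooth_germ ?n \<tau>S"
    unfolding \<sigma>S_def[abs_def] \<tau>S_def[abs_def]
    by (intro sg_mult sg_add sg_minus sg_cnj sg_power sg_const \<alpha>\<beta> st sg_par e)+
  have s'r: "s' (rot p) = s' p" "t' (rot p) = - t' p" for p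
    by (simp_all add: s'_def t'_def power_mult_distrib)
  then have dr: "d (rot p) = d p" for p by (simp add: d_def \<Delta>_def)
  have Sr: "\<sigma>S (rot p) = \<sigma>S p" "\<tau>S (rot p) = - \<tau>S p" for p
    by (simp_all add: \<sigma>S_def \<tau>S_def \<alpha>_def \<beta>_def s'r dr st algebra_simps)
  have S0: "\<sigma>S (join x (\<lambda>_. 0)) = 1" "\<tau>S (join x (\<lambda>_. 0)) = 0" for x
  proof -
    have "join x (\<lambda>_. 0) i = 0" if "i \<ge> 2" for i using that by (simp add: join_def)
    then have "s (join x (\<lambda>_. 0)) = 0" "t (join x (\<lambda>_. 0)) = 0" using st0 by blast+
    then show "\<sigma>S (join x (\<lambda>_. 0)) = 1" "\<tau>S (join x (\<lambda>_. 0)) = 0"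
      by (simp_all add: \<sigma>S_def \<tau>S_def \<alpha>_def \<beta>_def s'_def t'_def d_def \<Delta>_def v0 e)
  qed
  define SS where "SS x \<mu> = mat2 (\<sigma>S (join x \<mu>)) (\<tau>S (join x \<mu>))" for x \<mu>
  define XX where "XX x \<mu> = ofC (e \<mu> * toC x)" for x \<mu>
  have main: "\<forall>\<^sub>F p in param_nhds ?n. H (pt p) (par p) = SS (pt p) (par p) *v
      G4 k (XX (pt p) (par p)) (\<Lambda> (par p) 0) (\<Lambda> (par p) 1) (\<Lambda> (par p) 2)"
    using red eventually_par[OF e4] eventually_par[OF Er] eventually_par[OF l1ne] eventually_par[OF wne]
      sg_eventually_ne[OF \<Delta>(1), of 0, unfolded \<Delta>(2), OF one_neq_zero]
  proof eventually_elim
    case (elim p)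
    define \<mu> where "\<mu> = par p"
    define z where "z = zc p"
    define y where "y = toC (G4 k (ofC (e \<mu> * z)) (Re (a \<mu>)) (Im (a \<mu>)) (\<delta> \<mu>))"
    define G where "G = model (l0 \<mu>) (l1 \<mu>) z"
    have c: "cinv k (nsq p) \<noteq> 0" unfolding nsq_cmod by (rule cinv_props(1)[OF k])
    have "cinv k ((cmod z)\<^sup>2) * e \<mu> ^ 3 * toC (G4 k (ofC (e \<mu> * z)) (Re (a \<mu>)) (Im (a \<mu>)) (\<delta> \<mu>))
       = (1 - v \<mu> * cnj (l0 \<mu> + l1 \<mu> * (z * cnj z))) * G + v \<mu> * cnj z ^ 2 * cnj G"
      unfolding a_def \<delta>_def w_def r_def v_def G_def
      by (rule G4_as_model) (use k elim in \<open>simp_all add: \<mu>_def w_def r_def\<close>)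
    moreover have "s' p = - v \<mu> * cnj (l0 \<mu> + l1 \<mu> * (z * cnj z))" "t' p = v \<mu> * cnj z ^ 2"
      by (simp_all only: s'_def t'_def nsq_zc \<mu>_def z_def)
    moreover have "nsq p = (cmod z)\<^sup>2" by (simp only: nsq_cmod z_def)
    ultimately have g: "cinv k (nsq p) * e \<mu> ^ 3 * y = (1 + s' p) * G + t' p * cnj G"
      unfolding y_def by simp
    have hh: "cinv k (nsq p) * toC (H (pt p) (par p)) = (1 + s p) * G + t p * cnj G"
      using elim(1) by (simp add: h_def G_def \<mu>_def z_def)
    have "toC (H (pt p) (par p)) = \<sigma>S p * y + \<tau>S p * cnj y"
      using combine_multipliers[OF c cinv_props(2) hh g elim(6)[unfolded \<Delta>_def]]
      unfolding \<sigma>S_def \<tau>S_def \<alpha>_def \<beta>_def d_def \<Delta>_def \<mu>_def[symmetric] .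
    then show ?case
      by (intro toC_inj) (simp add: toC_mat2 SS_def XX_def y_def \<mu>_def z_def \<Lambda>_def)
  qed
  have jr: "join (pt (rot p)) (par p) = rot p" for p
    using join_pt_par[of "rot p"] by (simp only: par_rot)
  show ?thesis
    unfolding factors_through_def
  proof (intro exI conjI)
    show "smooth_family_germ m SS" unfolding smooth_family_germ_alt SS_def join_pt_par by (rule sg_mat2[OF S])
    show "equivariant_matrix_family m SS"
      by (rule equivariant_matrix_familyI, rule always_eventually) (simp only: SS_def jr join_pt_par Sr mat2_R4, simp)
    show "\<forall>\<^sub>F x in nhds 0. SS x (\<lambda>_. 0) = mat 1"
      by (rule always_eventually) (simp add: SS_def S0 mat2_id)
    show "smooth_family_germ m XX" unfolding smooth_family_germ_alt XX_def toC_pt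
      by (intro sg_ofC sg_mult sg_zc sg_par[OF e(1)])
    show "equivariant_family m XX" unfolding equivariant_family_iff
      by (rule always_eventually) (simp add: XX_def algebra_simps)
    show "\<forall>\<^sub>F x in nhds 0. XX x (\<lambda>_. 0) = x"
      by (rule always_eventually) (simp add: XX_def e)
    show "smooth_param_map_germ m 3 \<Lambda>"
      unfolding smooth_param_map_germ_def
    proof (intro conjI allI impI)
      show "\<forall>\<^sub>F \<mu> in param_nhds m. \<Lambda> \<mu> \<in> topspace (Euclidean_space 3)"
        by (rule always_eventually) (auto simp: topspace_E \<Lambda>_def)
      show "smooth_germ m (\<lambda>\<mu>. \<Lambda> \<mu> i)" for i
        unfolding \<Lambda>_def by (cases "i = 0"; cases "i = 1"; cases "i = 2") (simp_all add: sg_Re sg_Im a \<delta> sg_const)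
    qed
    show "\<Lambda> (\<lambda>_. 0) = (\<lambda>_. 0)" by (auto simp: \<Lambda>_def a0 \<delta>)
    show "\<forall>\<^sub>F (x, \<mu>) in family_nhds m. H x \<mu> = SS x \<mu> *v G4 k (XX x \<mu>) (\<Lambda> \<mu> 0) (\<Lambda> \<mu> 1) (\<Lambda> \<mu> 2)"
      unfolding eventually_family_nhds using main by simp
  qed
qed

section \<open>Minimality of the number of parameters\<close>

lemma sg_partial:
  assumes "smooth_germ n f" "i < n"
  obtains D where "smooth_germ n D"
    "\<forall>\<^sub>F p in param_nhds n. has_partial f i (D p) p"
proof -
  obtain e where e: "e > 0" "smooth_cube n e f" using assms(1) sg_cube by blast
  obtain D where D: "\<And>i p. i < n \<Longrightarrow> p \<in> cube n e \<Longrightarrow> has_partial f i (D i p) p"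
    "\<And>i. i < n \<Longrightarrow> smooth_cube n e (D i)" using smooth_cube_partials[OF e(2)] by metis
  show ?thesis
    by (rule that[OF sgI[OF e(1) D(2)[OF assms(2)]]])
       (use D(1)[OF assms(2)] e(1) in \<open>auto simp: eventually_param_nhds\<close>)
qed

lemma directional_derivative:
  assumes "smooth_germ n f"
  shows "\<exists>L. \<forall>v. ((\<lambda>t. f (tup n (\<lambda>j. v j * t))) has_vector_derivative (\<Sum>j<n. v j *\<^sub>R L j)) (at (0::real))"
proof -
  obtain e where e: "e > 0" "smooth_cube n e f" using assms(1) sg_cube by blast
  obtain D where D: "\<And>i p. i < n \<Longrightarrow> p \<in> cube n e \<Longrightarrow> has_partial f i (D i p) p"
    "\<And>i. i < n \<Longrightarrow> smooth_cube n e (D i)" using smooth_cube_partials[OF e(2)] by metis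
  have z: "tup n (\<lambda>j. v j * 0) = (\<lambda>_. 0)" for v by (auto simp: tup_def)
  have "((\<lambda>t. f (tup n (\<lambda>j. v j * t))) has_vector_derivative (\<Sum>j<n. v j *\<^sub>R D j (tup n (\<lambda>j. v j * 0)))) (at (0::real))" for v
  proof (rule chain_curve[OF D(1)])
    show "continuous_on (cube n e) (D i)" if "i < n" for i by (rule smooth_cube_cont[OF D(2)[OF that]])
    show "((\<lambda>t. v i * t) has_vector_derivative v i) (at 0)" for i by (auto intro!: derivative_eq_intros)
    show "tup n (\<lambda>j. v j * 0) \<in> cube n e" unfolding z by (rule zero_in_cube[OF e(1)])
  qed
  then show ?thesis unfolding z by (intro exI[of _ "\<lambda>j. D j (\<lambda>_. 0)"]) blast
qed

text \<open>
  Used for the differential of a parameter map into at most two dimensions.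
\<close>

lemma two_equations_three_unknowns:
  fixes a b :: "nat \<Rightarrow> real"
  obtains v where "v 0 \<noteq> 0 \<or> v 1 \<noteq> 0 \<or> v 2 \<noteq> 0" "(\<Sum>j<3. v j * a j) = 0" "(\<Sum>j<3. v j * b j) = 0"
proof -
  define A B where "A = (vector [a 0, a 1, a 2] :: real^3)" and "B = (vector [b 0, b 1, b 2] :: real^3)"
  have "dim {A, B} \<le> card {A, B}" by (rule dim_le_card') simp
  also have "\<dots> \<le> 2" by (simp add: card_insert_if)
  finally have "dim {A, B} < DIM(real^3)" by simp
  then obtain x where x: "x \<noteq> 0" "\<And>y. y \<in> span {A, B} \<Longrightarrow> orthogonal x y"
    using orthogonal_to_subspace_exists by blast
  have "orthogonal x A" "orthogonal x B" by (intro x(2) span_base; simp)+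
  then have o: "x $ 1 * a 0 + x $ 2 * a 1 + x $ 3 * a 2 = 0" "x $ 1 * b 0 + x $ 2 * b 1 + x $ 3 * b 2 = 0"
    by (simp_all add: orthogonal_def inner_vec_def sum_3 A_def B_def)
  have ne: "x $ 1 \<noteq> 0 \<or> x $ 2 \<noteq> 0 \<or> x $ 3 \<noteq> 0" using x(1) by (auto simp: vec_eq_iff forall_3)
  define v where "v j = (if j = 0 then x $ 1 else if j = 1 then x $ 2 else x $ 3)" for j :: nat
  have s: "(\<Sum>j<3. f j) = f 0 + f 1 + f 2" for f :: "nat \<Rightarrow> real" by (simp add: eval_nat_numeral)
  show ?thesis by (rule that[of v]) (use o ne in \<open>simp_all add: s v_def\<close>)
qed

definition den_inv :: "real \<Rightarrow> real \<Rightarrow> real" where "den_inv x y = inverse (1 + x\<^sup>2 + y\<^sup>2)"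

lemma fden: "1 + x\<^sup>2 + y\<^sup>2 \<noteq> (0::real)"
  by (metis add.assoc add_pos_nonneg less_numeral_extra(3) sum_power2_ge_zero zero_less_one)

lemma F4_nth:
  "F4 k (vector [x, y]) $ 1 = - (k * y ^ 3 * den_inv x y)" "F4 k (vector [x, y]) $ 2 = k * x ^ 3 * den_inv x y"
  by (simp_all add: F4_def Let_def den_inv_def divide_inverse)

lemma den_inv_deriv:
  "((\<lambda>t. den_inv t y) has_real_derivative - (2 * x * (den_inv x y)\<^sup>2)) (at x)"
  "((\<lambda>t. den_inv x t) has_real_derivative - (2 * y * (den_inv x y)\<^sup>2)) (at y)"
  unfolding den_inv_def
  by (auto intro!: derivative_eq_intros simp: fden fden[unfolded power2_eq_square] power2_eq_square)

lemma F4_partials: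
  "((\<lambda>t. F4 k (vector [t, y]) $ 1) has_real_derivative 2 * k * x * y ^ 3 * (den_inv x y)\<^sup>2) (at x)"
  "((\<lambda>t. F4 k (vector [t, y]) $ 2) has_real_derivative 3 * k * x\<^sup>2 * den_inv x y - 2 * k * x ^ 4 * (den_inv x y)\<^sup>2) (at x)"
  "((\<lambda>t. F4 k (vector [x, t]) $ 1) has_real_derivative - (3 * k * y\<^sup>2 * den_inv x y) + 2 * k * y ^ 4 * (den_inv x y)\<^sup>2) (at y)"
  "((\<lambda>t. F4 k (vector [x, t]) $ 2) has_real_derivative - (2 * k * x ^ 3 * y * (den_inv x y)\<^sup>2)) (at y)"
  unfolding F4_nth
  by (auto intro!: derivative_eq_intros den_inv_deriv simp: power2_eq_square power3_eq_cube power4_eq_xxxx algebra_simps)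

lemma nth_derivative_unique:
  fixes f :: "real \<Rightarrow> real^'n"
  assumes "(f has_vector_derivative D) (at x)" "((\<lambda>t. f t $ i) has_real_derivative d) (at x)"
  shows "D $ i = d"
  by (rule vector_derivative_unique_at[OF bounded_linear.has_vector_derivative[OF bounded_linear_vec_nth assms(1)]
        assms(2)[unfolded has_real_derivative_iff_has_vector_derivative]])

definition F4x :: "real \<Rightarrow> (nat \<Rightarrow> real) \<Rightarrow> real^2" where
  "F4x k q = (let x = q 0; y = q 1; w = den_inv x y in
     vector [2 * k * x * y ^ 3 * w\<^sup>2, 3 * k * x\<^sup>2 * w - 2 * k * x ^ 4 * w\<^sup>2])"

definition F4y :: "real \<Rightarrow> (nat \<Rightarrow> real) \<Rightarrow> real^2" where
  "F4y k q = (let x = q 0; y = q 1; w = den_inv x y in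
     vector [- (3 * k * y\<^sup>2 * w) + 2 * k * y ^ 4 * w\<^sup>2, - (2 * k * x ^ 3 * y * w\<^sup>2)])"

lemma F4_partial_vectors:
  "((\<lambda>t. F4 k (vector [t, q 1])) has_vector_derivative D) (at (q 0)) \<Longrightarrow> D = F4x k q"
  "((\<lambda>t. F4 k (vector [q 0, t])) has_vector_derivative D) (at (q 1)) \<Longrightarrow> D = F4y k q"
  unfolding vec_eq_iff forall_2 F4x_def F4y_def Let_def
  by (simp_all add: nth_derivative_unique[OF _ F4_partials(1)] nth_derivative_unique[OF _ F4_partials(2)]
      nth_derivative_unique[OF _ F4_partials(3)] nth_derivative_unique[OF _ F4_partials(4)] del: One_nat_def)

lemma bounded_bilinear_matrix_vector: "bounded_bilinear ((*v) :: real^2^2 \<Rightarrow> real^2 \<Rightarrow> real^2)"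
  by (simp add: bilinear_conv_bounded_bilinear[symmetric] bilinear_def linear_iff matrix_vector_right_distrib
      matrix_vector_mult_add_rdistrib matrix_vector_mult_scaleR scaleR_matrix_vector_assoc)

definition line_pt :: "(nat \<Rightarrow> real) \<Rightarrow> real \<Rightarrow> nat \<Rightarrow> real" where
  "line_pt v t = tup 3 (\<lambda>j. v j * t)"

text \<open>
  Along a direction v in which the differential of the parameter map vanishes, G contributes to the
  derivative of the factorisation only through its values and space derivatives at zero parameters,
  and these are \<open>F\<^sub>4\<close> and its derivatives. X1 and X2 are the components of the derivative of the
  change of coordinates, A that of the matrix; X1 vanishes at 0 because an equivariant change of
  coordinates fixes the origin for all parameters.
\<close>

lemma infinitesimal_factorisation:
  assumes G: "Z4_unfolding l (F4 k) G"
    and fac: "factors_through 3 (\<lambda>v p. G4 k v (p 0) (p 1) (p 2)) l G" and l: "l < 3"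
  obtains v :: "nat \<Rightarrow> real" and A X1 X2 where
    "v 0 \<noteq> 0 \<or> v 1 \<noteq> 0 \<or> v 2 \<noteq> 0"
    "smooth_germ 3 A" "smooth_germ 3 X1" "smooth_germ 3 X2" "X1 (\<lambda>_. 0) = 0"
    "\<forall>\<^sub>F q in param_nhds 3. q 2 = 0 \<longrightarrow>
      v 0 *\<^sub>R pt q + (v 1 + v 2 * nsq q) *\<^sub>R pt (rot q) = A q *v F4 k (pt q) + X1 q *\<^sub>R F4x k q + X2 q *\<^sub>R F4y k q"
proof -
  obtain S X \<Lambda> where Ss: "smooth_germ (3 + 2) (\<lambda>p. S (pt p) (par p))"
    and S0: "\<forall>\<^sub>F x in nhds 0. S x (\<lambda>_. 0) = mat 1"
    and Xs: "smooth_germ (3 + 2) (\<lambda>p. X (pt p) (par p))"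
    and Xe: "\<forall>\<^sub>F p in param_nhds (3 + 2). toC (X (pt (rot p)) (par p)) = \<i> * toC (X (pt p) (par p))"
    and X0: "\<forall>\<^sub>F x in nhds 0. X x (\<lambda>_. 0) = x"
    and Lt: "\<forall>\<^sub>F \<mu> in param_nhds 3. \<Lambda> \<mu> \<in> topspace (Euclidean_space l)"
    and Ls: "\<And>i. i < l \<Longrightarrow> smooth_germ 3 (\<lambda>\<mu>. \<Lambda> \<mu> i)"
    and L0: "\<Lambda> (\<lambda>_. 0) = (\<lambda>_. 0)"
    and id: "\<forall>\<^sub>F p in param_nhds (3 + 2). G4 k (pt p) (par p 0) (par p 1) (par p 2) = S (pt p) (par p) *v G (X (pt p) (par p)) (\<Lambda> (par p))"
    using fac unfolding factors_through_def smooth_family_germ_alt equivariant_family_iff smooth_param_map_germ_def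
      eventually_family_nhds prod.case by blast
  have Gs: "smooth_germ (l + 2) (\<lambda>p. G (pt p) (par p))" using G by (simp only: Z4_unfolding_def smooth_family_germ_alt)
  have G0: "\<forall>\<^sub>F x in nhds 0. G x (\<lambda>_. 0) = F4 k x" using G by (simp only: Z4_unfolding_def)
  \<comment> \<open>a direction in which the parameter map is stationary\<close>
  have "\<exists>M. \<forall>v. ((\<lambda>t. \<Lambda> (line_pt v t) i) has_vector_derivative (\<Sum>j<3. v j *\<^sub>R M j)) (at 0)" if "i < l" for i
    using directional_derivative[OF Ls[OF that]] by (simp only: line_pt_def)
  then obtain M where M: "\<And>i v. i < l \<Longrightarrow> ((\<lambda>t. \<Lambda> (line_pt v t) i) has_vector_derivative (\<Sum>j<3. v j *\<^sub>R M i j)) (at 0)" by metis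
  define r where "r i j = (if i < l then M i j else 0)" for i j
  obtain v where v: "v 0 \<noteq> 0 \<or> v 1 \<noteq> 0 \<or> v 2 \<noteq> 0" "(\<Sum>j<3. v j * r 0 j) = 0" "(\<Sum>j<3. v j * r 1 j) = 0"
    by (rule two_equations_three_unknowns)
  have stat: "((\<lambda>t. \<Lambda> (line_pt v t) i) has_vector_derivative 0) (at 0)" if i: "i < l" for i
  proof -
    have "i = 0 \<or> i = 1" using i l by auto
    then have "(\<Sum>j<3. v j *\<^sub>R M i j) = 0" using v(2,3) i by (auto simp: r_def)
    then show ?thesis using M[OF i, of v] by simp
  qed
  \<comment> \<open>the coordinate with index 2 of q runs along that direction\<close>
  define lift where "lift q = tup (3 + 2) (\<lambda>i. if i < 2 then q i else v (i - 2) * q 2)" for q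
  define lc where "lc i = (if i < 2 then (\<lambda>q. q i) else (\<lambda>q::nat\<Rightarrow>real. v (i - 2) * q 2))" for i :: nat
  have lc: "smooth_germ 3 (lc i)" "lc i (\<lambda>_. 0) = 0" for i by (auto simp: lc_def intro: sg_proj sg_mult sg_const)
  have lift_alt: "lift q = tup (3 + 2) (\<lambda>i. lc i q)" for q by (auto simp: lift_def lc_def tup_def fun_eq_iff)
  have lift_pt: "pt (lift q) = pt q" for q by (simp add: lift_def pt_def tup_def)
  have lift_par: "par (lift q) = line_pt v (q 2)" for q by (auto simp: lift_def par_def line_pt_def tup_def fun_eq_iff)
  have lift_ev: "\<forall>\<^sub>F q in param_nhds 3. P (lift q)" if "eventually P (param_nhds (3 + 2))" for P
    unfolding lift_alt by (rule eventually_tup[OF that lc])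
  have lift_sg: "smooth_germ 3 (\<lambda>q. F (lift q))" if "smooth_germ (3 + 2) F" for F :: "_ \<Rightarrow> 'c::real_normed_vector"
    unfolding lift_alt by (rule sg_comp[OF that lc])
  define Sc where "Sc q = S (pt q) (line_pt v (q 2))" for q
  define Xc where "Xc i q = X (pt q) (line_pt v (q 2)) $ i" for i q
  have Sc: "smooth_germ 3 Sc"
    using lift_sg[OF Ss] by (simp only: lift_pt lift_par Sc_def[abs_def])
  have Xc: "smooth_germ 3 (Xc i)" for i
    using sg_linear[OF bounded_linear_vec_nth lift_sg[OF Xs], of i] by (simp only: lift_pt lift_par Xc_def[abs_def])
  define c where "c i = (if i = 0 then Xc 1 else if i = 1 then Xc 2 else (\<lambda>q. \<Lambda> (line_pt v (q 2)) (i - 2)))" for i :: nat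
  have line_pt_0: "line_pt v 0 = (\<lambda>_. 0)" by (auto simp: line_pt_def tup_def)
  have X00: "X 0 (\<lambda>_. 0) = 0" using eventually_nhds_x_imp_x[OF X0] .
  have pt0: "pt (\<lambda>_. 0) = 0" by (simp add: pt_def vec_eq_iff forall_2)
  have c_sg: "smooth_germ 3 (c i)" if "i < l + 2" for i
  proof -
    have "smooth_germ 3 (\<lambda>q. \<Lambda> (line_pt v (q 2)) (i - 2))" if "i \<ge> 2"
    proof -
      have "i - 2 < l" using that \<open>i < l + 2\<close> by auto
      from Ls[OF this] show ?thesis
        unfolding line_pt_def by (rule sg_comp) (auto intro: sg_mult sg_const sg_proj)
    qed
    then show ?thesis using Xc by (auto simp: c_def)
  qed
  have c_0: "c i (\<lambda>_. 0) = 0" for i by (auto simp: c_def Xc_def line_pt_0 pt0 X00 L0)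
  define \<gamma> where "\<gamma> q = tup (l + 2) (\<lambda>i. c i q)" for q
  have \<gamma>_pt: "pt (\<gamma> q) = X (pt q) (line_pt v (q 2))" for q
    by (simp add: \<gamma>_def pt_def tup_def c_def Xc_def vec_eq_iff forall_2)
  have line_pt_ev: "\<forall>\<^sub>F q in param_nhds 3. P (line_pt v (q 2))" if "eventually P (param_nhds 3)" for P
    unfolding line_pt_def by (rule eventually_tup[OF that]) (auto intro: sg_mult sg_const sg_proj)
  have \<gamma>_par: "\<forall>\<^sub>F q in param_nhds 3. par (\<gamma> q) = \<Lambda> (line_pt v (q 2))"
    using line_pt_ev[OF Lt] by eventually_elim (auto simp: topspace_E \<gamma>_def par_def tup_def c_def fun_eq_iff)
  define g where "g p = G (pt p) (par p)" for p
  have id': "\<forall>\<^sub>F q in param_nhds 3. G4 k (pt q) (v 0 * q 2) (v 1 * q 2) (v 2 * q 2) = Sc q *v g (\<gamma> q)"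
    using lift_ev[OF id] \<gamma>_par
    by eventually_elim (simp add: lift_pt lift_par g_def \<gamma>_pt Sc_def, simp add: line_pt_def tup_def)
  obtain e where e: "e > 0" "smooth_cube (l + 2) e g" using Gs sg_cube unfolding g_def by blast
  obtain D where D: "\<And>i p. i < l + 2 \<Longrightarrow> p \<in> cube (l + 2) e \<Longrightarrow> has_partial g i (D i p) p"
    "\<And>i. i < l + 2 \<Longrightarrow> smooth_cube (l + 2) e (D i)" using smooth_cube_partials[OF e(2)] by metis
  have two: "(2::nat) < 3" by simp
  obtain A where A: "smooth_germ 3 A" "\<forall>\<^sub>F q in param_nhds 3. has_partial Sc 2 (A q) q"
    by (rule sg_partial[OF Sc two])
  obtain X1 where X1: "smooth_germ 3 X1" "\<forall>\<^sub>F q in param_nhds 3. has_partial (Xc 1) 2 (X1 q) q"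
    by (rule sg_partial[OF Xc two])
  obtain X2 where X2: "smooth_germ 3 X2" "\<forall>\<^sub>F q in param_nhds 3. has_partial (Xc 2) 2 (X2 q) q"
    by (rule sg_partial[OF Xc two])
  have X1_0: "X1 (\<lambda>_. 0) = 0"
  proof -
    obtain d where d: "d > 0" "\<forall>q\<in>cube 3 d. toC (X (pt (rot (lift q))) (par (lift q))) = \<i> * toC (X (pt (lift q)) (par (lift q)))"
      using lift_ev[OF Xe] by (auto simp: eventually_param_nhds)
    have z: "Xc 1 ((\<lambda>_. 0)(2 := t)) = 0" if "t \<in> {-d<..<d}" for t
    proof -
      define q where "q = (\<lambda>_::nat. 0::real)(2 := t)"
      have q: "q \<in> cube 3 d" using that d(1) by (auto simp: q_def cube_def abs_less_iff)
      have "pt (rot (lift q)) = 0" "pt (lift q) = 0"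
        by (simp_all add: pt_def rot_def lift_def tup_def q_def vec_eq_iff forall_2)
      then have "toC (X 0 (line_pt v t)) = \<i> * toC (X 0 (line_pt v t))" using d(2) q by (metis lift_par q_def fun_upd_same)
      then have "(1 - \<i>) * toC (X 0 (line_pt v t)) = 0" by (simp add: algebra_simps)
      moreover have "1 - \<i> \<noteq> 0" by (simp add: complex_eq_iff)
      ultimately have "toC (X 0 (line_pt v t)) = 0" by simp
      then show ?thesis using \<open>pt (lift q) = 0\<close> unfolding lift_pt q_def[symmetric]
        by (simp add: Xc_def toC_def complex_eq_iff) (simp add: q_def)
    qed
    have "((\<lambda>t. Xc 1 ((\<lambda>_. 0)(2 := t))) has_vector_derivative X1 (\<lambda>_. 0)) (at 0)" using param_nhds_at_0[OF X1(2)] by simp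
    moreover have "((\<lambda>t. Xc 1 ((\<lambda>_. 0)(2 := t))) has_vector_derivative 0) (at 0)"
      by (rule has_vector_derivative_transform_within_open[OF has_vector_derivative_const, of "{-d<..<d}"]) (use d(1) z in auto)
    ultimately show ?thesis using vector_derivative_unique_at by metis
  qed
  have \<gamma>_in: "\<forall>\<^sub>F q in param_nhds 3. \<gamma> q \<in> cube (l + 2) e"
    unfolding \<gamma>_def by (rule eventually_tup[OF eventually_in_cube[OF e(1)] c_sg c_0])
  obtain d0 where d0: "d0 > 0" "\<forall>q\<in>cube 3 d0. G4 k (pt q) (v 0 * q 2) (v 1 * q 2) (v 2 * q 2) = Sc q *v g (\<gamma> q)"
    using id' by (auto simp: eventually_param_nhds)
  have pt_ev: "\<forall>\<^sub>F q in param_nhds 3. P (pt q)" if "eventually P (nhds (0::real^2))" for P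
    using eventually_pt[OF that, of 1] by (simp add: eval_nat_numeral)
  obtain d1 where d1: "d1 > 0" "\<forall>q\<in>cube 3 d1. G (pt q) (\<lambda>_. 0) = F4 k (pt q)"
    using pt_ev[OF G0] by (auto simp: eventually_param_nhds)
  have "\<forall>\<^sub>F q in param_nhds 3. q 2 = 0 \<longrightarrow>
      v 0 *\<^sub>R pt q + (v 1 + v 2 * nsq q) *\<^sub>R pt (rot q) = A q *v F4 k (pt q) + X1 q *\<^sub>R F4x k q + X2 q *\<^sub>R F4y k q"
    using A(2) X1(2) X2(2) \<gamma>_in \<gamma>_par
      pt_ev[OF X0] pt_ev[OF S0] eventually_in_cube[OF d0(1), of 3] eventually_in_cube[OF d1(1), of 3]
  proof eventually_elim
    case (elim q)
    show ?case
    proof (rule impI)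
      assume q2: "q 2 = 0"
      have qq: "q(2 := 0) = q" using q2 by auto
      have line_pt_q: "line_pt v (q 2) = (\<lambda>_. 0)" by (simp add: q2 line_pt_0)
      have Aq: "((\<lambda>t. Sc (q(2 := t))) has_vector_derivative A q) (at 0)" using elim(1) q2 by simp
      have ptq: "pt (q(2 := t)) = pt q" for t by (simp add: pt_def)
      have \<gamma>q: "pt (\<gamma> q) = pt q" "par (\<gamma> q) = (\<lambda>_. 0)"
        using elim(6) elim(5) by (simp_all add: \<gamma>_pt line_pt_q L0)
      have gq: "g (\<gamma> q) = F4 k (pt q)" using d1(2) elim(9) by (simp add: g_def \<gamma>q)
      have \<gamma>01: "\<gamma> q 0 = q 0" "\<gamma> q 1 = q 1" using \<gamma>q(1) by (auto simp: pt_def vec_eq_iff forall_2)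
      \<comment> \<open>near zero parameters the space derivatives of g are those of \<open>F\<^sub>4\<close>\<close>
      have part: "((\<lambda>t. F4 k (if i = 0 then vector [t, q 1] else vector [q 0, t])) has_vector_derivative D i (\<gamma> q)) (at (q i))"
        if i: "i = 0 \<or> i = 1" for i
      proof -
        have i2: "i < l + 2" "i < 3" using i by auto
        have "((\<lambda>t. g ((\<gamma> q)(i := t))) has_vector_derivative D i (\<gamma> q)) (at (q i))"
          using D(1)[OF i2(1) elim(4)] i \<gamma>01 by auto
        then show ?thesis
        proof (rule has_vector_derivative_transform_within_open[of _ _ _ "{-d1<..<d1}"])
          show "q i \<in> {-d1<..<d1}" using elim(9) i2 by (auto simp: cube_def abs_less_iff)
          fix t assume t: "t \<in> {-d1<..<d1}"
          have "q(i := t) \<in> cube 3 d1" using t elim(9) i2(2) by (simp add: cube_upd abs_less_iff)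
          then have "G (pt (q(i := t))) (\<lambda>_. 0) = F4 k (pt (q(i := t)))" using d1(2) by blast
          moreover have "pt ((\<gamma> q)(i := t)) = pt (q(i := t))" using i \<gamma>01 by (auto simp: pt_def)
          moreover have "par ((\<gamma> q)(i := t)) = (\<lambda>_. 0)" using i \<gamma>q(2) by (auto simp: par_def fun_eq_iff)
          moreover have "pt (q(i := t)) = (if i = 0 then vector [t, q 1] else vector [q 0, t])" using i by (auto simp: pt_def)
          ultimately show "g ((\<gamma> q)(i := t)) = F4 k (if i = 0 then vector [t, q 1] else vector [q 0, t])" by (simp add: g_def)
        qed auto
      qed
      \<comment> \<open>the parameter components of \<open>\<gamma>\<close> have derivative zero by the choice of v\<close>
      define c' where "c' i = (if i = 0 then X1 q else if i = 1 then X2 q else 0)" for i :: nat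
      have "((\<lambda>t. g (tup (l + 2) (\<lambda>i. c i (q(2 := t))))) has_vector_derivative
          (\<Sum>i<l + 2. c' i *\<^sub>R D i (tup (l + 2) (\<lambda>i. c i (q(2 := 0)))))) (at 0)"
      proof (rule chain_curve[OF D(1)])
        show "continuous_on (cube (l + 2) e) (D i)" if "i < l + 2" for i by (rule smooth_cube_cont[OF D(2)[OF that]])
        show "((\<lambda>t. c i (q(2 := t))) has_vector_derivative c' i) (at 0)" if "i < l + 2" for i
        proof -
          consider "i = 0" | "i = 1" | "i \<ge> 2" by linarith
          then show ?thesis
          proof cases
            case 3
            then have "i - 2 < l" using that by auto
            from stat[OF this] show ?thesis using 3 by (simp add: c_def c'_def)
          qed (use elim(2,3) q2 in \<open>simp_all add: c_def c'_def\<close>)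
        qed
        show "tup (l + 2) (\<lambda>i. c i (q(2 := 0))) \<in> cube (l + 2) e" using elim(4) by (simp add: qq \<gamma>_def)
      qed
      moreover have "(\<Sum>i<l + 2. c' i *\<^sub>R D i (\<gamma> q)) = X1 q *\<^sub>R D 0 (\<gamma> q) + X2 q *\<^sub>R D 1 (\<gamma> q)"
      proof -
        have "(\<Sum>i<l + 2. c' i *\<^sub>R D i (\<gamma> q)) = (\<Sum>i\<in>{0, 1}. c' i *\<^sub>R D i (\<gamma> q))"
          by (rule sum.mono_neutral_right) (auto simp: c'_def)
        then show ?thesis by (simp add: c'_def)
      qed
      ultimately have dg: "((\<lambda>t. g (\<gamma> (q(2 := t)))) has_vector_derivative X1 q *\<^sub>R D 0 (\<gamma> q) + X2 q *\<^sub>R D 1 (\<gamma> q)) (at 0)"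
        unfolding qq \<gamma>_def[symmetric] by simp
      have "((\<lambda>t. Sc (q(2 := t)) *v g (\<gamma> (q(2 := t)))) has_vector_derivative
          Sc (q(2 := 0)) *v (X1 q *\<^sub>R D 0 (\<gamma> q) + X2 q *\<^sub>R D 1 (\<gamma> q)) + A q *v g (\<gamma> (q(2 := 0)))) (at 0)"
        by (rule bounded_bilinear.has_vector_derivative[OF bounded_bilinear_matrix_vector Aq dg])
      moreover have "Sc q = mat 1" using elim(7) by (simp add: Sc_def line_pt_q)
      ultimately have da: "((\<lambda>t. Sc (q(2 := t)) *v g (\<gamma> (q(2 := t)))) has_vector_derivative
          (X1 q *\<^sub>R D 0 (\<gamma> q) + X2 q *\<^sub>R D 1 (\<gamma> q)) + A q *v F4 k (pt q)) (at 0)"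
        unfolding qq gq by simp
      have db: "((\<lambda>t. Sc (q(2 := t)) *v g (\<gamma> (q(2 := t)))) has_vector_derivative
           v 0 *\<^sub>R pt q + (v 1 + v 2 * nsq q) *\<^sub>R pt (rot q)) (at 0)"
      proof (rule has_vector_derivative_transform_within_open[of "\<lambda>t. G4 k (pt q) (v 0 * t) (v 1 * t) (v 2 * t)" _ _ "{-d0<..<d0}"])
        have "G4 k (pt q) (v 0 * t) (v 1 * t) (v 2 * t) = F4 k (pt q)
             + t *\<^sub>R (v 0 *\<^sub>R pt q + (v 1 + v 2 * nsq q) *\<^sub>R pt (rot q))" for t
          by (simp add: G4_def Let_def nsq_def vec_eq_iff forall_2 algebra_simps)
        then show "((\<lambda>t. G4 k (pt q) (v 0 * t) (v 1 * t) (v 2 * t)) has_vector_derivative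
             v 0 *\<^sub>R pt q + (v 1 + v 2 * nsq q) *\<^sub>R pt (rot q)) (at 0)"
          by (simp only:) (auto intro!: derivative_eq_intros)
        fix t assume t: "t \<in> {-d0<..<d0}"
        have "q(2 := t) \<in> cube 3 d0" using t elim(8) by (simp add: cube_upd abs_less_iff)
        from d0(2)[rule_format, OF this]
        show "G4 k (pt q) (v 0 * t) (v 1 * t) (v 2 * t) = Sc (q(2 := t)) *v g (\<gamma> (q(2 := t)))"
          by (simp add: ptq)
      qed (use d0(1) in auto)
      have "D 0 (\<gamma> q) = F4x k q" "D 1 (\<gamma> q) = F4y k q"
        using part[of 0] part[of 1] F4_partial_vectors by auto
      with vector_derivative_unique_at[OF db da]
      show "v 0 *\<^sub>R pt q + (v 1 + v 2 * nsq q) *\<^sub>R pt (rot q) = A q *v F4 k (pt q) + X1 q *\<^sub>R F4x k q + X2 q *\<^sub>R F4y k q"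
        by (simp add: add_ac)
    qed
  qed
  then show ?thesis using that[of v A X1 X2] v(1) A(1) X1(1) X2(1) X1_0 by blast
qed

text \<open>
  The tangent equation is evaluated on the rays \<open>y = c x\<close>. On the axis its first component gives
  \<open>v 0 = 0\<close>, and the second component at order one gives \<open>v 1 = 0\<close>. At order three the second
  component reads \<open>v 2 (1 + c\<^sup>2) = B0 c\<close>, and the right hand side, a cubic polynomial in c, has no term
  with \<open>c\<^sup>2\<close>; the values c = 0, 1, -1 suffice to conclude that \<open>v 2 = 0\<close>.
\<close>

lemma versal_needs_three_parameters:
  assumes k: "k \<noteq> 0" and G: "Z4_versal_unfolding l (F4 k) G"
  shows "3 \<le> l"
proof (rule ccontr)
  assume "\<not> 3 \<le> l"
  then have l: "l < 3" by simp
  have fac: "factors_through 3 (\<lambda>v p. G4 k v (p 0) (p 1) (p 2)) l G"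
    using G G4_unfolding by (simp add: Z4_versal_unfolding_def)
  have unf: "Z4_unfolding l (F4 k) G" using G by (simp add: Z4_versal_unfolding_def)
  obtain v :: "nat \<Rightarrow> real" and A X1 X2 where v: "v 0 \<noteq> 0 \<or> v 1 \<noteq> 0 \<or> v 2 \<noteq> 0"
    and A': "smooth_germ 3 A" and X: "smooth_germ 3 X1" "smooth_germ 3 X2" "X1 (\<lambda>_. 0) = 0"
    and E: "\<forall>\<^sub>F q in param_nhds 3. q 2 = 0 \<longrightarrow>
      v 0 *\<^sub>R pt q + (v 1 + v 2 * nsq q) *\<^sub>R pt (rot q) = A q *v F4 k (pt q) + X1 q *\<^sub>R F4x k q + X2 q *\<^sub>R F4y k q"
    by (rule infinitesimal_factorisation[OF unf fac l])
  have A: "smooth_germ 3 (\<lambda>q. A q $ i $ j)" for i j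
    by (rule sg_linear[OF bounded_linear_vec_nth sg_linear[OF bounded_linear_vec_nth A']])
  have i3: "0 < (3::nat)" "1 < (3::nat)" by auto
  obtain P where P: "smooth_germ 3 P" "\<forall>\<^sub>F q in param_nhds 3. X1 q - X1 (q(0 := 0)) = q 0 *\<^sub>R P q"
    using hadamard[OF X(1) i3(1)] by blast
  obtain Q where Q: "smooth_germ 3 Q" "\<forall>\<^sub>F q in param_nhds 3. X1 q - X1 (q(1 := 0)) = q 1 *\<^sub>R Q q"
    using hadamard[OF X(1) i3(2)] by blast
  have Q': "\<forall>\<^sub>F q in param_nhds 3. X1 (q(0 := 0)) - X1 (q(0 := 0, 1 := 0)) = q 1 *\<^sub>R Q (q(0 := 0))"
    using eventually_upd[OF Q(2) i3(1) sg_const[of _ 0]] by simp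
  have Q0: "smooth_germ 3 (\<lambda>q. Q (q(0 := 0)))" by (rule sg_upd[OF Q(1) i3(1) sg_const]) simp
  have X1_form: "\<forall>\<^sub>F q in param_nhds 3. q 2 = 0 \<longrightarrow> X1 q = q 0 * P q + q 1 * Q (q(0 := 0))"
    using P(2) Q' eventually_coord_0
  proof eventually_elim
    case (elim q)
    show ?case
    proof
      assume "q 2 = 0"
      have "(q(0 := 0, 1 := 0)) i = 0" for i
      proof -
        consider "i = 0" | "i = 1" | "i = 2" | "i \<ge> 3" by linarith
        then show ?thesis by cases (use \<open>q 2 = 0\<close> elim(3) in simp_all)
      qed
      then have "q(0 := 0, 1 := 0) = (\<lambda>_. 0)" by (rule ext)
      then show "X1 q = q 0 * P q + q 1 * Q (q(0 := 0))" using elim(1,2) X(3) by simp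
    qed
  qed
  define ray where "ray c x = tup 3 (\<lambda>i. (if i = 0 then 1 else if i = 1 then c else 0) * x)" for c x :: real
  have ray: "filterlim (ray c) (param_nhds 3) (at 0)" for c
    unfolding ray_def
  proof (rule filterlim_tup)
    fix i :: nat
    have "((\<lambda>x. (if i = 0 then 1 else if i = 1 then c else 0) * x) \<longlongrightarrow> (if i = 0 then 1 else if i = 1 then c else 0) * 0) (at 0)"
      by (intro tendsto_intros)
    then show "((\<lambda>x. (if i = 0 then 1 else if i = 1 then c else 0) * x) \<longlongrightarrow> 0) (at 0)" by simp
  qed
  have ray_v: "ray c x 0 = x" "ray c x 1 = c * x" "ray c x 2 = 0" "ray c x (Suc 0) = c * x" for c x by (simp_all add: ray_def tup_def)
  have lim: "((\<lambda>x. F (ray c x)) \<longlongrightarrow> F (\<lambda>_. 0)) (at 0)" if "smooth_germ 3 F" for F :: "_ \<Rightarrow> real" and c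
    by (rule filterlim_compose[OF sg_tendsto[OF that] ray])
  define w where "w c x = den_inv x (c * x)" for c x
  have w: "(w c \<longlongrightarrow> 1) (at 0)" for c
  proof -
    have "((\<lambda>x. inverse (1 + x\<^sup>2 + (c * x)\<^sup>2)) \<longlongrightarrow> inverse (1 + 0\<^sup>2 + (c * 0)\<^sup>2)) (at 0)"
      by (intro tendsto_intros) simp
    then show ?thesis by (simp add: w_def[abs_def] den_inv_def)
  qed
  have ne: "\<forall>\<^sub>F x::real in at 0. x \<noteq> 0" by (simp add: eventually_neq_at_within)
  have pt_ray: "pt (ray c x) = vector [x, c * x]" for c x by (simp add: pt_def ray_v)
  have nsq_ray: "nsq (ray c x) = (1 + c\<^sup>2) * x\<^sup>2" for c x by (simp add: nsq_def ray_v power_mult_distrib algebra_simps)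
  have v0: "v 0 = 0"
  proof -
    have ev: "\<forall>\<^sub>F x in at 0. x\<^sup>2 * (A (ray 0 x) $ 1 $ 2 * k * w 0 x) = v 0"
      using eventually_compose_filterlim[OF E ray[of 0]] ne
    proof eventually_elim
      case (elim x)
      from elim(1) have "(v 0 *\<^sub>R pt (ray 0 x) + (v 1 + v 2 * nsq (ray 0 x)) *\<^sub>R pt (rot (ray 0 x))) $ 1
          = (A (ray 0 x) *v F4 k (pt (ray 0 x)) + X1 (ray 0 x) *\<^sub>R F4x k (ray 0 x) + X2 (ray 0 x) *\<^sub>R F4y k (ray 0 x)) $ 1"
        by (simp only: ray_v)
      then have "v 0 * x = A (ray 0 x) $ 1 $ 2 * (k * x ^ 3 * den_inv x 0)"
        by (simp add: ray_v pt_ray F4_nth matrix_vector_mult_def sum_2 F4x_def F4y_def Let_def)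
      then have "v 0 * x = (x\<^sup>2 * (A (ray 0 x) $ 1 $ 2 * k * w 0 x)) * x" by (simp add: w_def power2_eq_square power3_eq_cube mult_ac)
      then show ?case using elim(2) by (metis mult_right_cancel)
    qed
    have "((\<lambda>x. x\<^sup>2 * (A (ray 0 x) $ 1 $ 2 * k * w 0 x)) \<longlongrightarrow> 0\<^sup>2 * (A (\<lambda>_. 0) $ 1 $ 2 * k * 1)) (at 0)"
      by (intro tendsto_intros lim A w)
    from tendsto_unique[OF at_neq_bot tendsto_const Lim_transform_eventually[OF this ev]]
    show ?thesis by simp
  qed
  define B where "B c x = - (A (ray c x) $ 2 $ 1 * k * c ^ 3 * w c x) + A (ray c x) $ 2 $ 2 * k * w c x
     + (P (ray c x) + c * Q ((ray c x)(0 := 0))) * (3 * k * w c x - 2 * k * x\<^sup>2 * (w c x)\<^sup>2)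
     - X2 (ray c x) * (2 * k * c * x * (w c x)\<^sup>2)" for c x
  define B0 where "B0 c = - (A (\<lambda>_. 0) $ 2 $ 1 * k * c ^ 3) + A (\<lambda>_. 0) $ 2 $ 2 * k + (P (\<lambda>_. 0) + c * Q (\<lambda>_. 0)) * (3 * k)" for c
  have B: "(B c \<longlongrightarrow> B0 c) (at 0)" for c
  proof -
    have q0: "((\<lambda>x. Q ((ray c x)(0 := 0))) \<longlongrightarrow> Q ((\<lambda>_. 0)(0 := 0))) (at 0)" by (rule lim[OF Q0])
    have "(B c \<longlongrightarrow> - (A (\<lambda>_. 0) $ 2 $ 1 * k * c ^ 3 * 1) + A (\<lambda>_. 0) $ 2 $ 2 * k * 1
       + (P (\<lambda>_. 0) + c * Q ((\<lambda>_. 0)(0 := 0))) * (3 * k * 1 - 2 * k * 0\<^sup>2 * 1\<^sup>2)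
       - X2 (\<lambda>_. 0) * (2 * k * c * 0 * 1\<^sup>2)) (at 0)"
      unfolding B_def[abs_def] by (intro tendsto_intros lim A P X w q0)
    moreover have "(\<lambda>_. 0)(0 := 0) = (\<lambda>_::nat. 0::real)" by auto
    ultimately show ?thesis by (simp add: B0_def)
  qed
  have key: "\<forall>\<^sub>F x in at 0. v 1 + v 2 * (1 + c\<^sup>2) * x\<^sup>2 = x\<^sup>2 * B c x" for c
    using eventually_compose_filterlim[OF E ray[of c]] eventually_compose_filterlim[OF X1_form ray[of c]] ne
  proof eventually_elim
    case (elim x)
    have X1x: "X1 (ray c x) = x * P (ray c x) + c * x * Q ((ray c x)(0 := 0))" using elim(2) by (simp add: ray_v)
    have "(v 1 + v 2 * (1 + c\<^sup>2) * x\<^sup>2) * x = A (ray c x) $ 2 $ 1 * (- (k * (c * x) ^ 3 * w c x)) + A (ray c x) $ 2 $ 2 * (k * x ^ 3 * w c x)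
         + X1 (ray c x) * (3 * k * x\<^sup>2 * w c x - 2 * k * x ^ 4 * (w c x)\<^sup>2)
         + X2 (ray c x) * (- (2 * k * x ^ 3 * (c * x) * (w c x)\<^sup>2))"
    proof -
      from elim(1) have "(v 0 *\<^sub>R pt (ray c x) + (v 1 + v 2 * nsq (ray c x)) *\<^sub>R pt (rot (ray c x))) $ 2
          = (A (ray c x) *v F4 k (pt (ray c x)) + X1 (ray c x) *\<^sub>R F4x k (ray c x) + X2 (ray c x) *\<^sub>R F4y k (ray c x)) $ 2"
        by (simp only: ray_v)
      then show ?thesis
        using v0 by (simp add: ray_v pt_ray F4_nth nsq_ray w_def matrix_vector_mult_def sum_2 F4x_def F4y_def Let_def mult.assoc)
    qed
    also have "\<dots> = (x\<^sup>2 * B c x) * x"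
      unfolding X1x B_def by (simp add: power2_eq_square power3_eq_cube power4_eq_xxxx algebra_simps)
    finally show ?case using elim(3) by (metis mult_right_cancel)
  qed
  have v1: "v 1 = 0"
  proof -
    have "((\<lambda>x. v 1 + v 2 * (1 + 0\<^sup>2) * x\<^sup>2) \<longlongrightarrow> v 1 + v 2 * (1 + 0\<^sup>2) * 0\<^sup>2) (at 0)" by (intro tendsto_intros)
    moreover have "((\<lambda>x. x\<^sup>2 * B 0 x) \<longlongrightarrow> 0\<^sup>2 * B0 0) (at 0)" by (intro tendsto_intros B)
    then have "((\<lambda>x. v 1 + v 2 * (1 + 0\<^sup>2) * x\<^sup>2) \<longlongrightarrow> 0\<^sup>2 * B0 0) (at 0)"
      by (rule Lim_transform_eventually) (use key[of 0] in \<open>rule eventually_mono, simp\<close>)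
    ultimately have "v 1 + v 2 * (1 + 0\<^sup>2) * 0\<^sup>2 = 0\<^sup>2 * B0 0" by (rule tendsto_unique[OF at_neq_bot])
    then show ?thesis by simp
  qed
  have v2: "v 2 * (1 + c\<^sup>2) = B0 c" for c
  proof -
    have "\<forall>\<^sub>F x in at 0. B c x = v 2 * (1 + c\<^sup>2)"
      using key[of c] ne
    proof eventually_elim
      case (elim x)
      from elim(1) have "x\<^sup>2 * B c x = x\<^sup>2 * (v 2 * (1 + c\<^sup>2))" unfolding v1 by (metis add_0 mult.commute)
      then show ?case using elim(2) by simp
    qed
    from tendsto_unique[OF at_neq_bot tendsto_const Lim_transform_eventually[OF B this]]
    show ?thesis by simp
  qed
  have "v 2 = 0" using v2[of 0] v2[of 1] v2[of "-1"] by (simp add: B0_def algebra_simps)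
  then show False using v v0 v1 by simp
qed

theorem proposition2p2:
  fixes k :: real
  assumes "1 < k" and "k < 2 / sqrt 3"
  shows "Z4_universal_unfolding 3 (F4 k) (\<lambda>v p. G4 k v (p 0) (p 1) (p 2))"
proof -
  have k: "k \<noteq> 0" using assms(1) by simp
  show ?thesis
    unfolding Z4_universal_unfolding_def Z4_versal_unfolding_def
    using G4_unfolding G4_versal[OF k] versal_needs_three_parameters[OF k]
    by (simp add: Z4_versal_unfolding_def)
qed

end
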